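(* Assume $\gamma^\#_+>0>\gamma^\#_-$. Let $\zeta_2>\zeta_1>0$ and suppose $G(s)=g(s)/d$ satisfies: $G$ is continuous on $[0,\infty)$, positive for $s>0$, with right derivative $G'(0+)>1$; $G([\zeta_1,\zeta_2])\subseteq[\zeta_1,\zeta_2]$ and $G([0,\infty))\subseteq[0,\zeta_2]$; $\min_{s\in[\zeta_1,\zeta_2]}G(s)=G(\zeta_1)$ and $G(s)>s$ for $s\in(0,\zeta_1]$. Assume also $g(s)\leq g'(0)s$ for all $s\geq0$. Then for every $c\in\left((-\infty,c_*^-]\cup[c_*^+,+\infty)\right)\setminus\{0\}$ the lattice equation (LE) has at least one semi-wavefront $w_j(t)=\phi_c(j+ct)$ with $\phi_c\leq\zeta_2$. Moreover, if $c\leq c_*^-$ then $\phi_c(+\infty)=0$ and $\liminf_{s\to-\infty}\phi_c(s)>\zeta_1$; if $c\geq c_*^+$ then $\phi_c(-\infty)=0$ and $\liminf_{s\to+\infty}\phi_c(s)>\zeta_1$; and if $G(s)=s$ has only the two solutions $0,\kappa$ in $[0,\infty)$ with $\kappa$ globally attracting for $G:(0,\zeta_2]\to(0,\zeta_2]$, then $\phi_c$ converges to $\kappa$ at the end of $\mathbb{R}$ where it does not vanish.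
   Context: Let $D>0$, $d>0$, $r\geq0$, and $\beta:\mathbb{Z}\to[0,\infty)$ with $\sum_{k\in\mathbb{Z}}\beta(k)=1$. Let $g:[0,\infty)\to[0,\infty)$ be continuous with $g(0)=0$ and finite derivative $g'(0)$. Lattice equation (LE): $w_j'(t)=D[w_{j+1}(t)-2w_j(t)+w_{j-1}(t)]-dw_j(t)+\sum_{k\in\mathbb{Z}}\beta(j-k)g(w_k(t-r))$, $j\in\mathbb{Z}$. A semi-wavefront is a solution $w_j(t)=\phi(j+ct)$ with $\phi$ positive, bounded, and $\phi(-\infty)=0$ or $\phi(+\infty)=0$; equivalently $\phi$ is a positive bounded solution of $c\phi'(x)=D[\phi(x+1)+\phi(x-1)-2\phi(x)]-d\phi(x)+\sum_{k}\beta(k)g(\phi(x-k-cr))$. Let $\gamma^\#_-\leq0\leq\gamma^\#_+$ (extended reals) be such that $\sum_k\beta(k)e^{-zk}$ converges for $z\in(\gamma^\#_-,\gamma^\#_+)$ and diverges for $z>\gamma^\#_+$ and for $z<\gamma^\#_-$. Let $\tilde\chi(z,c)=d+2D+cz-D(e^z+e^{-z})-g'(0)e^{-crz}\sum_{k}\beta(k)e^{-kz}$ for $z\in(\gamma^\#_-,\gamma^\#_+)$ with $d+2D+cz>0$. Critical speeds: $c_*^+=\inf\{c:\tilde\chi(z,c)=0$ for some such $z>0\}$, $c_*^-=\sup\{c:\tilde\chi(z,c)=0$ for some such $z<0\}$ (these are real numbers with $c_*^-<c_*^+$ under the hypotheses). "Globally attracting" means iterates of every $s\in(0,\zeta_2]$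 under $G$ converge to $\kappa$. *)

theory Defs
  imports "HOL-Analysis.Analysis"
begin

definition gamma_plus :: "(int \<Rightarrow> real) \<Rightarrow> ereal" where
  "gamma_plus \<beta> = Sup {ereal z | z. (\<lambda>k. \<beta> k * exp (- z * real_of_int k)) summable_on UNIV}"

definition gamma_minus :: "(int \<Rightarrow> real) \<Rightarrow> ereal" where
  "gamma_minus \<beta> = Inf {ereal z | z. (\<lambda>k. \<beta> k * exp (- z * real_of_int k)) summable_on UNIV}"

text \<open>The characteristic function chi~(z,c); gp stands for g'(0).\<close>
definition chi :: "real \<Rightarrow> real \<Rightarrow> real \<Rightarrow> (int \<Rightarrow> real) \<Rightarrow> real \<Rightarrow> real \<Rightarrow> real \<Rightarrow> real" where
  "chi D d r \<beta> gp z c = d + 2 * D + c * z - D * (exp z + exp (- z))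
     - gp * exp (- c * r * z) * (\<Sum>\<^sub>\<infinity>k. \<beta> k * exp (- real_of_int k * z))"

definition admissible_z :: "real \<Rightarrow> real \<Rightarrow> (int \<Rightarrow> real) \<Rightarrow> real \<Rightarrow> real \<Rightarrow> bool" where
  "admissible_z D d \<beta> z c \<longleftrightarrow>
     gamma_minus \<beta> < ereal z \<and> ereal z < gamma_plus \<beta> \<and> d + 2 * D + c * z > 0"

definition cstar_plus :: "real \<Rightarrow> real \<Rightarrow> real \<Rightarrow> (int \<Rightarrow> real) \<Rightarrow> real \<Rightarrow> real" where
  "cstar_plus D d r \<beta> gp =
     Inf {c. \<exists>z>0. admissible_z D d \<beta> z c \<and> chi D d r \<beta> gp z c = 0}"

definition cstar_minus :: "real \<Rightarrow> real \<Rightarrow> real \<Rightarrow> (int \<Rightarrow> real) \<Rightarrow> real \<Rightarrow> real" where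
  "cstar_minus D d r \<beta> gp =
     Sup {c. \<exists>z<0. admissible_z D d \<beta> z c \<and> chi D d r \<beta> gp z c = 0}"

text \<open>Profile equation of a travelling solution w_j(t) = phi(j + c t) of (LE).\<close>
definition profile_eq :: "real \<Rightarrow> real \<Rightarrow> real \<Rightarrow> (int \<Rightarrow> real) \<Rightarrow> (real \<Rightarrow> real)
    \<Rightarrow> real \<Rightarrow> (real \<Rightarrow> real) \<Rightarrow> bool" where
  "profile_eq D d r \<beta> g c \<phi> \<longleftrightarrow>
     (\<forall>x. \<phi> differentiable (at x) \<and>
        c * deriv \<phi> x = D * (\<phi> (x + 1) + \<phi> (x - 1) - 2 * \<phi> x) - d * \<phi> x
          + (\<Sum>\<^sub>\<infinity>k. \<beta> k * g (\<phi> (x - real_of_int k - c * r))))"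

definition semi_wavefront :: "real \<Rightarrow> real \<Rightarrow> real \<Rightarrow> (int \<Rightarrow> real) \<Rightarrow> (real \<Rightarrow> real)
    \<Rightarrow> real \<Rightarrow> (real \<Rightarrow> real) \<Rightarrow> bool" where
  "semi_wavefront D d r \<beta> g c \<phi> \<longleftrightarrow>
     profile_eq D d r \<beta> g c \<phi> \<and> (\<forall>x. \<phi> x > 0) \<and> bounded (range \<phi>) \<and>
     ((\<phi> \<longlongrightarrow> 0) at_bot \<or> (\<phi> \<longlongrightarrow> 0) at_top)"

end

theory Submission
  imports Defs "HOL-Probability.Probability"
begin

text \<open>
  Inverting \<open>c \<phi>' + (2 D + d) \<phi>\<close> turns the profile equation into a convolution equation
  \<open>\<phi> = A \<phi>\<close> with \<open>A \<phi> = p \<mu>1 * \<phi> + q \<mu>2 * G(\<phi>)\<close>, where \<open>p + q = 1\<close> and \<open>\<mu>1\<close>, \<open>\<mu>2\<close> are the laws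
  of \<open>c t + k\<close> and \<open>c t + k + c r\<close> for an exponentially distributed \<open>t\<close> and a random lattice
  displacement \<open>k\<close>. A speed \<open>c \<ge> c\<^sub>*\<^sup>+\<close> yields some \<open>\<rho> > 0\<close> with nonnegative characteristic function,
  that is, \<open>u(x) = min \<zeta>2 (exp (\<rho> x))\<close> satisfies \<open>A \<phi> \<le> u\<close> whenever \<open>0 \<le> \<phi> \<le> u\<close>. No subsolution is
  needed: for \<open>\<epsilon> > 0\<close> the Schauder principle gives a fixed point of \<open>\<phi> \<mapsto> max (A \<phi>) (\<epsilon> u)\<close>, which is
  shifted so that it first reaches a small level \<open>\<delta>\<close> at \<open>0\<close>. Integrating \<open>A \<phi> \<le> \<phi>\<close> over the negative
  half-line, where \<open>G(\<phi>) \<ge> (1 + \<eta>) \<phi>\<close>, bounds the integral of \<open>\<phi>\<close> there uniformly in \<open>\<epsilon>\<close>, so the limit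
  \<open>\<epsilon> \<rightarrow> 0\<close> is a nonzero solution vanishing at \<open>-\<infinity>\<close>. It persists at \<open>+\<infinity>\<close> because, by convexity, the Laplace
  transform of the linearised kernel exceeds \<open>1\<close> on the whole half-line \<open>z \<le> 0\<close>, which allows any
  exponential lower bound with negative exponent to be improved until the exponent is \<open>0\<close>. Speeds
  \<open>c \<le> c\<^sub>*\<^sup>-\<close> are reduced to this case by reflecting \<open>\<beta>\<close>.
\<close>

section \<open>Fixed points in order intervals of functions\<close>

text \<open>At a critical speed the exponent may sit at the edge of the strip where the Laplace sum
  converges, which leaves no room for the usual exponential subsolution. Zero is excluded by other
  means: the floor \<open>\<epsilon> * u\<close> does it for the approximations, and translating
  them to height \<open>\<delta>\<close> at the origin carries it to the limit. The price is that
  the bound \<open>exp (\<rho> * x)\<close> is not translation invariant, so decay at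
  \<open>-\<infinity>\<close> has to be recovered from an integral. There \<open>G\<close> gains a
  factor \<open>1 + \<eta>\<close>, whereas convolution loses at most the sup bound times a first
  moment; the moments are finite because the Laplace sum converges on both sides of 0. The floor
  vanishes with \<open>\<epsilon>\<close>, and the place where an approximation rises above
  \<open>\<zeta>1\<close> is not controlled uniformly, so persistence is proved afresh for the
  limit. Compactness comes from the kernels, which make bounded functions Lipschitz with a constant
  proportional to \<open>1 / \<bar>c\<bar>\<close>.\<close>

lemma approx_brouwer_cube:
  fixes F :: "(nat \<Rightarrow> real) \<Rightarrow> nat \<Rightarrow> real" and n :: nat and B e :: real
  assumes B: "B > 0" and e: "e > 0"
    and maps: "\<And>v i. (\<And>j. j < n \<Longrightarrow> v j \<in> {0..B}) \<Longrightarrow> i < n \<Longrightarrow> F v i \<in> {0..B}"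
    and ucont: "\<And>e. e > 0 \<Longrightarrow> \<exists>d>0. \<forall>v w. (\<forall>j<n. v j \<in> {0..B}) \<longrightarrow> (\<forall>j<n. w j \<in> {0..B}) \<longrightarrow>
       (\<forall>j<n. \<bar>v j - w j\<bar> \<le> d) \<longrightarrow> (\<forall>i<n. \<bar>F v i - F w i\<bar> \<le> e)"
  obtains v where "\<And>j. j < n \<Longrightarrow> v j \<in> {0..B}" and "\<And>i. i < n \<Longrightarrow> \<bar>F v i - v i\<bar> \<le> e"
proof -
  obtain d where d: "d > 0" and uc: "\<And>v w i. (\<forall>j<n. v j \<in> {0..B}) \<Longrightarrow> (\<forall>j<n. w j \<in> {0..B}) \<Longrightarrow>
       (\<forall>j<n. \<bar>v j - w j\<bar> \<le> d) \<Longrightarrow> i < n \<Longrightarrow> \<bar>F v i - F w i\<bar> \<le> e / 2"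
    using ucont[of "e / 2"] e by (metis half_gt_zero)
  \<comment> \<open>The mesh \<open>B / p\<close> has to stay below two moduli: \<open>d\<close>, so
    that \<open>uc\<close> compares the vertices of one cell, and \<open>e / 2\<close>, so that the
    vertices themselves differ little.\<close>
  obtain p :: nat where p: "p > 0" and pd: "B / p \<le> min d (e / 2)"
  proof -
    obtain p :: nat where "B / min d (e / 2) < real p" using reals_Archimedean2 by blast
    moreover have "min d (e / 2) > 0" using d e by auto
    ultimately have "B \<le> real p * min d (e / 2)" by (simp add: pos_divide_less_eq)
    moreover have "p > 0"
      using \<open>B / min d (e / 2) < real p\<close> \<open>min d (e / 2) > 0\<close> B by (metis divide_pos_pos less_trans of_nat_0_less_iff)
    ultimately show ?thesis by (intro that[of p]) (metis mult.commute of_nat_0_less_iff pos_divide_le_eq)+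
  qed
  define V where "V x = (\<lambda>i. B * real (x i) / real p)" for x :: "nat \<Rightarrow> nat"
  \<comment> \<open>The label records whether \<open>F\<close> pushes coordinate \<open>i\<close> up
    or down. Kuhn's lemma prescribes its value on the faces \<open>x i = 0\<close> and
    \<open>x i = p\<close>; this agrees with the push because \<open>F\<close> maps the cube into
    itself.\<close>
  define label where "label x i = (if x i = 0 \<or> (x i \<noteq> p \<and> F (V x) i \<ge> V x i) then 0 else (1::nat))" for x i
  have V_mem: "V x j \<in> {0..B}" if "x j \<le> p" for x j
    using that p B by (auto simp: V_def divide_le_eq)
  \<comment> \<open>In each coordinate two vertices of the cell at \<open>q\<close> carry different
    labels, so \<open>F v i - v i\<close> takes both signs on the cell and is small at
    \<open>V q\<close>.\<close>
  obtain q where q: "\<forall>i<n. q i < p"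
    "\<forall>i<n. \<exists>r s. (\<forall>j<n. q j \<le> r j \<and> r j \<le> q j + 1) \<and> (\<forall>j<n. q j \<le> s j \<and> s j \<le> q j + 1) \<and> label r i \<noteq> label s i"
    by (rule kuhn_lemma[of p n label]) (use p in \<open>auto simp: label_def\<close>)
  have near: "\<bar>V r j - V q j\<bar> \<le> min d (e / 2)" if "q j \<le> r j" "r j \<le> q j + 1" for r j
  proof -
    have "V r j - V q j = B / p * (real (r j) - real (q j))"
      by (simp add: V_def right_diff_distrib diff_divide_distrib)
    moreover have "0 \<le> real (r j) - real (q j)" "real (r j) - real (q j) \<le> 1" using that by linarith+
    ultimately have "\<bar>V r j - V q j\<bar> = B / p * (real (r j) - real (q j))"
      using B by simp
    also have "\<dots> \<le> B / p * 1"
      using B \<open>real (r j) - real (q j) \<le> 1\<close> by (intro mult_left_mono) auto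
    finally have "\<bar>V r j - V q j\<bar> \<le> B / p * 1" .
    then show ?thesis using pd by linarith
  qed
  have box: "\<forall>j<n. V r j \<in> {0..B}" if "\<forall>j<n. q j \<le> r j \<and> r j \<le> q j + 1" for r
    using that q(1) by (metis V_mem Suc_eq_plus1 Suc_leI le_trans)
  have low: "F (V q) i \<ge> V q i - e" if r: "\<forall>j<n. q j \<le> r j \<and> r j \<le> q j + 1" "label r i = 0" and i: "i < n" for r i
  proof -
    have "F (V r) i \<ge> V r i"
    proof (cases "r i = 0")
      case True then show ?thesis using maps[of "V r" i] box[OF r(1)] i by (simp add: V_def)
    next
      case False then show ?thesis using r(2) by (auto simp: label_def split: if_splits)
    qed
    moreover have "\<bar>F (V r) i - F (V q) i\<bar> \<le> e / 2"
      by (rule uc) (use box[of r] box[of q] r near i in auto)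
    moreover have "\<bar>V r i - V q i\<bar> \<le> e / 2" using near[of i r] r i by auto
    ultimately show ?thesis by linarith
  qed
  have up: "F (V q) i \<le> V q i + e" if r: "\<forall>j<n. q j \<le> r j \<and> r j \<le> q j + 1" "label r i \<noteq> 0" and i: "i < n" for r i
  proof -
    have "F (V r) i \<le> V r i"
    proof (cases "r i = p")
      case True then show ?thesis using maps[of "V r" i] box[OF r(1)] i p by (simp add: V_def)
    next
      case False then show ?thesis using r(2) by (auto simp: label_def split: if_splits)
    qed
    moreover have "\<bar>F (V r) i - F (V q) i\<bar> \<le> e / 2"
      by (rule uc) (use box[of r] box[of q] r near i in auto)
    moreover have "\<bar>V r i - V q i\<bar> \<le> e / 2" using near[of i r] r i by auto
    ultimately show ?thesis by linarith
  qed
  show ?thesis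
  proof (rule that[of "V q"])
    show "V q j \<in> {0..B}" if "j < n" for j using box[of q] that by auto
    show "\<bar>F (V q) i - V q i\<bar> \<le> e" if i: "i < n" for i
    proof -
      obtain r s where rs: "\<forall>j<n. q j \<le> r j \<and> r j \<le> q j + 1" "\<forall>j<n. q j \<le> s j \<and> s j \<le> q j + 1" "label r i \<noteq> label s i"
        using q(2) i by blast
      moreover have "label x i = 0 \<or> label x i = 1" for x by (simp add: label_def)
      ultimately have "F (V q) i \<ge> V q i - e \<and> F (V q) i \<le> V q i + e"
        using low[of r i] low[of s i] up[of r i] up[of s i] i by (cases "label r i = 0") (metis, metis)
      then show ?thesis by auto
    qed
  qed
qed

lemma eventually_abs_less_real: "eventually (\<lambda>n. \<bar>x\<bar> < real n) sequentially"
  by (rule eventually_sequentiallyI[of "Suc (nat \<lceil>\<bar>x\<bar>\<rceil>)"]) linarith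

lemma lipschitz_continuous_on_UNIV:
  fixes f :: "real \<Rightarrow> real"
  assumes "\<And>x y. \<bar>f x - f y\<bar> \<le> L * \<bar>x - y\<bar>"
  shows "continuous_on UNIV f"
proof (rule lipschitz_on_continuous_on)
  show "L-lipschitz_on UNIV f"
    using assms assms[of 0 1] by (intro lipschitz_onI) (auto simp: dist_real_def)
qed

text \<open>Arzela-Ascoli in pointwise form. The restrictions to the rationals lie in a countable
  product of compact intervals, which is sequentially compact, and the common Lipschitz constant
  extends convergence from the rationals to every real.\<close>

lemma lipschitz_sequence_pointwise_limit:
  fixes \<phi> :: "nat \<Rightarrow> real \<Rightarrow> real" and B L :: real
  assumes bound: "\<And>n x. \<phi> n x \<in> {0..B}"
    and lip: "\<And>n x y. \<bar>\<phi> n x - \<phi> n y\<bar> \<le> L * \<bar>x - y\<bar>"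
  obtains r \<psi> where "strict_mono (r :: nat \<Rightarrow> nat)" and "\<And>x. (\<lambda>n. \<phi> (r n) x) \<longlonglongrightarrow> \<psi> x"
proof -
  define X where "X n = (\<lambda>q::rat. \<phi> n (of_rat q))" for n
  have "compact (Pi\<^sub>E UNIV (\<lambda>_::rat. {0..B}))"
    using compactin_PiE[of "\<lambda>_::rat. euclidean" UNIV "\<lambda>_. {0..B}"]
    by (simp add: euclidean_product_topology)
  then have "seq_compact (Pi\<^sub>E UNIV (\<lambda>_::rat. {0..B}))"
    by (simp add: compact_eq_seq_compact_metric)
  moreover have "\<forall>n. X n \<in> Pi\<^sub>E UNIV (\<lambda>_::rat. {0..B})"
    using bound by (auto simp: X_def)
  ultimately obtain l r where l: "strict_mono r" "(X \<circ> r) \<longlonglongrightarrow> l"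
    unfolding seq_compact_def by meson
  have lq: "(\<lambda>n. \<phi> (r n) (of_rat q)) \<longlonglongrightarrow> l q" for q
  proof -
    have "isCont (\<lambda>f :: rat \<Rightarrow> real. f q) l"
      using continuous_on_product_coordinates[of q] continuous_on_eq_continuous_at[OF open_UNIV] by blast
    from isCont_tendsto_compose[OF this l(2)] show ?thesis by (simp add: X_def)
  qed
  have L0: "L \<ge> 0" using lip[of 0 1 0] by simp
  have "Cauchy (\<lambda>n. \<phi> (r n) x)" for x
  proof (rule metric_CauchyI)
    fix e :: real assume e: "e > 0"
    \<comment> \<open>\<open>L + 1\<close> avoids division by zero when \<open>L = 0\<close>. The
      two Lipschitz errors stay below \<open>e / 4\<close> each, the difference at the rational
      point below \<open>e / 2\<close>.\<close>
    define h where "h = e / (4 * (L + 1))"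
    have "h > 0" using e L0 by (simp add: h_def)
    then obtain q where q: "\<bar>x - of_rat q\<bar> < h"
      using of_rat_dense[of "x - h" "x + h"] by (auto simp: abs_less_iff) (smt (verit))
    have "L * \<bar>x - of_rat q\<bar> \<le> L * h" using q L0 by (simp add: mult_left_mono)
    also have "\<dots> < e / 4" using e L0 by (simp add: h_def field_simps)
    finally have small: "L * \<bar>x - of_rat q\<bar> < e / 4" .
    obtain M where M: "\<And>m n. m \<ge> M \<Longrightarrow> n \<ge> M \<Longrightarrow> \<bar>\<phi> (r m) (of_rat q) - \<phi> (r n) (of_rat q)\<bar> < e / 2"
      using LIMSEQ_imp_Cauchy[OF lq[of q]] e unfolding Cauchy_def dist_real_def by (meson half_gt_zero)
    show "\<exists>M. \<forall>m\<ge>M. \<forall>n\<ge>M. dist (\<phi> (r m) x) (\<phi> (r n) x) < e"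
    proof (intro exI[of _ M] allI impI)
      fix m n assume "m \<ge> M" "n \<ge> M"
      then show "dist (\<phi> (r m) x) (\<phi> (r n) x) < e"
        using M[of m n] lip[of "r m" x "of_rat q"] lip[of "r n" x "of_rat q"] small
        unfolding dist_real_def by linarith
    qed
  qed
  then have "\<exists>y. (\<lambda>n. \<phi> (r n) x) \<longlonglongrightarrow> y" for x
    by (simp add: Cauchy_convergent_iff convergent_def)
  then show ?thesis using that[OF l(1)] by metis
qed

text \<open>Schauder's theorem for pointwise convergence, with compactness supplied by
  \<open>lip\<close>. The order interval contains discontinuous functions because the
  finite-dimensional approximants are step functions. \<open>ucont\<close> is needed to apply
  Brouwer on the grid; \<open>scont\<close> is needed in the limit, where the step functions
  converge only pointwise.\<close>

lemma order_interval_fixed_point: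
  fixes T :: "(real \<Rightarrow> real) \<Rightarrow> real \<Rightarrow> real" and u :: "real \<Rightarrow> real" and B L :: real
  defines "X \<equiv> {\<phi> \<in> borel_measurable borel. \<forall>x. 0 \<le> \<phi> x \<and> \<phi> x \<le> u x}"
  assumes B: "B > 0" and u_meas: "u \<in> borel_measurable borel" and u: "\<And>x. u x \<in> {0..B}"
    and maps: "\<And>\<phi> x. \<phi> \<in> X \<Longrightarrow> 0 \<le> T \<phi> x \<and> T \<phi> x \<le> u x"
    and lip: "\<And>\<phi> x y. \<phi> \<in> X \<Longrightarrow> \<bar>T \<phi> x - T \<phi> y\<bar> \<le> L * \<bar>x - y\<bar>"
    and ucont: "\<And>e. e > 0 \<Longrightarrow> \<exists>d>0. \<forall>\<phi>\<in>X. \<forall>\<psi>\<in>X. (\<forall>x. \<bar>\<phi> x - \<psi> x\<bar> \<le> d) \<longrightarrow> (\<forall>x. \<bar>T \<phi> x - T \<psi> x\<bar> \<le> e)"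
    and scont: "\<And>\<phi> \<psi> x. (\<And>n. \<phi> n \<in> X) \<Longrightarrow> \<psi> \<in> X \<Longrightarrow> (\<And>x. (\<lambda>n. \<phi> n x) \<longlonglongrightarrow> \<psi> x) \<Longrightarrow> (\<lambda>n. T (\<phi> n) x) \<longlonglongrightarrow> T \<psi> x"
  obtains \<phi> where "\<phi> \<in> X" and "T \<phi> = \<phi>"
proof -
  \<comment> \<open>\<open>S N v\<close> is the step function with values \<open>v\<close> on a grid of mesh \<open>1 / N\<close>, clipped to the order
    interval. Since \<open>T (S N v)\<close> is Lipschitz, an approximate fixed point of \<open>v \<mapsto> T (S N v)\<close> on the grid
    is uniformly close to \<open>S N v\<close>.\<close>
  define S where "S N v x = (if - (int N)\<^sup>2 \<le> \<lfloor>real N * x\<rfloor> \<and> \<lfloor>real N * x\<rfloor> < (int N)\<^sup>2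
      then min (u x) (max 0 (v (nat (\<lfloor>real N * x\<rfloor> + (int N)\<^sup>2)))) else 0)" for N and v :: "nat \<Rightarrow> real" and x :: real
  have S_X: "S N v \<in> X" for N v
  proof -
    have "S N v \<in> borel_measurable borel"
      unfolding S_def using u_meas by measurable
    moreover have "0 \<le> S N v x \<and> S N v x \<le> u x" for x
      using u[of x] by (auto simp: S_def)
    ultimately show ?thesis by (simp add: X_def)
  qed
  have L0: "L \<ge> 0" using lip[OF S_X, of 0 "\<lambda>_. 0" 1 0] by simp
  have approx: "\<exists>v. \<forall>x. \<bar>x\<bar> < real N \<longrightarrow> \<bar>T (S N v) x - S N v x\<bar> \<le> (L + 1) / N" if N: "N > 0" for N :: nat
  proof -
    \<comment> \<open>The points \<open>g i\<close> for \<open>i < n\<close> run through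
      \<open>[-N, N)\<close> with mesh \<open>1 / N\<close>, so the window grows while the mesh
      shrinks.\<close>
    define n where "n = 2 * N\<^sup>2"
    define g where "g i = (real i - (real N)\<^sup>2) / real N" for i :: nat
    define F where "F v i = T (S N v) (g i)" for v i
    have "\<exists>v. (\<forall>j<n. v j \<in> {0..B}) \<and> (\<forall>i<n. \<bar>F v i - v i\<bar> \<le> 1 / N)"
    proof (rule approx_brouwer_cube[of B "1 / N" n F])
      show "F v i \<in> {0..B}" for v i
        using maps[OF S_X, of N v "g i"] u[of "g i"] by (auto simp: F_def)
      fix e :: real assume "e > 0"
      then obtain d where d: "d > 0" "\<And>\<phi> \<psi> x. \<phi> \<in> X \<Longrightarrow> \<psi> \<in> X \<Longrightarrow> (\<forall>x. \<bar>\<phi> x - \<psi> x\<bar> \<le> d) \<Longrightarrow> \<bar>T \<phi> x - T \<psi> x\<bar> \<le> e"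
        using ucont by meson
      have close: "\<bar>S N v x - S N w x\<bar> \<le> d" if "\<forall>j<n. \<bar>v j - w j\<bar> \<le> d" for v w x
      proof (cases "- (int N)\<^sup>2 \<le> \<lfloor>real N * x\<rfloor> \<and> \<lfloor>real N * x\<rfloor> < (int N)\<^sup>2")
        case True
        then have "nat (\<lfloor>real N * x\<rfloor> + (int N)\<^sup>2) < n" 
          unfolding n_def by (simp add: nat_less_iff)
        then have "\<bar>v (nat (\<lfloor>real N * x\<rfloor> + (int N)\<^sup>2)) - w (nat (\<lfloor>real N * x\<rfloor> + (int N)\<^sup>2))\<bar> \<le> d"
          using that by blast
        moreover have "\<bar>min s (max 0 y) - min s (max 0 z)\<bar> \<le> \<bar>y - z\<bar>" for s y z :: real
          by (simp add: min_def max_def)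
        ultimately show ?thesis using True by (auto simp: S_def intro: order_trans)
      next
        case False
        then show ?thesis using d(1) by (auto simp: S_def)
      qed
      show "\<exists>d>0. \<forall>v w. (\<forall>j<n. v j \<in> {0..B}) \<longrightarrow> (\<forall>j<n. w j \<in> {0..B}) \<longrightarrow>
           (\<forall>j<n. \<bar>v j - w j\<bar> \<le> d) \<longrightarrow> (\<forall>i<n. \<bar>F v i - F w i\<bar> \<le> e)"
        using d(1) by (intro exI[of _ d]) (auto simp: F_def intro!: d(2) S_X close)
    qed (use B N in auto)
    then obtain v where v: "\<And>j. j < n \<Longrightarrow> v j \<in> {0..B}" "\<And>i. i < n \<Longrightarrow> \<bar>F v i - v i\<bar> \<le> 1 / N" by blast
    have "\<bar>T (S N v) x - S N v x\<bar> \<le> (L + 1) / N" if x: "\<bar>x\<bar> < real N" for x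
    proof -
      define k where "k = \<lfloor>real N * x\<rfloor>"
      define i where "i = nat (k + (int N)\<^sup>2)"
      have "\<bar>real N * x\<bar> < (real N)\<^sup>2"
        using x N by (simp add: abs_mult power2_eq_square)
      then have "- ((real N)\<^sup>2) \<le> real N * x" "real N * x < (real N)\<^sup>2" by linarith+
      then have k: "- (int N)\<^sup>2 \<le> k" "k < (int N)\<^sup>2"
        unfolding k_def by (simp_all add: le_floor_iff floor_less_iff)
      have i: "i < n" using k by (simp add: i_def n_def nat_less_iff)
      have ri: "real i = k + (real N)\<^sup>2" using k by (simp add: i_def)
      have "S N v x = min (u x) (v i)"
        using k v(1)[OF i] by (simp add: S_def flip: k_def i_def)
      \<comment> \<open>Both values are written as clipped at \<open>u x\<close>. Clipping does not
        increase distances, so it suffices to compare \<open>T (S N v) x\<close> with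
        \<open>v i\<close>.\<close>
      moreover have "T (S N v) x = min (u x) (T (S N v) x)"
        using maps[OF S_X] by (simp add: min_absorb2)
      moreover have "\<bar>x - g i\<bar> \<le> 1 / N"
      proof -
        have "x - g i = (real N * x - k) / N" using N by (simp add: g_def ri field_simps)
        moreover have "0 \<le> real N * x - k" "real N * x - k \<le> 1" unfolding k_def by linarith+
        ultimately show ?thesis using N by (simp add: divide_right_mono)
      qed
      then have "L * \<bar>x - g i\<bar> \<le> L / N" using L0 mult_left_mono[of "\<bar>x - g i\<bar>" "1 / N" L] by simp
      then have "\<bar>T (S N v) x - v i\<bar> \<le> L / N + 1 / N"
        using lip[OF S_X, of N v x "g i"] v(2)[OF i] unfolding F_def by linarith
      moreover have "(L + 1) / N = L / N + 1 / N" by (simp add: add_divide_distrib)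
      ultimately show ?thesis by (smt (verit))
    qed
    then show ?thesis by blast
  qed
  then obtain v where v: "\<And>N x. N > 0 \<Longrightarrow> \<bar>x\<bar> < real N \<Longrightarrow> \<bar>T (S N (v N)) x - S N (v N) x\<bar> \<le> (L + 1) / N"
    by metis
  define \<psi> where "\<psi> N = T (S N (v N))" for N
  obtain r \<phi> where r: "strict_mono r" and lim: "\<And>x. (\<lambda>n. \<psi> (r n) x) \<longlonglongrightarrow> \<phi> x"
  proof (rule lipschitz_sequence_pointwise_limit[of \<psi> B L])
    show "\<psi> n x \<in> {0..B}" for n x using maps[OF S_X, of n "v n" x] u[of x] by (auto simp: \<psi>_def)
    show "\<bar>\<psi> n x - \<psi> n y\<bar> \<le> L * \<bar>x - y\<bar>" for n x y using lip[OF S_X] by (simp add: \<psi>_def)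
  qed blast
  have lipT: "continuous_on UNIV (\<psi> N)" for N
    unfolding \<psi>_def by (rule lipschitz_continuous_on_UNIV[OF lip[OF S_X]])
  have \<phi>_X: "\<phi> \<in> X"
  proof -
    have "\<phi> \<in> borel_measurable borel"
      by (rule borel_measurable_LIMSEQ_real[OF lim]) (use lipT borel_measurable_continuous_onI in blast)
    moreover have "0 \<le> \<phi> x \<and> \<phi> x \<le> u x" for x
      using LIMSEQ_le_const[OF lim[of x], of 0] LIMSEQ_le_const2[OF lim[of x], of "u x"] maps[OF S_X]
      by (auto simp: \<psi>_def)
    ultimately show ?thesis by (simp add: X_def)
  qed
  have Slim: "(\<lambda>n. S (r n) (v (r n)) x) \<longlonglongrightarrow> \<phi> x" for x
  proof -
    have "(\<lambda>n. \<psi> (r n) x - S (r n) (v (r n)) x) \<longlonglongrightarrow> 0"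
    proof (rule Lim_null_comparison)
      from eventually_abs_less_real[of x] show "\<forall>\<^sub>F n in sequentially. norm (\<psi> (r n) x - S (r n) (v (r n)) x) \<le> (L + 1) / real n"
      proof eventually_elim
        case (elim n)
        have n: "n \<le> r n" by (rule seq_suble[OF r])
        have n0: "n > 0" using elim by (cases n) auto
        have "\<bar>\<psi> (r n) x - S (r n) (v (r n)) x\<bar> \<le> (L + 1) / r n"
          unfolding \<psi>_def by (rule v) (use n n0 elim in auto)
        also have "\<dots> \<le> (L + 1) / n" using n n0 L0 by (intro divide_left_mono) auto
        finally show ?case by simp
      qed
      show "(\<lambda>n. (L + 1) / real n) \<longlonglongrightarrow> 0" by (rule lim_const_over_n)
    qed
    from tendsto_diff[OF lim[of x] this] show ?thesis by simp
  qed
  have "T \<phi> x = \<phi> x" for x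
    using LIMSEQ_unique[OF scont[OF S_X \<phi>_X Slim, of x] lim[of x, unfolded \<psi>_def]] .
  then show ?thesis using that[OF \<phi>_X] by blast
qed

section \<open>Convolution with a probability measure\<close>

definition conv :: "real measure \<Rightarrow> (real \<Rightarrow> real) \<Rightarrow> real \<Rightarrow> real" where
  "conv \<mu> f x = (\<integral>y. f (x - y) \<partial>\<mu>)"

lemma conv_translate: "conv \<mu> (\<lambda>x. f (x + s)) x = conv \<mu> f (x + s)"
  by (simp add: conv_def algebra_simps)

context real_distribution
begin

lemma integrable_translate:
  fixes f :: "real \<Rightarrow> real"
  assumes "f \<in> borel_measurable borel" "\<And>x. \<bar>f x\<bar> \<le> B"
  shows "integrable M (\<lambda>y. f (x - y))"
  using assms by (intro integrable_const_bound[of _ B]) auto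

lemma conv_const [simp]: "conv M (\<lambda>_. c) x = c"
  using prob_space by (simp add: conv_def)

lemma conv_mono:
  assumes "f \<in> borel_measurable borel" "\<And>x. \<bar>f x\<bar> \<le> B"
    and "g \<in> borel_measurable borel" "\<And>x. \<bar>g x\<bar> \<le> B'"
    and "\<And>x. f x \<le> g x"
  shows "conv M f x \<le> conv M g x"
  unfolding conv_def
  by (intro integral_mono integrable_translate[of f B] integrable_translate[of g B'] assms)

lemma conv_nonneg:
  assumes "\<And>x. 0 \<le> f x"
  shows "0 \<le> conv M f x"
  unfolding conv_def by (intro integral_nonneg_AE) (simp add: assms)

lemma conv_le_const:
  assumes "f \<in> borel_measurable borel" "\<And>x. 0 \<le> f x" "\<And>x. f x \<le> B"
  shows "conv M f x \<le> B"
  using conv_mono[of f B "\<lambda>_. B" "\<bar>B\<bar>" x] assms by (simp add: abs_of_nonneg)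

lemma conv_close:
  assumes "f \<in> borel_measurable borel" "\<And>x. \<bar>f x\<bar> \<le> B"
    and "g \<in> borel_measurable borel" "\<And>x. \<bar>g x\<bar> \<le> B"
    and "\<And>x. \<bar>f x - g x\<bar> \<le> e"
  shows "\<bar>conv M f x - conv M g x\<bar> \<le> e"
proof -
  have int: "integrable M (\<lambda>y. f (x - y))" "integrable M (\<lambda>y. g (x - y))"
    using assms by (auto intro: integrable_translate)
  have "conv M f x - conv M g x = (\<integral>y. f (x - y) - g (x - y) \<partial>M)"
    using int by (simp add: conv_def)
  also have "\<bar>\<dots>\<bar> \<le> (\<integral>y. \<bar>f (x - y) - g (x - y)\<bar> \<partial>M)"
    by (rule integral_abs_bound)
  also have "\<dots> \<le> (\<integral>y. e \<partial>M)"
    using int assms(5) by (intro integral_mono) auto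
  also have "\<dots> = e" using prob_space by simp
  finally show ?thesis .
qed

lemma conv_LIMSEQ:
  assumes "\<And>n. f n \<in> borel_measurable borel" "\<And>n x. \<bar>f n x\<bar> \<le> B"
    and "g \<in> borel_measurable borel" "\<And>x. (\<lambda>n. f n x) \<longlonglongrightarrow> g x"
  shows "(\<lambda>n. conv M (f n) x) \<longlonglongrightarrow> conv M g x"
  unfolding conv_def
  by (rule integral_dominated_convergence[where w = "\<lambda>_. B"]) (use assms in auto)

lemma conv_tendsto_at_top:
  assumes [measurable]: "f \<in> borel_measurable borel" and "\<And>x. \<bar>f x\<bar> \<le> B" and lim: "(f \<longlongrightarrow> c) at_top"
  shows "(conv M f \<longlongrightarrow> c) at_top"
proof -
  have "((\<lambda>x. \<integral>y. f (x - y) \<partial>M) \<longlongrightarrow> (\<integral>y. c \<partial>M)) at_top"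
  proof (rule integral_dominated_convergence_at_top[where w = "\<lambda>_. B"])
    have "filterlim (\<lambda>x. x - y) at_top at_top" for y :: real
      using filterlim_tendsto_add_at_top[OF tendsto_const[of "- y"] filterlim_ident] by simp
    then show "AE y in M. ((\<lambda>x. f (x - y)) \<longlongrightarrow> c) at_top"
      using filterlim_compose[OF lim] by blast
  qed (use assms in auto)
  then show ?thesis using prob_space by (simp add: conv_def[abs_def])
qed

text \<open>Only a one-sided eventual bound on \<open>f\<close> is available, so dominated
  convergence is applied to \<open>min c (f x)\<close>, which does converge, and monotonicity
  returns to \<open>f\<close>.\<close>

lemma conv_eventually_ge:
  assumes f: "f \<in> borel_measurable borel" "\<And>x. \<bar>f x\<bar> \<le> B" and c: "eventually (\<lambda>x. c \<le> f x) at_top" and "e > 0"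
  shows "eventually (\<lambda>x. c - e \<le> conv M f x) at_top"
proof -
  have "((\<lambda>x. min c (f x)) \<longlongrightarrow> c) at_top"
    by (rule tendsto_eventually) (use c in \<open>auto elim: eventually_mono\<close>)
  then have "(conv M (\<lambda>x. min c (f x)) \<longlongrightarrow> c) at_top"
    by (rule conv_tendsto_at_top[of _ "max \<bar>c\<bar> B", rotated 2])
       (use f in \<open>auto simp: min_def le_max_iff_disj\<close>)
  then have "eventually (\<lambda>x. c - e < conv M (\<lambda>x. min c (f x)) x) at_top"
    using \<open>e > 0\<close> by (simp add: order_tendsto_iff)
  moreover have "conv M (\<lambda>x. min c (f x)) x \<le> conv M f x" for x
    by (rule conv_mono[of _ "max \<bar>c\<bar> B" _ B]) (use f in \<open>auto simp: min_def le_max_iff_disj\<close>)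
  ultimately show ?thesis by (auto elim!: eventually_mono intro: order_trans less_imp_le)
qed

lemma conv_uminus: "conv M (\<lambda>x. - f x) x = - conv M f x"
  by (simp add: conv_def)

lemma conv_eventually_le:
  assumes f: "f \<in> borel_measurable borel" "\<And>x. \<bar>f x\<bar> \<le> B" and c: "eventually (\<lambda>x. f x \<le> c) at_top" and "e > 0"
  shows "eventually (\<lambda>x. conv M f x \<le> c + e) at_top"
proof -
  have "eventually (\<lambda>x. - c - e \<le> conv M (\<lambda>x. - f x) x) at_top"
    by (rule conv_eventually_ge[of _ B]) (use assms in auto)
  then show ?thesis by (rule eventually_mono) (simp add: conv_uminus)
qed

lemma conv_ge_measure:
  assumes "f \<in> borel_measurable borel" "\<And>x. 0 \<le> f x" "\<And>x. f x \<le> B"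
    and c: "\<And>y. y \<in> {a<..<b} \<Longrightarrow> c \<le> f (x - y)"
  shows "c * measure M {a<..<b} \<le> conv M f x"
proof -
  have "c * measure M {a<..<b} = (\<integral>y. c * indicator {a<..<b} y \<partial>M)" by simp
  also have "\<dots> \<le> conv M f x" unfolding conv_def
  proof (rule integral_mono)
    show "integrable M (\<lambda>y. c * indicator {a<..<b} y)"
      by (intro integrable_mult_right integrable_real_indicator) (auto simp: emeasure_eq_measure)
    show "integrable M (\<lambda>y. f (x - y))"
      by (rule integrable_translate[of f B]) (use assms in auto)
  qed (use assms in \<open>auto simp: indicator_def\<close>)
  finally show ?thesis .
qed

lemma ennreal_conv:
  assumes "f \<in> borel_measurable borel" "\<And>x. 0 \<le> f x" "\<And>x. f x \<le> B"
  shows "ennreal (conv M f x) = (\<integral>\<^sup>+y. ennreal (f (x - y)) \<partial>M)"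
  unfolding conv_def
  by (rule nn_integral_eq_integral[symmetric])
     (use integrable_translate[of f B x] assms in \<open>auto simp: abs_of_nonneg\<close>)

text \<open>Translating by \<open>y\<close> moves the endpoint of the half-line and so changes the
  integral by at most \<open>B * \<bar>y\<bar>\<close>; averaging over \<open>y\<close> produces the
  first moment. The loss is added on the right to avoid a difference of possibly infinite
  integrals.\<close>

lemma conv_halfline:
  assumes f[measurable]: "f \<in> borel_measurable borel" and f0: "\<And>x. 0 \<le> f x" and fB: "\<And>x. f x \<le> B"
  shows "(\<integral>\<^sup>+x. ennreal (f x) * indicator {..0} x \<partial>lborel)
     \<le> (\<integral>\<^sup>+x. ennreal (conv M f x) * indicator {..0} x \<partial>lborel) + ennreal B * (\<integral>\<^sup>+y. ennreal \<bar>y\<bar> \<partial>M)"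
proof -
  let ?I = "\<integral>\<^sup>+x. ennreal (f x) * indicator {..0} x \<partial>lborel"
  have B0: "B \<ge> 0" using f0 fB order_trans by blast
  interpret P: pair_sigma_finite lborel M ..
  have step: "?I \<le> (\<integral>\<^sup>+x. ennreal (f (x - y)) * indicator {..0} x \<partial>lborel) + ennreal B * ennreal \<bar>y\<bar>" for y
  proof -
    have "(\<integral>\<^sup>+x. ennreal (f (x - y)) * indicator {..0} x \<partial>lborel)
        = (\<integral>\<^sup>+x. ennreal (f x) * indicator {..-y} x \<partial>lborel)"
      by (subst nn_integral_real_affine[where c = 1 and t = y])
         (auto intro!: nn_integral_cong simp: indicator_def)
    moreover have "?I \<le> (\<integral>\<^sup>+x. ennreal (f x) * indicator {..-y} x + ennreal B * indicator {-y..0} x \<partial>lborel)"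
      using fB B0 by (intro nn_integral_mono) (auto simp: indicator_def intro: ennreal_leI)
    moreover have "\<dots> = (\<integral>\<^sup>+x. ennreal (f x) * indicator {..-y} x \<partial>lborel) + ennreal B * emeasure lborel {-y..0}"
      by (subst nn_integral_add) (auto simp: nn_integral_cmult)
    moreover have "emeasure lborel {-y..0} \<le> ennreal \<bar>y\<bar>"
      by (cases "y \<ge> 0") auto
    ultimately show ?thesis by (smt (verit) add_left_mono mult_left_mono order_trans zero_le)
  qed
  have "?I = (\<integral>\<^sup>+y. ?I \<partial>M)" using emeasure_space_1 by simp
  also have "\<dots> \<le> (\<integral>\<^sup>+y. (\<integral>\<^sup>+x. ennreal (f (x - y)) * indicator {..0} x \<partial>lborel) + ennreal B * ennreal \<bar>y\<bar> \<partial>M)"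
    by (intro nn_integral_mono step)
  also have "\<dots> = (\<integral>\<^sup>+y. (\<integral>\<^sup>+x. ennreal (f (x - y)) * indicator {..0} x \<partial>lborel) \<partial>M)
       + ennreal B * (\<integral>\<^sup>+y. ennreal \<bar>y\<bar> \<partial>M)"
    by (subst nn_integral_add) (auto simp: nn_integral_cmult)
  also have "(\<integral>\<^sup>+y. (\<integral>\<^sup>+x. ennreal (f (x - y)) * indicator {..0} x \<partial>lborel) \<partial>M)
      = (\<integral>\<^sup>+x. (\<integral>\<^sup>+y. ennreal (f (x - y)) * indicator {..0} x \<partial>M) \<partial>lborel)"
    by (rule P.Fubini') simp
  also have "\<dots> = (\<integral>\<^sup>+x. ennreal (conv M f x) * indicator {..0} x \<partial>lborel)"
    by (intro nn_integral_cong, subst nn_integral_multc) (auto simp: ennreal_conv[OF f f0 fB])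
  finally show ?thesis .
qed

end

text \<open>\<open>lip1\<close> and \<open>lip2\<close> are the only source of compactness.
  \<open>charges\<close> spreads positivity in both directions and carries lower bounds towards
  \<open>+\<infinity>\<close>. \<open>transform\<close> says that \<open>exp (\<rho> * x)\<close> is
  a supersolution of the equation linearised at 0; being stated with \<open>nn_integral\<close>, it
  also contains the finiteness of both transforms at \<open>\<rho>\<close>.\<close>

locale convolution_equation = M1: real_distribution \<mu>1 + M2: real_distribution \<mu>2
  for \<mu>1 \<mu>2 :: "real measure" +
  fixes p q \<gamma> K \<zeta>1 \<zeta>2 \<rho> :: real and G :: "real \<Rightarrow> real"
  assumes p_pos: "0 < p" and q_pos: "0 < q" and pq: "p + q = 1"
    and moment1: "(\<integral>\<^sup>+y. ennreal \<bar>y\<bar> \<partial>\<mu>1) < \<infinity>" and moment2: "(\<integral>\<^sup>+y. ennreal \<bar>y\<bar> \<partial>\<mu>2) < \<infinity>"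
    and lip1: "\<And>f B x x'. f \<in> borel_measurable borel \<Longrightarrow> (\<And>x. 0 \<le> f x) \<Longrightarrow> (\<And>x. f x \<le> B) \<Longrightarrow>
      \<bar>conv \<mu>1 f x - conv \<mu>1 f x'\<bar> \<le> K * B * \<bar>x - x'\<bar>"
    and lip2: "\<And>f B x x'. f \<in> borel_measurable borel \<Longrightarrow> (\<And>x. 0 \<le> f x) \<Longrightarrow> (\<And>x. f x \<le> B) \<Longrightarrow>
      \<bar>conv \<mu>2 f x - conv \<mu>2 f x'\<bar> \<le> K * B * \<bar>x - x'\<bar>"
    and charges: "\<And>u v. -1 < u \<Longrightarrow> u < v \<Longrightarrow> v < 1 \<Longrightarrow> 0 < measure \<mu>1 {u<..<v}"
    and zeta: "0 < \<zeta>1" "\<zeta>1 < \<zeta>2"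
    and G_cont: "continuous_on UNIV G" and G_nonneg: "\<And>s. 0 \<le> G s" and G_le: "\<And>s. G s \<le> \<zeta>2"
    and G_sublin: "\<And>s. 0 \<le> s \<Longrightarrow> G s \<le> \<gamma> * s" and gamma: "1 < \<gamma>"
    and G_zero: "\<And>\<gamma>'. \<gamma>' < \<gamma> \<Longrightarrow> \<exists>\<delta>>0. \<forall>s\<in>{0..\<delta>}. \<gamma>' * s \<le> G s"
    and G_pos: "\<And>s. 0 < s \<Longrightarrow> 0 < G s"
    and G_above: "\<And>s. 0 < s \<Longrightarrow> s \<le> \<zeta>1 \<Longrightarrow> s < G s"
    and G_min: "\<And>s. \<zeta>1 \<le> s \<Longrightarrow> s \<le> \<zeta>2 \<Longrightarrow> G \<zeta>1 \<le> G s"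
    and rho_pos: "0 < \<rho>"
    and transform: "ennreal p * (\<integral>\<^sup>+y. ennreal (exp (- \<rho> * y)) \<partial>\<mu>1)
      + ennreal (q * \<gamma>) * (\<integral>\<^sup>+y. ennreal (exp (- \<rho> * y)) \<partial>\<mu>2) \<le> 1"
begin

definition A :: "(real \<Rightarrow> real) \<Rightarrow> real \<Rightarrow> real" where
  "A \<phi> x = p * conv \<mu>1 \<phi> x + q * conv \<mu>2 (\<lambda>s. G (\<phi> s)) x"

definition adm :: "(real \<Rightarrow> real) \<Rightarrow> bool" where
  "adm \<phi> \<longleftrightarrow> \<phi> \<in> borel_measurable borel \<and> (\<forall>x. 0 \<le> \<phi> x \<and> \<phi> x \<le> \<zeta>2)"

lemma G_meas [measurable]: "G \<in> borel_measurable borel"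
  using G_cont by (rule borel_measurable_continuous_onI)

lemma admD:
  assumes "adm \<phi>"
  shows "\<phi> \<in> borel_measurable borel" "0 \<le> \<phi> x" "\<phi> x \<le> \<zeta>2" "\<bar>\<phi> x\<bar> \<le> \<zeta>2"
    "(\<lambda>s. G (\<phi> s)) \<in> borel_measurable borel" "\<bar>G s\<bar> \<le> \<zeta>2"
  using assms G_nonneg G_le by (auto simp: adm_def)

lemma convex_le: "a \<le> c \<Longrightarrow> b \<le> c \<Longrightarrow> p * a + q * b \<le> c" for a b c :: real
  using convex_bound_le[of a c b p q] p_pos q_pos pq by simp

lemma A_nonneg: "adm \<phi> \<Longrightarrow> 0 \<le> A \<phi> x"
  unfolding A_def using p_pos q_pos
  by (intro add_nonneg_nonneg mult_nonneg_nonneg M1.conv_nonneg M2.conv_nonneg) (auto simp: admD G_nonneg)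

lemma A_le: "adm \<phi> \<Longrightarrow> A \<phi> x \<le> \<zeta>2"
  unfolding A_def by (intro convex_le M1.conv_le_const M2.conv_le_const) (auto simp: admD G_nonneg G_le)

lemma A_diff_le:
  assumes "\<bar>conv \<mu>1 \<phi> x - conv \<mu>1 \<psi> y\<bar> \<le> e"
    and "\<bar>conv \<mu>2 (\<lambda>s. G (\<phi> s)) x - conv \<mu>2 (\<lambda>s. G (\<psi> s)) y\<bar> \<le> e"
  shows "\<bar>A \<phi> x - A \<psi> y\<bar> \<le> e"
proof -
  let ?a = "conv \<mu>1 \<phi> x - conv \<mu>1 \<psi> y" and ?b = "conv \<mu>2 (\<lambda>s. G (\<phi> s)) x - conv \<mu>2 (\<lambda>s. G (\<psi> s)) y"
  have "A \<phi> x - A \<psi> y = p * ?a + q * ?b" by (simp add: A_def algebra_simps)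
  moreover have "\<bar>p * ?a + q * ?b\<bar> \<le> p * \<bar>?a\<bar> + q * \<bar>?b\<bar>"
    using abs_triangle_ineq[of "p * ?a" "q * ?b"] p_pos q_pos by (simp add: abs_mult)
  moreover have "p * \<bar>?a\<bar> + q * \<bar>?b\<bar> \<le> e" using assms by (rule convex_le)
  ultimately show ?thesis by simp
qed

lemma A_lipschitz:
  assumes "adm \<phi>"
  shows "\<bar>A \<phi> x - A \<phi> y\<bar> \<le> K * \<zeta>2 * \<bar>x - y\<bar>"
proof -
  have "\<bar>conv \<mu>1 \<phi> x - conv \<mu>1 \<phi> y\<bar> \<le> K * \<zeta>2 * \<bar>x - y\<bar>"
    by (rule lip1) (use assms in \<open>auto simp: admD\<close>)
  moreover have "\<bar>conv \<mu>2 (\<lambda>s. G (\<phi> s)) x - conv \<mu>2 (\<lambda>s. G (\<phi> s)) y\<bar> \<le> K * \<zeta>2 * \<bar>x - y\<bar>"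
    by (rule lip2) (use assms in \<open>auto simp: admD G_nonneg G_le\<close>)
  ultimately show ?thesis by (rule A_diff_le)
qed

lemma A_ucont:
  assumes "e > 0"
  shows "\<exists>d>0. \<forall>\<phi> \<psi>. adm \<phi> \<longrightarrow> adm \<psi> \<longrightarrow> (\<forall>x. \<bar>\<phi> x - \<psi> x\<bar> \<le> d) \<longrightarrow> (\<forall>x. \<bar>A \<phi> x - A \<psi> x\<bar> \<le> e)"
proof -
  have "uniformly_continuous_on {0..\<zeta>2} G"
    by (rule compact_uniformly_continuous) (use G_cont continuous_on_subset in auto)
  then obtain d where d: "d > 0" "\<And>s t. s \<in> {0..\<zeta>2} \<Longrightarrow> t \<in> {0..\<zeta>2} \<Longrightarrow> \<bar>t - s\<bar> < d \<Longrightarrow> \<bar>G t - G s\<bar> < e"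
    using assms unfolding uniformly_continuous_on_def dist_real_def by meson
  show ?thesis
  proof (intro exI[of _ "min e (d / 2)"] conjI allI impI)
    fix \<phi> \<psi> x assume adm: "adm \<phi>" "adm \<psi>" and close: "\<forall>x. \<bar>\<phi> x - \<psi> x\<bar> \<le> min e (d / 2)"
    have "\<bar>conv \<mu>1 \<phi> x - conv \<mu>1 \<psi> x\<bar> \<le> e"
      by (rule M1.conv_close[of _ \<zeta>2]) (use adm close in \<open>auto simp: admD\<close>)
    moreover have "\<bar>conv \<mu>2 (\<lambda>s. G (\<phi> s)) x - conv \<mu>2 (\<lambda>s. G (\<psi> s)) x\<bar> \<le> e"
    proof (rule M2.conv_close[of _ \<zeta>2])
      show "\<bar>G (\<phi> y) - G (\<psi> y)\<bar> \<le> e" for y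
      proof (rule less_imp_le, rule d(2))
        show "\<bar>\<phi> y - \<psi> y\<bar> < d" using close[rule_format, of y] d(1) by linarith
      qed (use adm in \<open>auto simp: admD\<close>)
    qed (use adm in \<open>auto simp: admD\<close>)
    ultimately show "\<bar>A \<phi> x - A \<psi> x\<bar> \<le> e" by (rule A_diff_le)
  qed (use assms d in auto)
qed

lemma A_LIMSEQ:
  assumes "\<And>n. adm (\<phi> n)" "adm \<psi>" "\<And>x. (\<lambda>n. \<phi> n x) \<longlonglongrightarrow> \<psi> x"
  shows "(\<lambda>n. A (\<phi> n) x) \<longlonglongrightarrow> A \<psi> x"
  unfolding A_def
proof (intro tendsto_intros M1.conv_LIMSEQ[of _ \<zeta>2] M2.conv_LIMSEQ[of _ \<zeta>2])
  show "(\<lambda>n. G (\<phi> n x)) \<longlonglongrightarrow> G (\<psi> x)" for x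
    using G_cont assms(3) by (auto intro: continuous_on_tendsto_compose)
qed (use assms in \<open>auto simp: admD\<close>)

lemma A_translate: "A (\<lambda>x. \<phi> (x + s)) x = A \<phi> (x + s)"
  unfolding A_def using conv_translate[of \<mu>1 \<phi> s x] conv_translate[of \<mu>2 "\<lambda>x. G (\<phi> x)" s x] by simp

text \<open>\<open>G_sublin\<close> reduces the claim to the linearised operator, which multiplies
  \<open>exp (\<rho> * x)\<close> by the left-hand side of \<open>transform\<close>. The computation
  runs in \<open>ennreal\<close> because the exponential is unbounded and thus outside the scope of
  the lemmas on \<open>conv\<close>.\<close>

lemma A_le_exp:
  assumes \<phi>: "adm \<phi>" and exp: "\<And>x. \<phi> x \<le> exp (\<rho> * x)"
  shows "A \<phi> x \<le> exp (\<rho> * x)"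
proof -
  let ?L1 = "\<integral>\<^sup>+y. ennreal (exp (- \<rho> * y)) \<partial>\<mu>1" and ?L2 = "\<integral>\<^sup>+y. ennreal (exp (- \<rho> * y)) \<partial>\<mu>2"
  have exp': "\<phi> (x - y) \<le> exp (\<rho> * x) * exp (- \<rho> * y)" for y
    using exp[of "x - y"] by (simp flip: exp_add add: algebra_simps)
  have "ennreal (conv \<mu>1 \<phi> x) \<le> (\<integral>\<^sup>+y. ennreal (exp (\<rho> * x)) * ennreal (exp (- \<rho> * y)) \<partial>\<mu>1)"
    unfolding M1.ennreal_conv[OF admD(1,2,3)[OF \<phi>]]
    by (intro nn_integral_mono) (use exp' in \<open>simp flip: ennreal_mult add: ennreal_leI\<close>)
  then have 1: "ennreal (conv \<mu>1 \<phi> x) \<le> ennreal (exp (\<rho> * x)) * ?L1"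
    by (simp add: nn_integral_cmult)
  have G_exp: "G (\<phi> (x - y)) \<le> \<gamma> * exp (\<rho> * x) * exp (- \<rho> * y)" for y
    using order_trans[OF G_sublin[OF admD(2)[OF \<phi>, of "x - y"]] mult_left_mono[OF exp'[of y], of \<gamma>]] gamma
    by (simp add: mult.assoc)
  then have "ennreal (conv \<mu>2 (\<lambda>s. G (\<phi> s)) x) \<le> (\<integral>\<^sup>+y. ennreal (\<gamma> * exp (\<rho> * x)) * ennreal (exp (- \<rho> * y)) \<partial>\<mu>2)"
    unfolding M2.ennreal_conv[OF admD(5)[OF \<phi>] G_nonneg G_le]
    by (intro nn_integral_mono) (use G_exp gamma in \<open>simp flip: ennreal_mult add: ennreal_leI\<close>)
  then have 2: "ennreal (conv \<mu>2 (\<lambda>s. G (\<phi> s)) x) \<le> ennreal (\<gamma> * exp (\<rho> * x)) * ?L2"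
    by (simp add: nn_integral_cmult)
  have "ennreal (A \<phi> x) = ennreal p * ennreal (conv \<mu>1 \<phi> x) + ennreal q * ennreal (conv \<mu>2 (\<lambda>s. G (\<phi> s)) x)"
    unfolding A_def using p_pos q_pos
    by (simp add: ennreal_plus ennreal_mult M1.conv_nonneg M2.conv_nonneg admD[OF \<phi>] G_nonneg)
  also have "\<dots> \<le> ennreal p * (ennreal (exp (\<rho> * x)) * ?L1) + ennreal q * (ennreal (\<gamma> * exp (\<rho> * x)) * ?L2)"
    by (intro add_mono mult_left_mono 1 2) auto
  also have "\<dots> = ennreal (exp (\<rho> * x)) * (ennreal p * ?L1 + ennreal (q * \<gamma>) * ?L2)"
    using q_pos gamma by (simp add: ennreal_mult algebra_simps)
  also have "\<dots> \<le> ennreal (exp (\<rho> * x)) * 1" by (intro mult_left_mono transform) auto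
  finally show ?thesis by simp
qed

end

section \<open>Normalised approximations and their limit\<close>

text \<open>A value of at least \<open>e\<close> keeps \<open>f\<close> above \<open>e / 2\<close>
  on an interval of fixed length \<open>h\<close>. Far to the left this would exceed the integral
  over the remaining tail, which tends to 0.\<close>

lemma lipschitz_integrable_tendsto_zero:
  fixes f :: "real \<Rightarrow> real"
  assumes lip: "\<And>x y. \<bar>f x - f y\<bar> \<le> L * \<bar>x - y\<bar>" and f0: "\<And>x. 0 \<le> f x"
    and [measurable]: "f \<in> borel_measurable borel"
    and fin: "(\<integral>\<^sup>+x. ennreal (f x) * indicator {..0} x \<partial>lborel) < \<infinity>"
  shows "(f \<longlongrightarrow> 0) at_bot"
proof -
  have L0: "L \<ge> 0" using lip[of 0 1] by simp
  have J: "(\<lambda>n. \<integral>\<^sup>+x. ennreal (f x) * indicator {..- real n} x \<partial>lborel) \<longlonglongrightarrow> (\<integral>\<^sup>+(x::real). 0 \<partial>lborel)"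
  proof (rule nn_integral_dominated_convergence[where w = "\<lambda>x. ennreal (f x) * indicator {..0} x"])
    have "(\<lambda>n. ennreal (f x) * indicator {..- real n} x) \<longlonglongrightarrow> 0" for x
    proof (rule tendsto_eventually)
      from eventually_abs_less_real[of x] show "\<forall>\<^sub>F n in sequentially. ennreal (f x) * indicator {..- real n} x = 0"
        by (rule eventually_mono) (auto simp: indicator_def)
    qed
    then show "AE x in lborel. (\<lambda>n. ennreal (f x) * indicator {..- real n} x) \<longlonglongrightarrow> 0" by simp
  qed (use fin in \<open>auto simp: indicator_def top.not_eq_extremum\<close>)
  show ?thesis
  proof (rule order_tendstoI)
    fix e :: real assume "e < 0"
    then show "\<forall>\<^sub>F x in at_bot. e < f x" using f0 by (simp add: less_le_trans)
  next
    fix e :: real assume e: "0 < e"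
    define h where "h = e / (2 * (L + 1))"
    have h: "h > 0" "L * h \<le> e / 2" using e L0 by (auto simp: h_def field_simps)
    have "eventually (\<lambda>n. (\<integral>\<^sup>+x. ennreal (f x) * indicator {..- real n} x \<partial>lborel) < ennreal (e / 2 * h)) sequentially"
      using J e h by (intro order_tendstoD(2)) auto
    then obtain N :: nat where N: "(\<integral>\<^sup>+x. ennreal (f x) * indicator {..- real N} x \<partial>lborel) < ennreal (e / 2 * h)"
      using eventually_happens'[OF sequentially_bot] by blast
    have "f x < e" if x: "x \<le> - real N" for x
    proof (rule ccontr)
      assume "\<not> f x < e"
      have "e / 2 \<le> f y" if "y \<in> {x - h..x}" for y
      proof -
        have "L * \<bar>x - y\<bar> \<le> L * h" using that L0 by (intro mult_left_mono) auto
        then show ?thesis using lip[of x y] \<open>\<not> f x < e\<close> h by linarith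
      qed
      then have "(\<integral>\<^sup>+y. ennreal (e / 2) * indicator {x - h..x} y \<partial>lborel)
          \<le> (\<integral>\<^sup>+x. ennreal (f x) * indicator {..- real N} x \<partial>lborel)"
        using x by (intro nn_integral_mono) (auto simp: indicator_def intro: ennreal_leI)
      moreover have "(\<integral>\<^sup>+y. ennreal (e / 2) * indicator {x - h..x} y \<partial>lborel) = ennreal (e / 2 * h)"
        using e h by (simp add: nn_integral_cmult flip: ennreal_mult)
      ultimately show False using N by simp
    qed
    then show "\<forall>\<^sub>F x in at_bot. f x < e" unfolding eventually_at_bot_linorder by blast
  qed
qed

lemma nn_integral_exp_neg_halfline:
  fixes \<rho> :: real
  assumes "0 < \<rho>"
  shows "(\<integral>\<^sup>+x. ennreal (exp (- \<rho> * x)) * indicator {0..} x \<partial>lborel) = ennreal (1 / \<rho>)"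
proof -
  have "(\<integral>\<^sup>+x. ennreal (exp (- \<rho> * x)) * indicator {0..} x \<partial>lborel) = ennreal (0 - (- exp (- \<rho> * 0) / \<rho>))"
  proof (rule nn_integral_FTC_atLeast)
    show "((\<lambda>x. - exp (- \<rho> * x) / \<rho>) has_real_derivative exp (- \<rho> * x)) (at x)" for x
      using assms by (auto intro!: derivative_eq_intros)
    have "filterlim (\<lambda>x. - \<rho> * x) at_bot at_top"
      using assms by (intro filterlim_tendsto_neg_mult_at_bot[OF tendsto_const _ filterlim_ident]) auto
    then have "((\<lambda>x. exp (- \<rho> * x)) \<longlongrightarrow> 0) at_top"
      by (rule filterlim_compose[OF exp_at_bot])
    then show "((\<lambda>x. - exp (- \<rho> * x) / \<rho>) \<longlongrightarrow> 0) at_top"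
      using tendsto_divide[OF tendsto_minus tendsto_const[of \<rho>]] assms by fastforce
  qed auto
  then show ?thesis by simp
qed

lemma nn_integral_exp_halfline:
  fixes \<rho> :: real
  assumes "0 < \<rho>"
  shows "(\<integral>\<^sup>+x. ennreal (exp (\<rho> * x)) * indicator {..0} x \<partial>lborel) = ennreal (1 / \<rho>)"
proof -
  have "(\<integral>\<^sup>+x. ennreal (exp (\<rho> * x)) * indicator {..0} x \<partial>lborel)
      = (\<integral>\<^sup>+x. ennreal (exp (- \<rho> * x)) * indicator {0..} x \<partial>lborel)"
    by (subst nn_integral_real_affine[where c = "-1" and t = 0])
       (auto intro!: nn_integral_cong simp: indicator_def)
  also have "\<dots> = ennreal (1 / \<rho>)" by (rule nn_integral_exp_neg_halfline[OF assms])
  finally show ?thesis .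
qed

lemma first_crossing:
  fixes f :: "real \<Rightarrow> real"
  assumes cont: "continuous_on UNIV f" and x: "\<delta> \<le> f x" and bot: "eventually (\<lambda>x. f x < \<delta>) at_bot"
  obtains s where "f s = \<delta>" "\<And>x. x \<le> s \<Longrightarrow> f x \<le> \<delta>"
proof -
  define C where "C = {x. \<delta> \<le> f x}"
  obtain N where N: "\<And>x. x \<le> N \<Longrightarrow> f x < \<delta>" using bot unfolding eventually_at_bot_linorder by blast
  have "closed C" unfolding C_def by (intro closed_Collect_le cont continuous_on_const)
  moreover have "bdd_below C"
    by (rule bdd_belowI[of _ N]) (use N in \<open>metis C_def leD mem_Collect_eq nle_le\<close>)
  ultimately have C: "closed C" "C \<noteq> {}" "bdd_below C"
    using x by (auto simp: C_def)
  define s where "s = Inf C"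
  have s: "s \<in> C" unfolding s_def by (rule closed_contains_Inf) (use C in auto)
  have left: "f x < \<delta>" if "x < s" for x
    using cInf_lower[of x C] C that by (auto simp: s_def C_def not_le[symmetric])
  have "\<exists>x\<ge>s - 1. x \<le> s \<and> f x = \<delta>"
    by (rule IVT') (use left[of "s - 1"] s cont continuous_on_subset in \<open>auto simp: C_def\<close>)
  then have "f s = \<delta>" using left by (metis less_irrefl order_le_less)
  then show ?thesis using left that by (metis less_imp_le order_le_less)
qed

context convolution_equation
begin

text \<open>Only \<open>A \<phi> \<le> \<phi>\<close> is required, so that this applies to the perturbed fixed points as well.\<close>

lemma eventually_above_zeta1:
  assumes \<phi>: "adm \<phi>" and super: "\<And>x. A \<phi> x \<le> \<phi> x"
    and m0: "0 < m0" "eventually (\<lambda>x. m0 \<le> \<phi> x) at_top"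
  shows "\<exists>z>\<zeta>1. eventually (\<lambda>x. z \<le> \<phi> x) at_top"
proof -
  define S where "S = {\<alpha>. eventually (\<lambda>x. \<alpha> \<le> \<phi> x) at_top}"
  have S_le: "\<alpha> \<le> \<zeta>2" if "\<alpha> \<in> S" for \<alpha>
  proof -
    have "eventually (\<lambda>x. \<alpha> \<le> \<phi> x) at_top" using that by (simp add: S_def)
    then obtain x where "\<alpha> \<le> \<phi> x"
      using eventually_happens'[OF trivial_limit_at_top_linorder] by blast
    then show ?thesis using admD(3)[OF \<phi>, of x] by linarith
  qed
  then have bdd: "bdd_above S" by (rule bdd_aboveI)
  have m0S: "m0 \<in> S" using m0 by (simp add: S_def)
  then have m0_le: "m0 \<le> \<zeta>2" "m0 \<le> Sup S" using S_le cSup_upper[OF _ bdd] by auto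
  have "\<exists>b\<in>{m0/2..\<zeta>2}. \<forall>s\<in>{m0/2..\<zeta>2}. G b - min b \<zeta>1 \<le> G s - min s \<zeta>1"
  proof (rule continuous_attains_inf)
    show "{m0/2..\<zeta>2} \<noteq> {}" using m0 m0_le by auto
    show "continuous_on {m0/2..\<zeta>2} (\<lambda>s. G s - min s \<zeta>1)"
      using continuous_on_subset[OF G_cont] by (intro continuous_intros) auto
  qed auto
  then obtain b where b: "b \<in> {m0/2..\<zeta>2}" "\<And>s. s \<in> {m0/2..\<zeta>2} \<Longrightarrow> G b - min b \<zeta>1 \<le> G s - min s \<zeta>1" by blast
  \<comment> \<open>\<open>\<eta>\<close> is the least excess of \<open>G s\<close> over
    \<open>min s \<zeta>1\<close>. It is positive by \<open>G_above\<close> below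
    \<open>\<zeta>1\<close>, and beyond it by \<open>G_min\<close> together with
    \<open>\<zeta>1 < G \<zeta>1\<close>. An eventual lower bound
    \<open>\<alpha> \<le> \<zeta>1\<close> for \<open>\<phi>\<close> thus becomes
    \<open>\<alpha> + \<eta>\<close> for \<open>G (\<phi> x)\<close>.\<close>
  define \<eta> where "\<eta> = G b - min b \<zeta>1"
  have \<eta>: "\<eta> > 0"
    using b(1) m0 G_above[of b] G_above[of \<zeta>1] G_min[of b] zeta by (auto simp: \<eta>_def min_def)
  have "Sup S > \<zeta>1"
  proof (rule ccontr)
    assume "\<not> Sup S > \<zeta>1"
    have "\<exists>\<alpha>\<in>S. Sup S - min (q * \<eta> / 2) (m0 / 2) < \<alpha>"
      by (rule less_cSupD) (use m0S m0 \<eta> q_pos in \<open>auto simp: min_def\<close>)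
    then obtain \<alpha> where \<alpha>: "\<alpha> \<in> S" "Sup S - min (q * \<eta> / 2) (m0 / 2) < \<alpha>" by blast
    have \<alpha>': "m0 / 2 \<le> \<alpha>" "\<alpha> \<le> \<zeta>1"
      using \<alpha> m0_le cSup_upper[OF \<alpha>(1) bdd] \<open>\<not> Sup S > \<zeta>1\<close> by linarith+
    \<comment> \<open>One application of \<open>A\<close> gains \<open>q * \<eta> = 4 * e\<close>
      and loses \<open>e\<close> in the convolutions. The net \<open>3 * e\<close> overshoots
      \<open>Sup S\<close>, since \<open>\<alpha>\<close> lies within \<open>2 * e\<close> of
      it.\<close>
    define e where "e = q * \<eta> / 4"
    have e: "e > 0" using \<eta> q_pos by (simp add: e_def)
    have "eventually (\<lambda>x. \<alpha> - e \<le> conv \<mu>1 \<phi> x) at_top"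
      by (rule M1.conv_eventually_ge[of _ \<zeta>2]) (use \<phi> \<alpha> e in \<open>auto simp: admD S_def\<close>)
    moreover have "eventually (\<lambda>x. (\<alpha> + \<eta>) - e \<le> conv \<mu>2 (\<lambda>s. G (\<phi> s)) x) at_top"
    proof (rule M2.conv_eventually_ge[of _ \<zeta>2])
      have "eventually (\<lambda>x. \<alpha> \<le> \<phi> x) at_top" using \<alpha> by (simp add: S_def)
      then show "eventually (\<lambda>x. \<alpha> + \<eta> \<le> G (\<phi> x)) at_top"
      proof (rule eventually_mono)
        fix x assume "\<alpha> \<le> \<phi> x"
        then show "\<alpha> + \<eta> \<le> G (\<phi> x)"
          using b(2)[of "\<phi> x"] \<alpha>' admD(3)[OF \<phi>, of x] by (auto simp: \<eta>_def)
      qed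
    qed (use \<phi> e in \<open>auto simp: admD\<close>)
    ultimately have "eventually (\<lambda>x. \<alpha> + 3 * e \<le> \<phi> x) at_top"
    proof eventually_elim
      case (elim x)
      have "(p + q) * (\<alpha> - e) + q * \<eta> = p * (\<alpha> - e) + q * (\<alpha> + \<eta> - e)" by algebra
      also have "\<dots> \<le> A \<phi> x"
        unfolding A_def using elim p_pos q_pos by (intro add_mono mult_left_mono) auto
      also have "\<dots> \<le> \<phi> x" by (rule super)
      finally have "\<alpha> - e + q * \<eta> \<le> \<phi> x" unfolding pq by simp
      moreover have "q * \<eta> = 4 * e" by (simp add: e_def)
      ultimately show ?case by linarith
    qed
    then have "\<alpha> + 3 * e \<le> Sup S" using cSup_upper[OF _ bdd] by (simp add: S_def)
    moreover have "Sup S - q * \<eta> / 2 < \<alpha>"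
      using \<alpha>(2) min.cobounded1[of "q * \<eta> / 2" "m0 / 2"] by linarith
    moreover have "q * \<eta> / 2 = 2 * e" by (simp add: e_def)
    ultimately show False using e by linarith
  qed
  then obtain z where "z \<in> S" "\<zeta>1 < z" using less_cSupD[of S \<zeta>1] m0S by blast
  then show ?thesis by (auto simp: S_def)
qed

definition u :: "real \<Rightarrow> real" where "u x = min \<zeta>2 (exp (\<rho> * x))"

lemma u_bounds: "0 < u x" "u x \<le> \<zeta>2" "u x \<le> exp (\<rho> * x)"
  using zeta by (auto simp: u_def)

text \<open>The exponential alone is not Lipschitz. The cap yields
  \<open>u y * exp (- (\<rho> * (y - x))) \<le> u x\<close> for \<open>x \<le> y\<close>, and then
  \<open>1 - s \<le> exp (- s)\<close> and \<open>u y \<le> \<zeta>2\<close> give the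
  constant.\<close>

lemma u_lipschitz: "\<bar>u x - u y\<bar> \<le> \<rho> * \<zeta>2 * \<bar>x - y\<bar>"
proof -
  have main: "u x \<le> u y \<and> u y - u x \<le> \<rho> * \<zeta>2 * (y - x)" if "x \<le> y" for x y
  proof
    show "u x \<le> u y" using that rho_pos by (auto simp: u_def min_le_iff_disj)
    let ?t = "exp (- (\<rho> * (y - x)))"
    have t: "1 - \<rho> * (y - x) \<le> ?t" using exp_ge_add_one_self[of "- (\<rho> * (y - x))"] by simp
    have "u y * ?t \<le> exp (\<rho> * y) * ?t" using u_bounds[of y] by (intro mult_right_mono) auto
    also have "\<dots> = exp (\<rho> * x)" by (simp flip: exp_add add: algebra_simps)
    finally have "u y * ?t \<le> exp (\<rho> * x)" .
    moreover have "u y * ?t \<le> \<zeta>2 * 1"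
      using that rho_pos u_bounds[of y] zeta by (intro mult_mono) auto
    ultimately have "u y * ?t \<le> u x" by (simp add: u_def)
    moreover have "u y * (1 - \<rho> * (y - x)) \<le> u y * ?t" using t u_bounds[of y] by (intro mult_left_mono) auto
    moreover have "u y * (\<rho> * (y - x)) \<le> \<zeta>2 * (\<rho> * (y - x))"
      using that rho_pos u_bounds[of y] by (intro mult_right_mono) auto
    ultimately show "u y - u x \<le> \<rho> * \<zeta>2 * (y - x)" by (simp add: algebra_simps)
  qed
  show ?thesis using main[of x y] main[of y x] by (cases "x \<le> y") auto
qed

lemma K_nonneg: "0 \<le> K"
  using lip1[of "\<lambda>_. 1" 1 0 1] by simp

text \<open>The floor \<open>\<epsilon> * u\<close> excludes the zero solution and, as
  \<open>\<epsilon> \<le> 1\<close>, respects the upper bound \<open>u\<close>. The Lipschitz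
  constant adds those of \<open>A \<phi>\<close> and of \<open>u\<close>, hence is uniform in
  \<open>\<epsilon>\<close>.\<close>

lemma perturbed_fixed_point:
  assumes \<epsilon>: "0 < \<epsilon>" "\<epsilon> \<le> 1"
  obtains \<phi> where "adm \<phi>" "\<And>x. \<phi> x \<le> exp (\<rho> * x)" "\<And>x. \<phi> x = max (A \<phi> x) (\<epsilon> * u x)"
    "\<And>x y. \<bar>\<phi> x - \<phi> y\<bar> \<le> (K + \<rho>) * \<zeta>2 * \<bar>x - y\<bar>"
proof -
  define T where "T \<phi> x = max (A \<phi> x) (\<epsilon> * u x)" for \<phi> x
  let ?X = "{\<phi> \<in> borel_measurable borel. \<forall>x. 0 \<le> \<phi> x \<and> \<phi> x \<le> u x}"
  have X_adm: "adm \<phi>" if "\<phi> \<in> ?X" for \<phi>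
    using that u_bounds(2) order_trans unfolding adm_def by blast
  have Tlip: "\<bar>T \<phi> x - T \<phi> y\<bar> \<le> (K + \<rho>) * \<zeta>2 * \<bar>x - y\<bar>" if "\<phi> \<in> ?X" for \<phi> x y
  proof -
    have "\<bar>\<epsilon> * u x - \<epsilon> * u y\<bar> = \<epsilon> * \<bar>u x - u y\<bar>"
      using \<epsilon> by (simp add: abs_mult flip: right_diff_distrib)
    also have "\<dots> \<le> 1 * (\<rho> * \<zeta>2 * \<bar>x - y\<bar>)" using \<epsilon> u_lipschitz by (intro mult_mono) auto
    finally have "\<bar>\<epsilon> * u x - \<epsilon> * u y\<bar> \<le> \<rho> * \<zeta>2 * \<bar>x - y\<bar>" by simp
    moreover have "0 \<le> K * \<zeta>2 * \<bar>x - y\<bar>" "0 \<le> \<rho> * \<zeta>2 * \<bar>x - y\<bar>"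
      using K_nonneg rho_pos zeta by auto
    moreover have "(K + \<rho>) * \<zeta>2 * \<bar>x - y\<bar> = K * \<zeta>2 * \<bar>x - y\<bar> + \<rho> * \<zeta>2 * \<bar>x - y\<bar>" by (simp add: algebra_simps)
    ultimately show ?thesis using A_lipschitz[OF X_adm[OF that], of x y] unfolding T_def by linarith
  qed
  have "u = (\<lambda>x. min \<zeta>2 (exp (\<rho> * x)))" by (simp add: u_def fun_eq_iff)
  then have u_meas: "u \<in> borel_measurable borel" by simp
  obtain \<phi> where \<phi>: "\<phi> \<in> ?X" "T \<phi> = \<phi>"
  proof (rule order_interval_fixed_point[of \<zeta>2 u T "(K + \<rho>) * \<zeta>2"])
    show "0 \<le> T \<phi> x \<and> T \<phi> x \<le> u x" if "\<phi> \<in> ?X" for \<phi> x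
    proof -
      have "\<phi> y \<le> exp (\<rho> * y)" for y using that u_bounds(3)[of y] by (auto intro: order_trans)
      moreover have "\<epsilon> * u x \<le> 1 * u x" using \<epsilon> u_bounds[of x] by (intro mult_right_mono) auto
      ultimately show ?thesis
        using A_nonneg[OF X_adm[OF that], of x] A_le[OF X_adm[OF that], of x] A_le_exp[OF X_adm[OF that], of x]
        by (auto simp: T_def u_def le_max_iff_disj)
    qed
    show "\<exists>d>0. \<forall>\<phi>\<in>?X. \<forall>\<psi>\<in>?X. (\<forall>x. \<bar>\<phi> x - \<psi> x\<bar> \<le> d) \<longrightarrow> (\<forall>x. \<bar>T \<phi> x - T \<psi> x\<bar> \<le> e)" if e: "e > 0" for e
    proof -
      obtain d where d: "d > 0" "\<And>\<phi> \<psi> x. adm \<phi> \<Longrightarrow> adm \<psi> \<Longrightarrow> (\<forall>x. \<bar>\<phi> x - \<psi> x\<bar> \<le> d) \<Longrightarrow> \<bar>A \<phi> x - A \<psi> x\<bar> \<le> e"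
        using A_ucont[OF e] by meson
      have "\<bar>T \<phi> x - T \<psi> x\<bar> \<le> e" if "\<phi> \<in> ?X" "\<psi> \<in> ?X" "\<forall>x. \<bar>\<phi> x - \<psi> x\<bar> \<le> d" for \<phi> \<psi> x
        using d(2)[OF X_adm X_adm, of \<phi> \<psi> x] that unfolding T_def by (auto simp: max_def)
      then show ?thesis using d(1) by blast
    qed
    show "(\<lambda>n. T (\<phi> n) x) \<longlonglongrightarrow> T \<psi> x"
      if "\<And>n. \<phi> n \<in> ?X" "\<psi> \<in> ?X" "\<And>x. (\<lambda>n. \<phi> n x) \<longlonglongrightarrow> \<psi> x" for \<phi> \<psi> x
      unfolding T_def by (intro tendsto_intros A_LIMSEQ) (use that X_adm in blast)+
    show "u x \<in> {0..\<zeta>2}" for x using u_bounds[of x] by auto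
  qed (use zeta u_meas Tlip in auto)
  show ?thesis
  proof (rule that[OF X_adm[OF \<phi>(1)]])
    show "\<phi> x \<le> exp (\<rho> * x)" for x using \<phi>(1) u_bounds(3)[of x] by (auto intro: order_trans)
    show "\<phi> x = max (A \<phi> x) (\<epsilon> * u x)" for x using \<phi>(2) unfolding T_def by metis
    show "\<bar>\<phi> x - \<phi> y\<bar> \<le> (K + \<rho>) * \<zeta>2 * \<bar>x - y\<bar>" for x y using Tlip[OF \<phi>(1)] \<phi>(2) by simp
  qed
qed

text \<open>With \<open>I\<close> the integral of \<open>\<phi>\<close>, the gain in
  \<open>G\<close> gives \<open>p * I + q * (1 + \<eta>) * I = I + q * \<eta> * I\<close>, while the
  convolutions and \<open>A \<phi> \<le> \<phi>\<close> bound this by \<open>I\<close> plus moment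
  terms. \<open>fin\<close> permits cancelling \<open>I\<close>; its size does not enter the
  resulting bound.\<close>

lemma halfline_integral_bound:
  assumes \<phi>: "adm \<phi>" and super: "\<And>x. A \<phi> x \<le> \<phi> x" and below: "\<And>x. x \<le> 0 \<Longrightarrow> \<phi> x \<le> \<delta>"
    and \<eta>: "0 < \<eta>" and G: "\<And>s. 0 \<le> s \<Longrightarrow> s \<le> \<delta> \<Longrightarrow> (1 + \<eta>) * s \<le> G s"
    and fin: "(\<integral>\<^sup>+x. ennreal (\<phi> x) * indicator {..0} x \<partial>lborel) < \<infinity>"
  shows "ennreal (q * \<eta>) * (\<integral>\<^sup>+x. ennreal (\<phi> x) * indicator {..0} x \<partial>lborel)
    \<le> ennreal \<zeta>2 * ((\<integral>\<^sup>+y. ennreal \<bar>y\<bar> \<partial>\<mu>1) + (\<integral>\<^sup>+y. ennreal \<bar>y\<bar> \<partial>\<mu>2))"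
proof -
  note [measurable] = admD(1,5)[OF \<phi>]
  define I where "I = (\<integral>\<^sup>+x. ennreal (\<phi> x) * indicator {..0} x \<partial>lborel)"
  define I2 where "I2 = (\<integral>\<^sup>+x. ennreal (G (\<phi> x)) * indicator {..0} x \<partial>lborel)"
  define J1 where "J1 = (\<integral>\<^sup>+x. ennreal (conv \<mu>1 \<phi> x) * indicator {..0} x \<partial>lborel)"
  define J2 where "J2 = (\<integral>\<^sup>+x. ennreal (conv \<mu>2 (\<lambda>s. G (\<phi> s)) x) * indicator {..0} x \<partial>lborel)"
  define m1 where "m1 = (\<integral>\<^sup>+y. ennreal \<bar>y\<bar> \<partial>\<mu>1)"
  define m2 where "m2 = (\<integral>\<^sup>+y. ennreal \<bar>y\<bar> \<partial>\<mu>2)"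
  have "continuous_on UNIV (conv \<mu>1 \<phi>)"
    by (rule lipschitz_continuous_on_UNIV[OF lip1[of \<phi> \<zeta>2]]) (use admD[OF \<phi>] in auto)
  then have [measurable]: "conv \<mu>1 \<phi> \<in> borel_measurable borel" by (rule borel_measurable_continuous_onI)
  have "continuous_on UNIV (conv \<mu>2 (\<lambda>s. G (\<phi> s)))"
    by (rule lipschitz_continuous_on_UNIV[OF lip2[of "\<lambda>s. G (\<phi> s)" \<zeta>2]])
       (use admD[OF \<phi>] G_nonneg G_le in auto)
  then have [measurable]: "conv \<mu>2 (\<lambda>s. G (\<phi> s)) \<in> borel_measurable borel" by (rule borel_measurable_continuous_onI)
  have 1: "I \<le> J1 + ennreal \<zeta>2 * m1"
    unfolding I_def J1_def m1_def by (rule M1.conv_halfline) (use admD[OF \<phi>] in auto)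
  have 2: "I2 \<le> J2 + ennreal \<zeta>2 * m2"
    unfolding I2_def J2_def m2_def by (rule M2.conv_halfline) (use admD[OF \<phi>] G_nonneg G_le in auto)
  have 3: "ennreal (1 + \<eta>) * I \<le> I2"
  proof -
    have "ennreal (1 + \<eta>) * I = (\<integral>\<^sup>+x. ennreal ((1 + \<eta>) * \<phi> x) * indicator {..0} x \<partial>lborel)"
      unfolding I_def using \<eta> admD[OF \<phi>]
      by (subst nn_integral_cmult[symmetric]) (auto simp: ennreal_mult mult.assoc)
    also have "\<dots> \<le> I2" unfolding I2_def
      using G[OF admD(2)[OF \<phi>] below] by (intro nn_integral_mono) (auto simp: indicator_def intro: ennreal_leI)
    finally show ?thesis .
  qed
  have 4: "ennreal p * J1 + ennreal q * J2 \<le> I"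
  proof -
    have "ennreal p * J1 + ennreal q * J2 = (\<integral>\<^sup>+x. (ennreal p * ennreal (conv \<mu>1 \<phi> x)
        + ennreal q * ennreal (conv \<mu>2 (\<lambda>s. G (\<phi> s)) x)) * indicator {..0} x \<partial>lborel)"
      unfolding J1_def J2_def
      by (subst nn_integral_cmult[symmetric], simp, subst nn_integral_cmult[symmetric], simp,
          subst nn_integral_add[symmetric]) (auto simp: algebra_simps)
    also have "\<dots> \<le> I" unfolding I_def
    proof (intro nn_integral_mono mult_right_mono)
      fix x
      have "ennreal p * ennreal (conv \<mu>1 \<phi> x) + ennreal q * ennreal (conv \<mu>2 (\<lambda>s. G (\<phi> s)) x) = ennreal (A \<phi> x)"
        unfolding A_def using p_pos q_pos
        by (simp add: ennreal_plus ennreal_mult M1.conv_nonneg M2.conv_nonneg admD[OF \<phi>] G_nonneg)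
      then show "ennreal p * ennreal (conv \<mu>1 \<phi> x) + ennreal q * ennreal (conv \<mu>2 (\<lambda>s. G (\<phi> s)) x) \<le> ennreal (\<phi> x)"
        using super by (simp add: ennreal_leI)
    qed auto
    finally show ?thesis .
  qed
  have "I + ennreal (q * \<eta>) * I = ennreal p * I + ennreal q * (ennreal (1 + \<eta>) * I)"
  proof -
    have "ennreal 1 + ennreal (q * \<eta>) = ennreal p + ennreal q * ennreal (1 + \<eta>)"
      using p_pos q_pos \<eta> pq by (simp add: distrib_left flip: ennreal_plus ennreal_mult ennreal_1)
    then show ?thesis by (metis distrib_right ennreal_1 mult.assoc mult_1)
  qed
  also have "\<dots> \<le> ennreal p * (J1 + ennreal \<zeta>2 * m1) + ennreal q * (J2 + ennreal \<zeta>2 * m2)"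
    by (intro add_mono mult_left_mono 1 order_trans[OF 3 2]) auto
  also have "\<dots> = (ennreal p * J1 + ennreal q * J2) + (ennreal p * (ennreal \<zeta>2 * m1) + ennreal q * (ennreal \<zeta>2 * m2))"
    by (simp add: algebra_simps)
  also have "\<dots> \<le> I + (1 * (ennreal \<zeta>2 * m1) + 1 * (ennreal \<zeta>2 * m2))"
    using p_pos q_pos pq by (intro add_mono 4 mult_right_mono) (auto simp: ennreal_le_1)
  finally have "I + ennreal (q * \<eta>) * I \<le> I + ennreal \<zeta>2 * (m1 + m2)"
    by (simp add: distrib_left)
  then have "ennreal (q * \<eta>) * I \<le> ennreal \<zeta>2 * (m1 + m2)"
    using fin unfolding I_def[symmetric] by (auto simp: ennreal_add_left_cancel_le)
  then show ?thesis unfolding I_def m1_def m2_def .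
qed

text \<open>The value at 0 is fixed so that it survives a pointwise limit. Translation destroys the
  explicit form of the floor, of which only the size \<open>\<epsilon> * \<zeta>2\<close> is
  kept.\<close>

lemma normalised_approximation:
  assumes \<epsilon>: "0 < \<epsilon>" "\<epsilon> \<le> 1" and \<delta>: "0 < \<delta>" "\<delta> \<le> \<zeta>1"
    and \<eta>: "0 < \<eta>" and G: "\<And>s. 0 \<le> s \<Longrightarrow> s \<le> \<delta> \<Longrightarrow> (1 + \<eta>) * s \<le> G s"
  obtains \<phi> where "adm \<phi>" "\<And>x. A \<phi> x \<le> \<phi> x" "\<And>x. \<phi> x \<le> A \<phi> x + \<epsilon> * \<zeta>2" "\<phi> 0 = \<delta>"
    "\<And>x y. \<bar>\<phi> x - \<phi> y\<bar> \<le> (K + \<rho>) * \<zeta>2 * \<bar>x - y\<bar>"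
    "ennreal (q * \<eta>) * (\<integral>\<^sup>+x. ennreal (\<phi> x) * indicator {..0} x \<partial>lborel)
      \<le> ennreal \<zeta>2 * ((\<integral>\<^sup>+y. ennreal \<bar>y\<bar> \<partial>\<mu>1) + (\<integral>\<^sup>+y. ennreal \<bar>y\<bar> \<partial>\<mu>2))"
proof -
  obtain \<psi> where \<psi>: "adm \<psi>" "\<And>x. \<psi> x \<le> exp (\<rho> * x)" "\<And>x. \<psi> x = max (A \<psi> x) (\<epsilon> * u x)"
    "\<And>x y. \<bar>\<psi> x - \<psi> y\<bar> \<le> (K + \<rho>) * \<zeta>2 * \<bar>x - y\<bar>"
    using perturbed_fixed_point[OF \<epsilon>] by blast
  have super: "A \<psi> x \<le> \<psi> x" for x using \<psi>(3)[of x] by linarith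
  have sub: "\<psi> x \<le> A \<psi> x + \<epsilon> * \<zeta>2" for x
  proof -
    have "\<epsilon> * u x \<le> \<epsilon> * \<zeta>2" using \<epsilon> u_bounds[of x] by simp
    then show ?thesis using \<psi>(3)[of x] A_nonneg[OF \<psi>(1), of x] \<epsilon> zeta
      by (smt (verit) mult_pos_pos)
  qed
  \<comment> \<open>The floor is bounded away from 0 on the right half-line. This starts
    \<open>eventually_above_zeta1\<close>, and since \<open>\<delta> \<le> \<zeta>1\<close> the
    level \<open>\<delta>\<close> is really reached.\<close>
  have "eventually (\<lambda>x. \<epsilon> * u 0 \<le> \<psi> x) at_top"
  proof (rule eventually_mono[OF eventually_ge_at_top[of 0]])
    fix x :: real assume "0 \<le> x"
    then have "exp (\<rho> * 0) \<le> exp (\<rho> * x)" using rho_pos by simp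
    then have "u 0 \<le> u x" unfolding u_def by (intro min.mono order_refl)
    then have "\<epsilon> * u 0 \<le> \<epsilon> * u x" using \<epsilon> by simp
    then show "\<epsilon> * u 0 \<le> \<psi> x" using \<psi>(3)[of x] by linarith
  qed
  then obtain z where z: "\<zeta>1 < z" "eventually (\<lambda>x. z \<le> \<psi> x) at_top"
    using eventually_above_zeta1[OF \<psi>(1) super, of "\<epsilon> * u 0"] \<epsilon> u_bounds(1)[of 0] by auto
  then obtain x1 where x1: "z \<le> \<psi> x1"
    using eventually_happens'[OF trivial_limit_at_top_linorder] by blast
  have bot: "eventually (\<lambda>x. \<psi> x < \<delta>) at_bot"
  proof -
    have "filterlim (\<lambda>x. \<rho> * x) at_bot at_bot"
      using rho_pos by (intro filterlim_tendsto_pos_mult_at_bot[OF tendsto_const _ filterlim_ident]) auto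
    then have "((\<lambda>x. exp (\<rho> * x)) \<longlongrightarrow> 0) at_bot" by (rule filterlim_compose[OF exp_at_bot])
    then have "eventually (\<lambda>x. exp (\<rho> * x) < \<delta>) at_bot" using \<delta> by (intro order_tendstoD(2)) auto
    then show ?thesis by (rule eventually_mono) (use \<psi>(2) le_less_trans in blast)
  qed
  have cont: "continuous_on UNIV \<psi>" by (rule lipschitz_continuous_on_UNIV[OF \<psi>(4)])
  obtain s where s: "\<psi> s = \<delta>" "\<And>x. x \<le> s \<Longrightarrow> \<psi> x \<le> \<delta>"
    by (rule first_crossing[OF cont _ bot, of x1]) (use x1 z \<delta> in auto)
  define \<phi> where "\<phi> x = \<psi> (x + s)" for x
  have A\<phi>: "A \<phi> x = A \<psi> (x + s)" for x unfolding \<phi>_def by (rule A_translate)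
  note [measurable] = admD(1)[OF \<psi>(1)]
  have "\<phi> \<in> borel_measurable borel" unfolding \<phi>_def by measurable
  then have \<phi>: "adm \<phi>" using admD(2,3)[OF \<psi>(1)] by (simp add: adm_def \<phi>_def)
  have [measurable]: "\<phi> \<in> borel_measurable borel" by (rule admD(1)[OF \<phi>])
  have fin: "(\<integral>\<^sup>+x. ennreal (\<phi> x) * indicator {..0} x \<partial>lborel) < \<infinity>"
  proof -
    have "\<phi> x \<le> exp (\<rho> * s) * exp (\<rho> * x)" for x
      using \<psi>(2)[of "x + s"] by (simp add: \<phi>_def algebra_simps flip: exp_add)
    then have "(\<integral>\<^sup>+x. ennreal (\<phi> x) * indicator {..0} x \<partial>lborel)
        \<le> (\<integral>\<^sup>+x. ennreal (exp (\<rho> * s)) * (ennreal (exp (\<rho> * x)) * indicator {..0} x) \<partial>lborel)"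
      by (intro nn_integral_mono) (auto simp: indicator_def simp flip: ennreal_mult intro: ennreal_leI)
    also have "\<dots> = ennreal (exp (\<rho> * s)) * ennreal (1 / \<rho>)"
      by (subst nn_integral_cmult) (simp_all only: nn_integral_exp_halfline[OF rho_pos], simp)
    also have "\<dots> < \<infinity>" by (simp add: ennreal_mult_less_top)
    finally show ?thesis .
  qed
  show ?thesis
  proof (rule that[OF \<phi>])
    show sup: "A \<phi> x \<le> \<phi> x" for x using super by (simp add: A\<phi>) (simp add: \<phi>_def super)
    show "\<phi> x \<le> A \<phi> x + \<epsilon> * \<zeta>2" for x using sub by (simp add: A\<phi>) (simp add: \<phi>_def sub)
    show "\<phi> 0 = \<delta>" using s by (simp add: \<phi>_def)
    show "\<bar>\<phi> x - \<phi> y\<bar> \<le> (K + \<rho>) * \<zeta>2 * \<bar>x - y\<bar>" for x y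
      using \<psi>(4)[of "x + s" "y + s"] by (simp add: \<phi>_def)
    show "ennreal (q * \<eta>) * (\<integral>\<^sup>+x. ennreal (\<phi> x) * indicator {..0} x \<partial>lborel)
      \<le> ennreal \<zeta>2 * ((\<integral>\<^sup>+y. ennreal \<bar>y\<bar> \<partial>\<mu>1) + (\<integral>\<^sup>+y. ennreal \<bar>y\<bar> \<partial>\<mu>2))"
      by (rule halfline_integral_bound[OF \<phi> sup _ \<eta> G fin, of \<delta>]) (use s(2) in \<open>auto simp: \<phi>_def\<close>)
  qed
qed

lemma fixed_point_vanishing_at_bot:
  obtains \<phi> x0 where "adm \<phi>" "A \<phi> = \<phi>" "0 < \<phi> x0" "continuous_on UNIV \<phi>" "(\<phi> \<longlongrightarrow> 0) at_bot"
proof -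
  \<comment> \<open>Half of the available excess, so that \<open>1 + \<eta> < \<gamma>\<close> and
    \<open>G_zero\<close> applies.\<close>
  define \<eta> where "\<eta> = (\<gamma> - 1) / 2"
  have \<eta>: "\<eta> > 0" "1 + \<eta> < \<gamma>" using gamma by (auto simp: \<eta>_def field_simps)
  obtain \<delta>' where \<delta>': "\<delta>' > 0" "\<And>s. s \<in> {0..\<delta>'} \<Longrightarrow> (1 + \<eta>) * s \<le> G s" using G_zero[OF \<eta>(2)] by blast
  define \<delta> where "\<delta> = min \<delta>' \<zeta>1"
  have \<delta>: "0 < \<delta>" "\<delta> \<le> \<zeta>1" using \<delta>' zeta by (auto simp: \<delta>_def)
  have G\<delta>: "(1 + \<eta>) * s \<le> G s" if "0 \<le> s" "s \<le> \<delta>" for s using \<delta>'(2) that by (auto simp: \<delta>_def)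
  let ?L = "(K + \<rho>) * \<zeta>2"
  let ?C = "ennreal \<zeta>2 * ((\<integral>\<^sup>+y. ennreal \<bar>y\<bar> \<partial>\<mu>1) + (\<integral>\<^sup>+y. ennreal \<bar>y\<bar> \<partial>\<mu>2))"
  define Q where "Q n \<phi> \<longleftrightarrow> adm \<phi> \<and> (\<forall>x. A \<phi> x \<le> \<phi> x \<and> \<phi> x \<le> A \<phi> x + 1 / real (Suc n) * \<zeta>2) \<and> \<phi> 0 = \<delta> \<and>
      (\<forall>x y. \<bar>\<phi> x - \<phi> y\<bar> \<le> ?L * \<bar>x - y\<bar>) \<and>
      ennreal (q * \<eta>) * (\<integral>\<^sup>+x. ennreal (\<phi> x) * indicator {..0} x \<partial>lborel) \<le> ?C" for n \<phi>
  have "\<exists>\<phi>. Q n \<phi>" for n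
    unfolding Q_def by (rule normalised_approximation[of "1 / real (Suc n)" \<delta> \<eta>]) (use \<delta> \<eta> G\<delta> in auto)
  then obtain \<phi> where "\<And>n. Q n (\<phi> n)" by metis
  then have \<phi>: "\<And>n. adm (\<phi> n)" "\<And>n x. A (\<phi> n) x \<le> \<phi> n x" "\<And>n x. \<phi> n x \<le> A (\<phi> n) x + 1 / real (Suc n) * \<zeta>2"
      "\<And>n. \<phi> n 0 = \<delta>" "\<And>n x y. \<bar>\<phi> n x - \<phi> n y\<bar> \<le> ?L * \<bar>x - y\<bar>"
      "\<And>n. ennreal (q * \<eta>) * (\<integral>\<^sup>+x. ennreal (\<phi> n x) * indicator {..0} x \<partial>lborel) \<le> ?C"
    unfolding Q_def by blast+
  obtain r \<psi> where r: "strict_mono r" and lim: "\<And>x. (\<lambda>n. \<phi> (r n) x) \<longlonglongrightarrow> \<psi> x"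
    by (rule lipschitz_sequence_pointwise_limit[of \<phi> \<zeta>2 ?L]) (use \<phi>(1,5) admD in auto)
  have \<psi>_bound: "0 \<le> \<psi> x" "\<psi> x \<le> \<zeta>2" for x
    using LIMSEQ_le_const[OF lim[of x], of 0] LIMSEQ_le_const2[OF lim[of x], of \<zeta>2] admD[OF \<phi>(1)] by auto
  have \<psi>_meas [measurable]: "\<psi> \<in> borel_measurable borel"
    by (rule borel_measurable_LIMSEQ_real[OF lim]) (use admD(1)[OF \<phi>(1)] in auto)
  have \<psi>: "adm \<psi>" using \<psi>_bound \<psi>_meas by (simp add: adm_def)
  have \<psi>_lip: "\<bar>\<psi> x - \<psi> y\<bar> \<le> ?L * \<bar>x - y\<bar>" for x y
    by (rule LIMSEQ_le_const2[OF tendsto_rabs[OF tendsto_diff[OF lim lim]]]) (use \<phi>(5) in auto)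
  have "A \<psi> x = \<psi> x" for x
  proof -
    have "(\<lambda>n. \<phi> (r n) x - A (\<phi> (r n)) x) \<longlonglongrightarrow> 0"
    proof (rule tendsto_sandwich[OF _ _ tendsto_const])
      have "(\<lambda>n. 1 / real (Suc n) * \<zeta>2) \<longlonglongrightarrow> 0 * \<zeta>2"
        by (intro tendsto_mult tendsto_const) (use LIMSEQ_inverse_real_of_nat in \<open>simp add: inverse_eq_divide\<close>)
      then show "(\<lambda>n. 1 / real (Suc (r n)) * \<zeta>2) \<longlonglongrightarrow> 0"
        using LIMSEQ_subseq_LIMSEQ[OF _ r] by (fastforce simp: o_def)
      show "\<forall>\<^sub>F n in sequentially. \<phi> (r n) x - A (\<phi> (r n)) x \<le> 1 / real (Suc (r n)) * \<zeta>2"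
        using \<phi>(3) by (intro always_eventually allI) (smt (verit))
    qed (use \<phi>(2) in auto)
    moreover have "(\<lambda>n. \<phi> (r n) x - A (\<phi> (r n)) x) \<longlonglongrightarrow> \<psi> x - A \<psi> x"
      by (intro tendsto_intros lim A_LIMSEQ) (use \<phi> \<psi> in auto)
    ultimately show ?thesis using LIMSEQ_unique by fastforce
  qed
  moreover have "(\<psi> \<longlongrightarrow> 0) at_bot"
  proof (rule lipschitz_integrable_tendsto_zero[OF \<psi>_lip \<psi>_bound(1) \<psi>_meas])
    have [measurable]: "\<phi> n \<in> borel_measurable borel" for n by (rule admD(1)[OF \<phi>(1)])
    \<comment> \<open>Fatou's lemma: the integral bound does not depend on \<open>n\<close>, so it
      passes to the pointwise limit.\<close>
    have "ennreal (q * \<eta>) * (\<integral>\<^sup>+x. ennreal (\<psi> x) * indicator {..0} x \<partial>lborel)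
      = (\<integral>\<^sup>+x. liminf (\<lambda>n. ennreal (q * \<eta>) * (ennreal (\<phi> (r n) x) * indicator {..0} x)) \<partial>lborel)"
    proof (subst nn_integral_cmult[symmetric], simp, rule nn_integral_cong)
      fix x :: real
      have "(\<lambda>n. ennreal (q * \<eta>) * (ennreal (\<phi> (r n) x) * indicator {..0} x))
          \<longlonglongrightarrow> ennreal (q * \<eta>) * (ennreal (\<psi> x) * indicator {..0} x)"
        using tendsto_ennrealI[OF lim[of x]] by (auto simp: indicator_def intro!: ennreal_tendsto_cmult)
      then show "ennreal (q * \<eta>) * (ennreal (\<psi> x) * indicator {..0} x)
          = liminf (\<lambda>n. ennreal (q * \<eta>) * (ennreal (\<phi> (r n) x) * indicator {..0} x))"
        by (simp add: lim_imp_Liminf)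
    qed
    also have "\<dots> \<le> liminf (\<lambda>n. \<integral>\<^sup>+x. ennreal (q * \<eta>) * (ennreal (\<phi> (r n) x) * indicator {..0} x) \<partial>lborel)"
      by (rule nn_integral_liminf) simp
    also have "\<dots> \<le> ?C"
      by (rule Liminf_le) (use \<phi>(6) in \<open>auto simp: nn_integral_cmult\<close>)
    also have "?C < \<infinity>" using moment1 moment2 by (simp add: ennreal_mult_less_top)
    finally show "(\<integral>\<^sup>+x. ennreal (\<psi> x) * indicator {..0} x \<partial>lborel) < \<infinity>"
      using \<eta> q_pos by (auto simp: ennreal_mult_less_top)
  qed
  moreover have "continuous_on UNIV \<psi>" by (rule lipschitz_continuous_on_UNIV[OF \<psi>_lip])
  moreover have "\<psi> 0 = \<delta>"
    by (rule LIMSEQ_unique[OF lim[of 0]]) (simp add: \<phi>(4))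
  ultimately show ?thesis using that[OF \<psi>, of 0] \<delta> by auto
qed

text \<open>If \<open>\<phi>\<close> is positive at \<open>x\<close>, it exceeds
  \<open>\<phi> x / 2\<close> nearby, and \<open>\<mu>1\<close> charges the displacements that lead
  from there to any \<open>y\<close> at distance less than 1. Finitely many such steps join any two
  points.\<close>

lemma fixed_point_pos:
  assumes \<phi>: "adm \<phi>" "A \<phi> = \<phi>" and cont: "continuous_on UNIV \<phi>" and x0: "0 < \<phi> x0"
  shows "0 < \<phi> x"
proof -
  have step: "0 < \<phi> y" if pos: "0 < \<phi> x" and near: "\<bar>y - x\<bar> < 1" for x y
  proof -
    obtain h where h: "h > 0" "\<And>z. \<bar>z - x\<bar> < h \<Longrightarrow> \<phi> x / 2 < \<phi> z"
    proof -
      have "isCont \<phi> x" using cont by (simp add: continuous_on_eq_continuous_at)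
      then have "eventually (\<lambda>z. \<phi> x / 2 < \<phi> z) (nhds x)"
        using pos by (intro order_tendstoD(1)[of \<phi> "\<phi> x"]) (auto simp: isCont_def tendsto_at_iff_tendsto_nhds)
      then show ?thesis using that unfolding eventually_nhds_metric dist_real_def by blast
    qed
    define k where "k = min h ((1 - \<bar>y - x\<bar>) / 2)"
    have k: "0 < k" "k \<le> h" "k < 1 - \<bar>y - x\<bar>" using near h(1) by (auto simp: k_def min_less_iff_disj)
    define a where "a = y - x - k"
    define b where "b = y - x + k"
    have ab: "-1 < a" "a < b" "b < 1" using k unfolding a_def b_def by linarith+
    have "0 < p * (\<phi> x / 2 * measure \<mu>1 {a<..<b})"
      using charges[OF ab] p_pos pos by simp
    also have "\<phi> x / 2 * measure \<mu>1 {a<..<b} \<le> conv \<mu>1 \<phi> y"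
    proof (rule M1.conv_ge_measure[of _ \<zeta>2])
      show "\<phi> x / 2 \<le> \<phi> (y - z)" if "z \<in> {a<..<b}" for z
        by (rule less_imp_le, rule h(2)) (use that k in \<open>auto simp: a_def b_def\<close>)
    qed (use admD[OF \<phi>(1)] in auto)
    also have "p * conv \<mu>1 \<phi> y \<le> A \<phi> y" unfolding A_def
      using q_pos M2.conv_nonneg[of "\<lambda>s. G (\<phi> s)" y] G_nonneg by simp
    finally show ?thesis using p_pos \<phi>(2) by simp
  qed
  obtain N :: nat where N: "\<bar>x - x0\<bar> < real N" using reals_Archimedean2 by blast
  define d where "d = (x - x0) / N"
  have d: "\<bar>d\<bar> < 1" "x0 + real N * d = x" using N by (auto simp: d_def abs_divide)
  have "0 < \<phi> (x0 + real n * d)" for n :: nat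
  proof (induction n)
    case (Suc n)
    show ?case by (rule step[OF Suc]) (use d in \<open>simp add: algebra_simps\<close>)
  qed (use x0 in simp)
  then show ?thesis using d(2) by metis
qed

end

section \<open>Persistence and convergence at plus infinity\<close>

text \<open>The Laplace transform restricted to a window, hence finite for every \<open>z\<close>.
  The bounded window also means that a lower estimate of \<open>conv\<close> at \<open>x\<close>
  reads \<open>\<phi>\<close> only within distance \<open>R\<close>.\<close>

definition trunc_laplace :: "real measure \<Rightarrow> real \<Rightarrow> real \<Rightarrow> real" where
  "trunc_laplace \<mu> R z = (\<integral>y. indicator {-R..R} y * exp (- z * y) \<partial>\<mu>)"

context real_distribution
begin

lemma trunc_bound: "\<bar>indicator {-R..R} y * exp (- z * y)\<bar> \<le> exp (\<bar>z\<bar> * R)" for y :: real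
proof -
  have "- (z * y) \<le> \<bar>z\<bar> * R" if "y \<in> {-R..R}"
  proof -
    have "- (z * y) \<le> \<bar>z\<bar> * \<bar>y\<bar>" by (simp flip: abs_mult)
    also have "\<dots> \<le> \<bar>z\<bar> * R" using that by (intro mult_left_mono) auto
    finally show ?thesis .
  qed
  then show ?thesis by (auto simp: indicator_def)
qed

lemma trunc_integrable: "integrable M (\<lambda>y. indicator {-R..R} y * exp (- z * y))"
  using trunc_bound[of R _ z] by (intro integrable_const_bound[of _ "exp (\<bar>z\<bar> * R)"]) auto

lemma trunc_laplace_mono:
  assumes "R \<le> R'"
  shows "trunc_laplace M R z \<le> trunc_laplace M R' z"
  unfolding trunc_laplace_def
  by (rule integral_mono[OF trunc_integrable trunc_integrable]) (use assms in \<open>auto simp: indicator_def\<close>)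

lemma trunc_laplace_nonneg: "0 \<le> trunc_laplace M R z"
  unfolding trunc_laplace_def by (intro integral_nonneg_AE) simp

lemma trunc_laplace_LIMSEQ:
  assumes "z \<longlonglongrightarrow> z'" and Z: "\<And>n. \<bar>z n\<bar> \<le> Z" and "0 \<le> R"
  shows "(\<lambda>n. trunc_laplace M R (z n)) \<longlonglongrightarrow> trunc_laplace M R z'"
  unfolding trunc_laplace_def
proof (rule integral_dominated_convergence[where w = "\<lambda>_. exp (Z * R)"])
  show "AE y in M. norm (indicator {-R..R} y * exp (- z n * y)) \<le> exp (Z * R)" for n
  proof (rule AE_I2)
    fix y
    have "exp (\<bar>z n\<bar> * R) \<le> exp (Z * R)" using mult_right_mono[OF Z \<open>0 \<le> R\<close>] by simp
    then show "norm (indicator {-R..R} y * exp (- z n * y)) \<le> exp (Z * R)"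
      using order_trans[OF trunc_bound[of R y "z n"]] by (simp only: real_norm_def)
  qed
  show "AE y in M. (\<lambda>n. indicator {-R..R} y * exp (- z n * y)) \<longlonglongrightarrow> indicator {-R..R} y * exp (- z' * y)"
    using assms(1) by (intro AE_I2 tendsto_intros)
qed auto

text \<open>Both exponentials lie above their tangents \<open>1 - z * y\<close> at 0; in the
  weighted sum the linear terms cancel because the weighted mean of \<open>z1\<close> and
  \<open>z2\<close> is 0.\<close>

lemma trunc_laplace_convex:
  assumes t: "0 \<le> t" "t \<le> 1" and z: "t * z1 + (1 - t) * z2 = 0"
  shows "trunc_laplace M R 0 \<le> t * trunc_laplace M R z1 + (1 - t) * trunc_laplace M R z2"
proof -
  have pt: "1 \<le> t * exp (- z1 * y) + (1 - t) * exp (- z2 * y)" for y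
  proof -
    have "t * (1 + (- z1 * y)) + (1 - t) * (1 + (- z2 * y)) \<le> t * exp (- z1 * y) + (1 - t) * exp (- z2 * y)"
      using t by (intro add_mono mult_left_mono exp_ge_add_one_self) auto
    moreover have "t * (1 + (- z1 * y)) + (1 - t) * (1 + (- z2 * y)) = 1 - (t * z1 + (1 - t) * z2) * y"
      by algebra
    ultimately show ?thesis using z by simp
  qed
  have "trunc_laplace M R 0 \<le> (\<integral>y. t * (indicator {-R..R} y * exp (- z1 * y)) + (1 - t) * (indicator {-R..R} y * exp (- z2 * y)) \<partial>M)"
    unfolding trunc_laplace_def
    by (intro integral_mono trunc_integrable Bochner_Integration.integrable_add integrable_mult_right)
       (use pt in \<open>auto simp: indicator_def\<close>)
  also have "\<dots> = t * trunc_laplace M R z1 + (1 - t) * trunc_laplace M R z2"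
    unfolding trunc_laplace_def
    by (subst Bochner_Integration.integral_add) (use trunc_integrable in \<open>auto intro: integrable_mult_right\<close>)
  finally show ?thesis .
qed

lemma trunc_laplace_0_LIMSEQ: "(\<lambda>n. trunc_laplace M (real n) 0) \<longlonglongrightarrow> 1"
proof -
  have "(\<lambda>n. trunc_laplace M (real n) 0) \<longlonglongrightarrow> (\<integral>y. 1 \<partial>M)"
    unfolding trunc_laplace_def
  proof (rule integral_dominated_convergence[where w = "\<lambda>_. 1"])
    have "(\<lambda>n. indicator {- real n..real n} y * exp (- 0 * y)) \<longlonglongrightarrow> (1 :: real)" for y
    proof (rule tendsto_eventually)
      from eventually_abs_less_real[of y] show "\<forall>\<^sub>F n in sequentially. indicator {- real n..real n} y * exp (- 0 * y) = 1"
        by (rule eventually_mono) (auto simp: indicator_def)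
    qed
    then show "AE y in M. (\<lambda>n. indicator {- real n..real n} y * exp (- 0 * y)) \<longlonglongrightarrow> 1" by simp
  qed (auto simp: indicator_def)
  then show ?thesis using prob_space by simp
qed

lemma trunc_laplace_le: "ennreal (trunc_laplace M R z) \<le> (\<integral>\<^sup>+y. ennreal (exp (- z * y)) \<partial>M)"
  unfolding trunc_laplace_def
  by (subst nn_integral_eq_integral[OF trunc_integrable, symmetric], simp, intro nn_integral_mono)
     (auto simp: indicator_def intro!: ennreal_leI)

lemma conv_ge_trunc_laplace:
  assumes "f \<in> borel_measurable borel" "\<And>x. 0 \<le> f x" "\<And>x. f x \<le> B"
    and c: "\<And>y. y \<in> {-R..R} \<Longrightarrow> c * exp (z * (x - y)) \<le> f (x - y)"
  shows "c * exp (z * x) * trunc_laplace M R z \<le> conv M f x"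
proof -
  have "c * exp (z * x) * trunc_laplace M R z = (\<integral>y. c * exp (z * x) * (indicator {-R..R} y * exp (- z * y)) \<partial>M)"
    by (simp add: trunc_laplace_def)
  also have "\<dots> \<le> conv M f x" unfolding conv_def
  proof (rule integral_mono)
    show "integrable M (\<lambda>y. c * exp (z * x) * (indicator {-R..R} y * exp (- z * y)))"
      by (intro integrable_mult_right trunc_integrable)
    show "integrable M (\<lambda>y. f (x - y))"
      by (rule integrable_translate[of f B]) (use assms in auto)
    show "c * exp (z * x) * (indicator {-R..R} y * exp (- z * y)) \<le> f (x - y)" for y
      using c[of y] assms(2)[of "x - y"] by (auto simp: indicator_def right_diff_distrib exp_diff exp_minus field_simps)
  qed
  finally show ?thesis .
qed

end

context convolution_equation
begin

text \<open>
  The untruncated transform may be infinite for \<open>z < 0\<close>. If the claim failed for all truncations, a limit point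
  \<open>l\<close> of the offending \<open>z\<close> would have transform at most \<open>1\<close>, just as \<open>\<rho>\<close> does; by convexity
  the transform \<open>p + q \<gamma>\<close> at \<open>0\<close> would be at most \<open>1\<close>.
\<close>

lemma transform_pos_on_nonpos:
  obtains R \<gamma>' \<theta> where "0 < R" "0 < \<gamma>'" "\<gamma>' < \<gamma>" "0 < \<theta>"
    "\<And>z. z0 \<le> z \<Longrightarrow> z \<le> 0 \<Longrightarrow> exp (\<theta> * R) \<le> p * trunc_laplace \<mu>1 R z + q * \<gamma>' * trunc_laplace \<mu>2 R z"
proof -
  \<comment> \<open>Slopes increasing to \<open>\<gamma>\<close> from below. The shift by 2 keeps
    \<open>g 0\<close> positive.\<close>
  define g where "g n = \<gamma> * (1 - 1 / real (n + 2))" for n :: nat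
  define T where "T R g z = p * trunc_laplace \<mu>1 R z + q * g * trunc_laplace \<mu>2 R z" for R g z
  have g: "0 < g n" "g n < \<gamma>" for n using gamma by (auto simp: g_def)
  have g_lim: "g \<longlonglongrightarrow> \<gamma>"
  proof -
    have "(\<lambda>n. 1 / real (n + 2)) \<longlonglongrightarrow> 0"
      using LIMSEQ_ignore_initial_segment[OF lim_1_over_n, of 2] by simp
    then have "(\<lambda>n. \<gamma> * (1 - 1 / real (n + 2))) \<longlonglongrightarrow> \<gamma> * (1 - 0)" by (intro tendsto_intros)
    then show ?thesis unfolding g_def[abs_def] by simp
  qed
  have "\<exists>n. \<forall>z\<in>{z0..0}. 1 + 1 / real (n + 1) \<le> T (real (n + 1)) (g n) z"
  proof (rule ccontr)
    assume "\<not> ?thesis"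
    then have "\<forall>n. \<exists>z\<in>{z0..0}. T (real (n + 1)) (g n) z < 1 + 1 / real (n + 1)" by (simp add: not_le)
    then obtain z where z: "\<And>n. z n \<in> {z0..0}" "\<And>n. T (real (n + 1)) (g n) (z n) < 1 + 1 / real (n + 1)" by metis
    obtain l r where l: "l \<in> {z0..0}" and r: "strict_mono (r :: nat \<Rightarrow> nat)" and lim: "(z \<circ> r) \<longlonglongrightarrow> l"
      using compact_imp_seq_compact[OF compact_Icc[of z0 0]] z(1) unfolding seq_compact_def by metis
    \<comment> \<open>The level \<open>m\<close> stays fixed while \<open>n\<close> grows. Truncated
      transforms increase with the level, so eventually those at level \<open>m\<close> are
      dominated by those at level \<open>r n + 1\<close>, and continuity in \<open>z\<close> is
      needed only at level \<open>m\<close>.\<close>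
    have T_l: "T m \<gamma> l \<le> 1" if m: "0 \<le> m" for m
    proof (rule LIMSEQ_le)
      show "(\<lambda>n. T m (g (r n)) (z (r n))) \<longlonglongrightarrow> T m \<gamma> l"
        unfolding T_def
      proof (intro tendsto_intros M1.trunc_laplace_LIMSEQ[where Z = "\<bar>z0\<bar>"] M2.trunc_laplace_LIMSEQ[where Z = "\<bar>z0\<bar>"])
        show "(\<lambda>n. g (r n)) \<longlonglongrightarrow> \<gamma>" using LIMSEQ_subseq_LIMSEQ[OF g_lim r] by (simp add: o_def)
        show "(\<lambda>n. z (r n)) \<longlonglongrightarrow> l" "(\<lambda>n. z (r n)) \<longlonglongrightarrow> l" using lim by (simp_all add: o_def)
        show "\<bar>z (r n)\<bar> \<le> \<bar>z0\<bar>" "\<bar>z (r n)\<bar> \<le> \<bar>z0\<bar>" for n using z(1)[of "r n"] by auto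
      qed (use m in auto)
      have "(\<lambda>n. 1 + 1 / real (n + 1)) \<longlonglongrightarrow> 1 + 0"
        using LIMSEQ_ignore_initial_segment[OF lim_1_over_n, of 1] by (intro tendsto_intros) simp
      then show "(\<lambda>n. 1 + 1 / real (r n + 1)) \<longlonglongrightarrow> 1"
        using LIMSEQ_subseq_LIMSEQ[OF _ r] by (fastforce simp: o_def)
      show "\<exists>N. \<forall>n\<ge>N. T m (g (r n)) (z (r n)) \<le> 1 + 1 / real (r n + 1)"
      proof (intro exI allI impI)
        fix n assume n: "nat \<lceil>m\<rceil> \<le> n"
        then have "m \<le> real (r n + 1)" using seq_suble[OF r, of n] by linarith
        then have "T m (g (r n)) (z (r n)) \<le> T (real (r n + 1)) (g (r n)) (z (r n))"
          unfolding T_def using p_pos q_pos g(1)[of "r n"]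
          by (intro add_mono mult_left_mono M1.trunc_laplace_mono M2.trunc_laplace_mono) auto
        then show "T m (g (r n)) (z (r n)) \<le> 1 + 1 / real (r n + 1)" using z(2)[of "r n"] by linarith
      qed
    qed
    have T_rho: "T m \<gamma> \<rho> \<le> 1" for m
    proof -
      have "ennreal (T m \<gamma> \<rho>) = ennreal p * ennreal (trunc_laplace \<mu>1 m \<rho>) + ennreal (q * \<gamma>) * ennreal (trunc_laplace \<mu>2 m \<rho>)"
        unfolding T_def using p_pos q_pos gamma
        by (simp add: ennreal_plus ennreal_mult M1.trunc_laplace_nonneg M2.trunc_laplace_nonneg)
      also have "\<dots> \<le> 1"
        by (rule order_trans[OF _ transform]) (intro add_mono mult_left_mono M1.trunc_laplace_le M2.trunc_laplace_le; simp)
      finally show ?thesis by (simp add: ennreal_le_1)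
    qed
    define t where "t = - l / (\<rho> - l)"
    have t: "0 \<le> t" "t \<le> 1" "t * \<rho> + (1 - t) * l = 0" using l rho_pos by (auto simp: t_def field_simps)
    have T_0: "T m \<gamma> 0 \<le> 1" if "0 \<le> m" for m
    proof -
      have "T m \<gamma> 0 \<le> p * (t * trunc_laplace \<mu>1 m \<rho> + (1 - t) * trunc_laplace \<mu>1 m l)
          + q * \<gamma> * (t * trunc_laplace \<mu>2 m \<rho> + (1 - t) * trunc_laplace \<mu>2 m l)"
        unfolding T_def using p_pos q_pos gamma
        by (intro add_mono mult_left_mono M1.trunc_laplace_convex M2.trunc_laplace_convex t) auto
      also have "\<dots> = t * T m \<gamma> \<rho> + (1 - t) * T m \<gamma> l" by (simp add: T_def algebra_simps)
      also have "\<dots> \<le> t * 1 + (1 - t) * 1"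
        using t by (intro add_mono mult_left_mono T_rho T_l that) auto
      finally show ?thesis by simp
    qed
    have "(\<lambda>n. T (real n) \<gamma> 0) \<longlonglongrightarrow> p * 1 + q * \<gamma> * 1"
      unfolding T_def by (intro tendsto_intros M1.trunc_laplace_0_LIMSEQ M2.trunc_laplace_0_LIMSEQ)
    then have "p * 1 + q * \<gamma> * 1 \<le> 1" by (rule LIMSEQ_le_const2) (use T_0 in auto)
    moreover have "q * 1 < q * \<gamma>" using gamma q_pos by (intro mult_strict_left_mono)
    ultimately show False using pq by linarith
  qed
  then obtain n where n: "\<And>z. z \<in> {z0..0} \<Longrightarrow> 1 + 1 / real (n + 1) \<le> T (real (n + 1)) (g n) z" by blast
  have ln: "0 < ln (1 + 1 / real (n + 1))" by (intro ln_gt_zero) (simp add: field_simps)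
  show ?thesis
  \<comment> \<open>\<open>\<theta>\<close> is chosen so that \<open>exp (\<theta> * R)\<close>
    equals the lower bound \<open>1 + 1 / real (n + 1)\<close> just obtained.\<close>
  proof (rule that[of "real (n + 1)" "g n" "ln (1 + 1 / real (n + 1)) / real (n + 1)"])
    have pos: "0 < 1 + 1 / real (n + 1)" by (simp add: add_pos_pos)
    show "exp (ln (1 + 1 / real (n + 1)) / real (n + 1) * real (n + 1))
        \<le> p * trunc_laplace \<mu>1 (real (n + 1)) z + q * g n * trunc_laplace \<mu>2 (real (n + 1)) z" if "z0 \<le> z" "z \<le> 0" for z
      using n[of z] that pos by (simp add: T_def exp_ln del: of_nat_add of_nat_Suc)
  qed (use g ln in auto)
qed

text \<open>For \<open>x > 1\<close> the displacements in \<open>(1/2, 3/4)\<close> lead back by at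
  least \<open>1/2\<close> without leaving \<open>[0, \<infinity>)\<close>. Each advance by
  \<open>1/2\<close> therefore costs at most the factor \<open>k\<close>, which makes the rate
  \<open>2 * ln k\<close>; rounding the number of steps up costs one more factor
  \<open>k\<close>.\<close>

lemma fixed_point_exponential_lower_bound:
  assumes \<phi>: "adm \<phi>" "A \<phi> = \<phi>" and cont: "continuous_on UNIV \<phi>" and pos: "\<And>x. 0 < \<phi> x"
  obtains C z0 where "0 < C" "z0 < 0" "\<And>x. 0 \<le> x \<Longrightarrow> C * exp (z0 * x) \<le> \<phi> x"
proof -
  define k where "k = p * measure \<mu>1 {1/2<..<3/4}"
  have "measure \<mu>1 {1/2<..<3/4} \<le> 1" by simp
  then have "k \<le> p * 1" unfolding k_def using p_pos by (intro mult_left_mono) auto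
  then have "k < 1" using q_pos pq by linarith
  moreover have "0 < k" using charges[of "1/2" "3/4"] p_pos by (simp add: k_def)
  ultimately have k: "0 < k" "k < 1" by auto
  have "\<exists>b\<in>{0..1}. \<forall>x\<in>{0..1}. \<phi> b \<le> \<phi> x"
    by (rule continuous_attains_inf) (use continuous_on_subset[OF cont] in auto)
  then obtain b where b: "b \<in> {0..1}" "\<And>x. x \<in> {0..1} \<Longrightarrow> \<phi> b \<le> \<phi> x" by blast
  have claim: "\<phi> b * k ^ n \<le> \<phi> x" if "0 \<le> x" "x \<le> 1 + real n / 2" for n x
    using that
  proof (induction n arbitrary: x)
    case 0 then show ?case using b by auto
  next
    case (Suc n)
    show ?case
    proof (cases "x \<le> 1 + real n / 2")
      case True
      have "\<phi> b * k ^ Suc n \<le> \<phi> b * k ^ n" using k pos[of b] by (simp add: mult_left_le_one_le)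
      also have "\<dots> \<le> \<phi> x" by (rule Suc.IH) (use Suc.prems True in auto)
      finally show ?thesis .
    next
      case False
      have "(\<phi> b * k ^ n) * measure \<mu>1 {1/2<..<3/4} \<le> conv \<mu>1 \<phi> x"
        by (rule M1.conv_ge_measure[of _ \<zeta>2])
           (use admD[OF \<phi>(1)] False Suc.prems in \<open>auto intro!: Suc.IH simp: field_simps\<close>)
      then have "\<phi> b * k ^ Suc n \<le> p * conv \<mu>1 \<phi> x"
        using p_pos mult_left_mono[of _ "conv \<mu>1 \<phi> x" p] by (fastforce simp: k_def mult_ac)
      also have "\<dots> \<le> A \<phi> x" unfolding A_def
        using q_pos M2.conv_nonneg[of "\<lambda>s. G (\<phi> s)" x] G_nonneg by simp
      finally show ?thesis using \<phi>(2) by simp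
    qed
  qed
  show ?thesis
  proof (rule that[of "\<phi> b * k" "2 * ln k"])
    fix x :: real assume x: "0 \<le> x"
    define n where "n = nat \<lceil>2 * x\<rceil>"
    have n: "2 * x \<le> real n" "real n \<le> 2 * x + 1" using x unfolding n_def by linarith+
    have "k * exp (2 * ln k * x) = exp (ln k * (2 * x + 1))"
      using k by (simp add: algebra_simps exp_add)
    also have "\<dots> \<le> exp (ln k * real n)"
      using n k by (simp add: mult_left_mono_neg)
    also have "\<dots> = k ^ n" using k by (simp add: exp_of_nat2_mult)
    finally have "\<phi> b * (k * exp (2 * ln k * x)) \<le> \<phi> b * k ^ n" using pos[of b] by simp
    also have "\<dots> \<le> \<phi> x" by (rule claim) (use x n in auto)
    finally show "\<phi> b * k * exp (2 * ln k * x) \<le> \<phi> x" by (simp add: mult.assoc)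
  qed (use k pos[of b] in auto)
qed

text \<open>Near 0 the slope bound is \<open>G_zero\<close>. Away from 0 only positivity of
  \<open>G\<close> is known, so the linear bound is capped at a level that the minimum of
  \<open>G\<close> on the compact remainder can support.\<close>

lemma G_lower:
  assumes "0 < \<gamma>'" "\<gamma>' < \<gamma>"
  obtains \<delta> where "0 < \<delta>" "\<And>s. 0 \<le> s \<Longrightarrow> s \<le> \<zeta>2 \<Longrightarrow> \<gamma>' * min s \<delta> \<le> G s"
proof -
  obtain \<delta>0' where \<delta>0': "0 < \<delta>0'" "\<And>s. s \<in> {0..\<delta>0'} \<Longrightarrow> \<gamma>' * s \<le> G s" using G_zero[OF assms(2)] by blast
  define \<delta>0 where "\<delta>0 = min \<delta>0' \<zeta>2"
  have \<delta>0: "0 < \<delta>0" "\<delta>0 \<le> \<zeta>2" "\<And>s. 0 \<le> s \<Longrightarrow> s \<le> \<delta>0 \<Longrightarrow> \<gamma>' * s \<le> G s"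
    using \<delta>0' zeta by (auto simp: \<delta>0_def)
  have "\<exists>b\<in>{\<delta>0..\<zeta>2}. \<forall>s\<in>{\<delta>0..\<zeta>2}. G b \<le> G s"
    by (rule continuous_attains_inf) (use \<delta>0 continuous_on_subset[OF G_cont] in auto)
  then obtain b where b: "b \<in> {\<delta>0..\<zeta>2}" "\<And>s. s \<in> {\<delta>0..\<zeta>2} \<Longrightarrow> G b \<le> G s" by blast
  have "0 < G b" using b \<delta>0 by (intro G_pos) auto
  show ?thesis
  proof (rule that[of "min \<delta>0 (G b / \<gamma>')"])
    show "0 < min \<delta>0 (G b / \<gamma>')" using \<delta>0 \<open>0 < G b\<close> assms by simp
    show "\<gamma>' * min s (min \<delta>0 (G b / \<gamma>')) \<le> G s" if s: "0 \<le> s" "s \<le> \<zeta>2" for s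
    proof (cases "s \<le> \<delta>0")
      case True
      have "\<gamma>' * min s (min \<delta>0 (G b / \<gamma>')) \<le> \<gamma>' * s" using assms by (intro mult_left_mono) auto
      then show ?thesis using \<delta>0(3)[OF s(1) True] by linarith
    next
      case False
      have "\<gamma>' * min s (min \<delta>0 (G b / \<gamma>')) \<le> \<gamma>' * (G b / \<gamma>')" using assms by (intro mult_left_mono) auto
      then show ?thesis using b(2)[of s] False s assms by simp
    qed
  qed
qed

text \<open>The gain \<open>\<theta>\<close> in the exponent is the same for all exponents between
  \<open>z0\<close> and 0, so finitely many rounds of \<open>improve\<close> reach the exponent 0.
  The bounds are kept for the capped function \<open>w\<close>, because \<open>G\<close> dominates
  \<open>\<gamma>' * w\<close> but not \<open>\<gamma>' * \<phi>\<close>.\<close>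

lemma fixed_point_persistence:
  assumes \<phi>: "adm \<phi>" "A \<phi> = \<phi>" and cont: "continuous_on UNIV \<phi>" and pos: "\<And>x. 0 < \<phi> x"
  shows "\<exists>m>0. eventually (\<lambda>x. m \<le> \<phi> x) at_top"
proof -
  obtain C0 z0 where C0: "0 < C0" "z0 < 0" "\<And>x. 0 \<le> x \<Longrightarrow> C0 * exp (z0 * x) \<le> \<phi> x"
    using fixed_point_exponential_lower_bound[OF assms] by blast
  obtain R \<gamma>' \<theta> where R: "0 < R" and \<gamma>': "0 < \<gamma>'" "\<gamma>' < \<gamma>" and \<theta>: "0 < \<theta>"
    and T: "\<And>z. z0 \<le> z \<Longrightarrow> z \<le> 0 \<Longrightarrow> exp (\<theta> * R) \<le> p * trunc_laplace \<mu>1 R z + q * \<gamma>' * trunc_laplace \<mu>2 R z"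
    using transform_pos_on_nonpos by blast
  obtain \<delta> where \<delta>: "0 < \<delta>" "\<And>s. 0 \<le> s \<Longrightarrow> s \<le> \<zeta>2 \<Longrightarrow> \<gamma>' * min s \<delta> \<le> G s" using G_lower[OF \<gamma>'] by blast
  define w where "w x = min (\<phi> x) \<delta>" for x
  define W where "W z \<longleftrightarrow> (\<exists>C>0. \<forall>x\<ge>0. C * exp (z * x) \<le> w x)" for z
  have improve: "W z'" if W: "W z" and z: "z0 \<le> z" "z < z'" "z' \<le> 0" "z' \<le> z + \<theta>" for z z'
  proof -
    obtain C1 where C1: "0 < C1" "\<And>x. 0 \<le> x \<Longrightarrow> C1 * exp (z * x) \<le> w x" using W unfolding W_def by blast
    define C where "C = min C1 \<delta>"
    have C: "0 < C" "C \<le> \<delta>" "C \<le> C1" using C1 \<delta> by (auto simp: C_def)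
    \<comment> \<open>Each step of length \<open>R\<close> to the right gains a factor \<open>exp ((z' - z) R) \<le> exp (\<theta> R)\<close>; as \<open>z' \<le> 0\<close>, the bound
      stays below the cap \<open>\<delta>\<close>.\<close>
    have claim: "C * exp (real n * ((z' - z) * R)) * exp (z * x) \<le> w x" if "real n * R \<le> x" for n x
      using that
    proof (induction n arbitrary: x)
      case 0
      have "C * exp (z * x) \<le> C1 * exp (z * x)" using C by (intro mult_right_mono) auto
      also have "\<dots> \<le> w x" using 0 by (intro C1(2)) simp
      finally show ?case by simp
    next
      case (Suc n)
      define B where "B = C * exp (real n * ((z' - z) * R))"
      have B0: "0 < B" using C by (simp add: B_def)
      \<comment> \<open>Since \<open>x\<close> is beyond \<open>Suc n * R\<close>, the whole window
        around it lies beyond \<open>n * R\<close>, where the induction hypothesis holds.\<close>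
      have w_low: "B * exp (z * (x - y)) \<le> w (x - y)" if "y \<in> {-R..R}" for y
        unfolding B_def by (rule Suc.IH) (use that Suc.prems in \<open>auto simp: algebra_simps\<close>)
      have c1: "B * exp (z * x) * trunc_laplace \<mu>1 R z \<le> conv \<mu>1 \<phi> x"
        by (rule M1.conv_ge_trunc_laplace[of _ \<zeta>2])
           (use admD[OF \<phi>(1)] w_low in \<open>auto simp: w_def\<close>)
      have c2: "(\<gamma>' * B) * exp (z * x) * trunc_laplace \<mu>2 R z \<le> conv \<mu>2 (\<lambda>s. G (\<phi> s)) x"
      proof (rule M2.conv_ge_trunc_laplace[of _ \<zeta>2])
        fix y assume y: "y \<in> {-R..R}"
        have "\<gamma>' * (B * exp (z * (x - y))) \<le> \<gamma>' * w (x - y)"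
          using \<gamma>' by (intro mult_left_mono w_low y) auto
        also have "\<dots> \<le> G (\<phi> (x - y))"
          unfolding w_def by (rule \<delta>(2)) (use admD[OF \<phi>(1)] in auto)
        finally show "\<gamma>' * B * exp (z * (x - y)) \<le> G (\<phi> (x - y))" by (simp add: mult.assoc)
      qed (use admD[OF \<phi>(1)] G_nonneg G_le in auto)
      have "B * exp (z * x) * exp ((z' - z) * R) \<le> B * exp (z * x) * exp (\<theta> * R)"
        using z R B0 by (intro mult_left_mono) (auto simp: mult_right_mono)
      also have "\<dots> \<le> B * exp (z * x) * (p * trunc_laplace \<mu>1 R z + q * \<gamma>' * trunc_laplace \<mu>2 R z)"
        using T[of z] z B0 by (intro mult_left_mono) auto
      also have "\<dots> = p * (B * exp (z * x) * trunc_laplace \<mu>1 R z) + q * ((\<gamma>' * B) * exp (z * x) * trunc_laplace \<mu>2 R z)"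
        by (simp add: algebra_simps)
      also have "\<dots> \<le> A \<phi> x"
        unfolding A_def using p_pos q_pos by (intro add_mono mult_left_mono c1 c2) auto
      finally have "B * exp (z * x) * exp ((z' - z) * R) \<le> \<phi> x" using \<phi>(2) by simp
      moreover have eq: "C * exp (real (Suc n) * ((z' - z) * R)) * exp (z * x) = B * exp (z * x) * exp ((z' - z) * R)"
        by (simp add: B_def algebra_simps flip: exp_add)
      moreover have "C * exp (real (Suc n) * ((z' - z) * R)) * exp (z * x) \<le> \<delta>"
      proof -
        have "z * x \<le> z * (real (Suc n) * R)" using z Suc.prems by (intro mult_left_mono_neg) auto
        then have "real (Suc n) * ((z' - z) * R) + z * x \<le> real (Suc n) * R * z'" by (simp add: algebra_simps)
        also have "\<dots> \<le> 0" using R z by (simp add: mult_nonneg_nonpos)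
        finally have "exp (real (Suc n) * ((z' - z) * R)) * exp (z * x) \<le> 1" by (simp flip: exp_add)
        then have "C * (exp (real (Suc n) * ((z' - z) * R)) * exp (z * x)) \<le> C * 1"
          using C by (intro mult_left_mono) auto
        also have "\<dots> \<le> \<delta>" using C by simp
        finally show ?thesis by (simp only: mult.assoc)
      qed
      ultimately have "C * exp (real (Suc n) * ((z' - z) * R)) * exp (z * x) \<le> \<phi> x"
        "C * exp (real (Suc n) * ((z' - z) * R)) * exp (z * x) \<le> \<delta>" by (simp_all only: eq)
      then show ?case unfolding w_def by (rule min.boundedI)
    qed
    have "C * exp (- R * (z' - z)) * exp (z' * x) \<le> w x" if x: "0 \<le> x" for x
    proof -
      \<comment> \<open>As many gains are used as fit to the left of \<open>x\<close>; the
        incomplete last window costs the constant factor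
        \<open>exp (- R * (z' - z))\<close>.\<close>
      define n where "n = nat \<lfloor>x / R\<rfloor>"
      have "real n \<le> x / R" "x / R \<le> real n + 1" using x R unfolding n_def by (simp_all add: of_nat_nat)
      then have n: "real n * R \<le> x" "x \<le> real n * R + R" using R by (simp_all add: field_simps)
      have "(x - R) * (z' - z) \<le> real n * R * (z' - z)" using n z by (intro mult_right_mono) auto
      then have "- R * (z' - z) + z' * x \<le> real n * ((z' - z) * R) + z * x" by (simp add: algebra_simps)
      then have "exp (- R * (z' - z)) * exp (z' * x) \<le> exp (real n * ((z' - z) * R)) * exp (z * x)"
        by (simp flip: exp_add)
      then have "C * (exp (- R * (z' - z)) * exp (z' * x)) \<le> C * (exp (real n * ((z' - z) * R)) * exp (z * x))"
        using C by (intro mult_left_mono) auto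
      then show ?thesis using claim[OF n(1)] by (simp add: mult.assoc)
    qed
    then show ?thesis unfolding W_def using C by (intro exI[of _ "C * exp (- R * (z' - z))"]) auto
  qed
  \<comment> \<open>The last round could pass 0, where \<open>improve\<close> no longer applies;
    \<open>min\<close> shortens it.\<close>
  have "W (min 0 (z0 + real n * \<theta>))" for n
  proof (induction n)
    case 0
    have "min C0 \<delta> * exp (z0 * x) \<le> w x" if "0 \<le> x" for x
    proof -
      have "min C0 \<delta> * exp (z0 * x) \<le> C0 * exp (z0 * x)" by (intro mult_right_mono) auto
      moreover have "exp (z0 * x) \<le> 1" using that C0 by (simp add: mult_nonpos_nonneg)
      then have "min C0 \<delta> * exp (z0 * x) \<le> \<delta> * 1" using \<delta> C0 by (intro mult_mono) auto
      ultimately show ?thesis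
        unfolding w_def using C0(3)[OF that] by (intro min.boundedI) linarith+
    qed
    then show ?case unfolding W_def using C0 \<delta> by (intro exI[of _ "min C0 \<delta>"]) auto
  next
    case (Suc n)
    have Suc': "z0 + real (Suc n) * \<theta> = z0 + real n * \<theta> + \<theta>" by (simp add: algebra_simps)
    have z0n: "z0 \<le> z0 + real n * \<theta>" using \<theta> by simp
    show ?case
    proof (cases "z0 + real n * \<theta> < 0")
      case True
      show ?thesis by (rule improve[OF Suc]) (unfold Suc', use True \<theta> z0n C0 in auto)
    next
      case False
      then show ?thesis using Suc \<theta> unfolding Suc' by (simp add: min_absorb1)
    qed
  qed
  moreover obtain n :: nat where "- z0 / \<theta> < real n" using reals_Archimedean2 by blast
  then have "min 0 (z0 + real n * \<theta>) = 0" using \<theta> by (simp add: field_simps min_def)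
  ultimately have "W 0" by metis
  then obtain C where "0 < C" "\<And>x. 0 \<le> x \<Longrightarrow> C \<le> w x" unfolding W_def by auto
  then show ?thesis
    by (intro exI[of _ C]) (auto simp: w_def eventually_at_top_linorder)
qed

end

section \<open>Globally attracting interval maps and convergence of the profile\<close>

lemma funpow_2cycle:
  assumes "f (f s) = s"
  shows "(f ^^ (2 * n)) s = s"
  using assms by (induction n) auto

text \<open>
  If \<open>m < \<kappa> < M\<close>, then \<open>G \<circ> G\<close> maps some \<open>a' < \<kappa>\<close> below itself but moves small numbers up, so it has
  a positive fixed point below \<open>\<kappa>\<close>, whose orbit cannot converge to \<open>\<kappa>\<close>.
\<close>

lemma interval_covering_attractor:
  fixes G :: "real \<Rightarrow> real"
  assumes cont: "continuous_on UNIV G" and m: "0 < m" "m \<le> M" "M \<le> \<zeta>"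
    and a: "a \<in> {m..M}" "M \<le> G a" and b: "b \<in> {m..M}" "G b \<le> m"
    and lin: "\<And>s. 0 \<le> s \<Longrightarrow> G s \<le> \<gamma> * s" and \<gamma>: "1 < \<gamma>"
    and \<kappa>: "0 < \<kappa>" "G \<kappa> = \<kappa>" and below: "\<And>s. 0 < s \<Longrightarrow> s < \<kappa> \<Longrightarrow> s < G s"
    and above: "\<And>s. \<kappa> < s \<Longrightarrow> s \<le> \<zeta> \<Longrightarrow> G s < s"
    and attract: "\<And>s. 0 < s \<Longrightarrow> s \<le> \<zeta> \<Longrightarrow> (\<lambda>n. (G ^^ n) s) \<longlonglongrightarrow> \<kappa>"
  shows "m = \<kappa> \<and> M = \<kappa>"
proof (rule ccontr)
  assume ne: "\<not> (m = \<kappa> \<and> M = \<kappa>)"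
  \<comment> \<open>Points below \<open>\<kappa>\<close> move up and points above move down. As
    \<open>G b \<le> m \<le> b\<close> and \<open>a \<le> M \<le> G a\<close>, the two points lie on
    opposite sides of \<open>\<kappa>\<close>.\<close>
  have b_ge: "\<kappa> \<le> b" using below[of b] b m by force
  have a_le: "a \<le> \<kappa>" using above[of a] a m by force
  have "m \<noteq> \<kappa>"
  proof
    assume "m = \<kappa>"
    then have "a = \<kappa>" using a_le a by auto
    then show False using a ne \<open>m = \<kappa>\<close> m \<kappa> by auto
  qed
  have "M \<noteq> \<kappa>"
  proof
    assume "M = \<kappa>"
    then have "b = \<kappa>" using b_ge b by auto
    then show False using b ne \<open>M = \<kappa>\<close> m \<kappa> by auto
  qed
  have mM: "m < \<kappa>" "\<kappa> < M" using \<open>m \<noteq> \<kappa>\<close> \<open>M \<noteq> \<kappa>\<close> a_le b_ge a b by auto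
  have "b \<noteq> \<kappa>" "a \<noteq> \<kappa>" using a b mM \<kappa> by auto
  \<comment> \<open>On \<open>[a, \<kappa>]\<close> the map descends from at least \<open>M\<close>
    to \<open>\<kappa>\<close>, so it attains \<open>b\<close>. The preimage satisfies
    \<open>G (G a') = G b \<le> m \<le> a'\<close>.\<close>
  have "\<exists>x\<ge>a. x \<le> \<kappa> \<and> G x = b"
    by (rule IVT2') (use a b a_le b_ge \<kappa> continuous_on_subset[OF cont] in auto)
  then obtain a' where a': "a \<le> a'" "a' \<le> \<kappa>" "G a' = b" by blast
  have a'_less: "a' < \<kappa>" using a' \<open>b \<noteq> \<kappa>\<close> \<kappa> by (metis order_le_less)
  have GG_a': "G (G a') \<le> a'" using a' b a by auto
  \<comment> \<open>The second term gives \<open>\<gamma> * s0 < \<kappa>\<close>: the image of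
    \<open>s0\<close> is still below \<open>\<kappa>\<close>, and both applications of
    \<open>G\<close> move up.\<close>
  define s0 where "s0 = min (a' / 2) (\<kappa> / (2 * \<gamma>))"
  have s0: "0 < s0" "s0 \<le> a'" "\<gamma> * s0 < \<kappa>"
  proof -
    show "0 < s0" using a m a' \<kappa> \<gamma> by (auto simp: s0_def)
    show "s0 \<le> a'" using a m a' by (auto simp: s0_def)
    have "\<gamma> * s0 \<le> \<gamma> * (\<kappa> / (2 * \<gamma>))" using \<gamma> by (intro mult_left_mono) (auto simp: s0_def)
    then show "\<gamma> * s0 < \<kappa>" using \<gamma> \<kappa> by simp
  qed
  have Gs0: "s0 < G s0" "G s0 < \<kappa>" using below[of s0] lin[of s0] s0 a'_less by auto
  then have GG_s0: "s0 \<le> G (G s0)" using below[of "G s0"] s0 by auto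
  have "continuous_on {s0..a'} (\<lambda>s. G (G s) - s)"
    using continuous_on_subset[OF cont] continuous_on_compose2[OF cont, of _ G] by (intro continuous_intros) auto
  then have "\<exists>s\<ge>s0. s \<le> a' \<and> G (G s) - s = 0"
    by (intro IVT2') (use GG_a' GG_s0 s0 in auto)
  then obtain s where s: "s0 \<le> s" "s \<le> a'" "G (G s) = s" by auto
  have "(\<lambda>n. (G ^^ n) s) \<longlonglongrightarrow> \<kappa>" by (rule attract) (use s s0 a'_less mM m in auto)
  then have "(\<lambda>n. (G ^^ (2 * n)) s) \<longlonglongrightarrow> \<kappa>"
    using LIMSEQ_subseq_LIMSEQ[of "\<lambda>n. (G ^^ n) s" \<kappa> "\<lambda>n. 2 * n"] by (simp add: o_def strict_mono_def)
  then have "s = \<kappa>" unfolding funpow_2cycle[of G, OF s(3)] using LIMSEQ_unique tendsto_const by blast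
  then show False using s a'_less by simp
qed

lemma continuous_near_interval:
  fixes G :: "real \<Rightarrow> real"
  assumes cont: "continuous_on UNIV G" and "m \<le> M" and e: "0 < e"
  obtains h where "0 < h" "\<And>s. m - h \<le> s \<Longrightarrow> s \<le> M + h \<Longrightarrow> \<exists>t\<in>{m..M}. \<bar>G s - G t\<bar> \<le> e"
proof -
  have "uniformly_continuous_on {m - 1..M + 1} G"
    by (rule compact_uniformly_continuous) (use continuous_on_subset[OF cont] in auto)
  then obtain d where d: "0 < d" "\<And>s t. s \<in> {m - 1..M + 1} \<Longrightarrow> t \<in> {m - 1..M + 1} \<Longrightarrow> \<bar>t - s\<bar> < d \<Longrightarrow> \<bar>G t - G s\<bar> < e"
    using e unfolding uniformly_continuous_on_def dist_real_def by meson
  show ?thesis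
  proof (rule that[of "min 1 (d / 2)"])
    fix s assume s: "m - min 1 (d / 2) \<le> s" "s \<le> M + min 1 (d / 2)"
    define t where "t = max m (min M s)"
    have "\<bar>s - t\<bar> < d" "s \<in> {m - 1..M + 1}" "t \<in> {m - 1..M + 1}" "t \<in> {m..M}"
      using s d(1) \<open>m \<le> M\<close> unfolding t_def by (auto simp: min_def max_def split: if_splits)
    then show "\<exists>t\<in>{m..M}. \<bar>G s - G t\<bar> \<le> e" using d(2)[of t s] by (intro bexI[of _ t]) auto
  qed (use e d in auto)
qed

context convolution_equation
begin

text \<open>With \<open>m\<close> the lower and \<open>M\<close> the upper limit of
  \<open>\<phi>\<close> at \<open>+\<infinity>\<close>, the equation
  \<open>A \<phi> = \<phi>\<close> gives \<open>p * m + q * G b \<le> m\<close> and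
  \<open>M \<le> p * M + q * G a\<close>, where \<open>b\<close> and \<open>a\<close> are extremal
  for \<open>G\<close> on \<open>[m, M]\<close>. As \<open>p + q = 1\<close>, \<open>G\<close>
  stretches \<open>[m, M]\<close> over itself, which an attractor allows only for a single
  point.\<close>

lemma fixed_point_tendsto:
  assumes \<phi>: "adm \<phi>" "A \<phi> = \<phi>" and z: "0 < z" "eventually (\<lambda>x. z \<le> \<phi> x) at_top"
    and fix_only: "{s. 0 \<le> s \<and> G s = s} = {0, \<kappa>}"
    and attract: "\<And>s. 0 < s \<Longrightarrow> s \<le> \<zeta>2 \<Longrightarrow> (\<lambda>n. (G ^^ n) s) \<longlonglongrightarrow> \<kappa>"
  shows "(\<phi> \<longlongrightarrow> \<kappa>) at_top"
proof -
  \<comment> \<open>The equation \<open>fix_only\<close> alone would admit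
    \<open>\<kappa> = 0\<close>; a fixed point in \<open>[\<zeta>1, \<zeta>2]\<close> rules this out
    and locates \<open>\<kappa>\<close>.\<close>
  have "\<exists>s\<ge>\<zeta>1. s \<le> \<zeta>2 \<and> G s - s = 0"
    by (rule IVT2') (use G_above[of \<zeta>1] G_le[of \<zeta>2] zeta continuous_on_subset[OF G_cont]
        in \<open>auto intro!: continuous_intros\<close>)
  then obtain s where s: "\<zeta>1 \<le> s" "s \<le> \<zeta>2" "G s = s" by auto
  have fix_eq: "s = \<kappa>" if "0 < s" "G s = s" for s
  proof -
    have "s \<in> {s. 0 \<le> s \<and> G s = s}" using that by simp
    then show ?thesis unfolding fix_only using that by simp
  qed
  have \<kappa>: "\<zeta>1 \<le> \<kappa>" "\<kappa> \<le> \<zeta>2" "G \<kappa> = \<kappa>" "0 < \<kappa>"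
    using fix_eq[of s] s zeta by auto
  have below: "s < G s" if s: "0 < s" "s < \<kappa>" for s
  proof (rule ccontr)
    assume "\<not> s < G s"
    then have "\<zeta>1 < s" using G_above[of s] s by force
    have "\<exists>t\<ge>\<zeta>1. t \<le> s \<and> G t - t = 0"
      by (rule IVT2') (use G_above[of \<zeta>1] \<open>\<not> s < G s\<close> \<open>\<zeta>1 < s\<close> zeta continuous_on_subset[OF G_cont]
          in \<open>auto intro!: continuous_intros\<close>)
    then obtain t where "\<zeta>1 \<le> t" "t \<le> s" "G t = t" by auto
    then show False using fix_eq[of t] s zeta by auto
  qed
  have above: "G s < s" if s: "\<kappa> < s" "s \<le> \<zeta>2" for s
  proof (rule ccontr)
    assume "\<not> G s < s"
    have "\<exists>t\<ge>s. t \<le> \<zeta>2 \<and> G t - t = 0"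
      by (rule IVT2') (use G_le[of \<zeta>2] \<open>\<not> G s < s\<close> s continuous_on_subset[OF G_cont]
          in \<open>auto intro!: continuous_intros\<close>)
    then obtain t where "s \<le> t" "G t = t" by auto
    then show False using fix_eq[of t] s \<kappa> by auto
  qed
  define S where "S = {\<alpha>. eventually (\<lambda>x. \<alpha> \<le> \<phi> x) at_top}"
  define S' where "S' = {\<alpha>. eventually (\<lambda>x. \<phi> x \<le> \<alpha>) at_top}"
  have S_le: "\<alpha> \<le> \<alpha>'" if "\<alpha> \<in> S" "\<alpha>' \<in> S'" for \<alpha> \<alpha>'
  proof -
    have "eventually (\<lambda>x. \<alpha> \<le> \<phi> x \<and> \<phi> x \<le> \<alpha>') at_top"
      using that by (auto simp: S_def S'_def eventually_conj_iff)
    then obtain x where "\<alpha> \<le> \<phi> x \<and> \<phi> x \<le> \<alpha>'"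
      using eventually_happens'[OF trivial_limit_at_top_linorder] by blast
    then show ?thesis by linarith
  qed
  have zS: "z \<in> S" and \<zeta>S': "\<zeta>2 \<in> S'" using z admD(3)[OF \<phi>(1)] by (auto simp: S_def S'_def)
  have bdd: "bdd_above S" "bdd_below S'"
    using S_le zS \<zeta>S' by (meson bdd_aboveI bdd_belowI)+
  define m where "m = Sup S"
  define M where "M = Inf S'"
  have mM: "0 < m" "m \<le> M" "M \<le> \<zeta>2"
  proof -
    show "0 < m" using cSup_upper[OF zS bdd(1)] z by (simp add: m_def)
    show "m \<le> M" unfolding m_def M_def
      using zS \<zeta>S' S_le by (intro cSup_least cInf_greatest) auto
    show "M \<le> \<zeta>2" unfolding M_def by (rule cInf_lower[OF \<zeta>S' bdd(2)])
  qed
  have near: "eventually (\<lambda>x. m - h \<le> \<phi> x \<and> \<phi> x \<le> M + h) at_top" if h: "0 < h" for h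
  proof -
    have "\<exists>\<alpha>\<in>S. m - h < \<alpha>" by (rule less_cSupD) (use zS h in \<open>auto simp: m_def\<close>)
    then have "eventually (\<lambda>x. m - h \<le> \<phi> x) at_top"
      unfolding S_def by (auto elim!: eventually_mono)
    moreover have "\<exists>\<alpha>\<in>S'. \<alpha> < M + h" by (rule cInf_lessD) (use \<zeta>S' h in \<open>auto simp: M_def\<close>)
    then have "eventually (\<lambda>x. \<phi> x \<le> M + h) at_top"
      unfolding S'_def by (auto elim!: eventually_mono)
    ultimately show ?thesis by (rule eventually_conj)
  qed
  have "\<exists>b\<in>{m..M}. \<forall>s\<in>{m..M}. G b \<le> G s"
    by (rule continuous_attains_inf) (use mM continuous_on_subset[OF G_cont] in auto)
  then obtain b where b: "b \<in> {m..M}" "\<And>s. s \<in> {m..M} \<Longrightarrow> G b \<le> G s" by blast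
  have "\<exists>a\<in>{m..M}. \<forall>s\<in>{m..M}. G s \<le> G a"
    by (rule continuous_attains_sup) (use mM continuous_on_subset[OF G_cont] in auto)
  then obtain a where a: "a \<in> {m..M}" "\<And>s. s \<in> {m..M} \<Longrightarrow> G s \<le> G a" by blast
  have G_near: "eventually (\<lambda>x. \<exists>t\<in>{m..M}. \<bar>G (\<phi> x) - G t\<bar> \<le> e) at_top" if e: "0 < e" for e
  proof -
    obtain h where h: "0 < h" "\<And>s. m - h \<le> s \<Longrightarrow> s \<le> M + h \<Longrightarrow> \<exists>t\<in>{m..M}. \<bar>G s - G t\<bar> \<le> e"
      using continuous_near_interval[OF G_cont mM(2) e] by blast
    show ?thesis using near[OF h(1)] by (rule eventually_mono) (use h(2) in blast)
  qed
  \<comment> \<open>The error \<open>e\<close> is two times \<open>e'\<close>: one \<open>e'\<close>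
    for being only close to the limiting values, one for the tail of the convolution.\<close>
  have "p * m + q * G b \<le> m"
  proof (rule field_le_epsilon)
    fix e :: real assume "0 < e"
    define e' where "e' = e / 2"
    have e': "0 < e'" using \<open>0 < e\<close> by (simp add: e'_def)
    have "eventually (\<lambda>x. (m - e') - e' \<le> conv \<mu>1 \<phi> x) at_top"
      by (rule M1.conv_eventually_ge[of _ \<zeta>2])
         (use admD[OF \<phi>(1)] e' near[OF e'] in \<open>auto simp: eventually_conj_iff\<close>)
    moreover have "eventually (\<lambda>x. (G b - e') - e' \<le> conv \<mu>2 (\<lambda>s. G (\<phi> s)) x) at_top"
    proof (rule M2.conv_eventually_ge[of _ \<zeta>2])
      show "eventually (\<lambda>x. G b - e' \<le> G (\<phi> x)) at_top"
        using G_near[OF e'] by (rule eventually_mono) (use b(2) in force)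
    qed (use admD[OF \<phi>(1)] e' in auto)
    ultimately have "eventually (\<lambda>x. p * m + q * G b - e \<le> \<phi> x) at_top"
    proof eventually_elim
      case (elim x)
      have "p * ((m - e') - e') + q * ((G b - e') - e') \<le> A \<phi> x"
        unfolding A_def using elim p_pos q_pos by (intro add_mono mult_left_mono) auto
      moreover have "p * ((m - e') - e') + q * ((G b - e') - e') = p * m + q * G b - (p + q) * (2 * e')" by algebra
      ultimately show ?case unfolding pq e'_def using \<phi>(2) by simp
    qed
    then show "p * m + q * G b \<le> m + e"
      using cSup_upper[OF _ bdd(1), of "p * m + q * G b - e"] by (simp add: S_def m_def)
  qed
  moreover have "M \<le> p * M + q * G a"
  proof (rule field_le_epsilon)
    fix e :: real assume "0 < e"
    define e' where "e' = e / 2"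
    have e': "0 < e'" using \<open>0 < e\<close> by (simp add: e'_def)
    have "eventually (\<lambda>x. conv \<mu>1 \<phi> x \<le> (M + e') + e') at_top"
      by (rule M1.conv_eventually_le[of _ \<zeta>2])
         (use admD[OF \<phi>(1)] e' near[OF e'] in \<open>auto simp: eventually_conj_iff\<close>)
    moreover have "eventually (\<lambda>x. conv \<mu>2 (\<lambda>s. G (\<phi> s)) x \<le> (G a + e') + e') at_top"
    proof (rule M2.conv_eventually_le[of _ \<zeta>2])
      show "eventually (\<lambda>x. G (\<phi> x) \<le> G a + e') at_top"
        using G_near[OF e'] by (rule eventually_mono) (use a(2) in force)
    qed (use admD[OF \<phi>(1)] e' in auto)
    ultimately have "eventually (\<lambda>x. \<phi> x \<le> p * M + q * G a + e) at_top"
    proof eventually_elim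
      case (elim x)
      have "A \<phi> x \<le> p * ((M + e') + e') + q * ((G a + e') + e')"
        unfolding A_def using elim p_pos q_pos by (intro add_mono mult_left_mono) auto
      moreover have "p * ((M + e') + e') + q * ((G a + e') + e') = p * M + q * G a + (p + q) * (2 * e')" by algebra
      ultimately show ?case unfolding pq e'_def using \<phi>(2) by simp
    qed
    then show "M \<le> p * M + q * G a + e"
      using cInf_lower[OF _ bdd(2), of "p * M + q * G a + e"] by (simp add: S'_def M_def)
  qed
  moreover have "p * m = m - q * m" "p * M = M - q * M"
  proof -
    have "p = 1 - q" using pq by simp
    then show "p * m = m - q * m" "p * M = M - q * M" by (metis left_diff_distrib mult_1)+
  qed
  ultimately have "G b \<le> m" "M \<le> G a" using q_pos by auto
  then have "m = \<kappa> \<and> M = \<kappa>"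
    by (intro interval_covering_attractor[OF G_cont mM a(1) _ b(1) _ G_sublin gamma \<kappa>(4,3) below above attract]) auto
  then have lim: "eventually (\<lambda>x. \<kappa> - h \<le> \<phi> x \<and> \<phi> x \<le> \<kappa> + h) at_top" if "0 < h" for h
    using near[OF that] by simp
  show ?thesis
  proof (rule tendstoI)
    fix e :: real assume "0 < e"
    then have "0 < e / 2" by simp
    from lim[OF this] show "eventually (\<lambda>x. dist (\<phi> x) \<kappa> < e) at_top"
      by (rule eventually_mono) (use \<open>0 < e\<close> in \<open>auto simp: dist_real_def abs_less_iff\<close>)
  qed
qed

lemma wave_exists:
  obtains \<phi> where "adm \<phi>" "A \<phi> = \<phi>" "\<And>x. 0 < \<phi> x" "continuous_on UNIV \<phi>" "(\<phi> \<longlongrightarrow> 0) at_bot"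
    "\<exists>z>\<zeta>1. eventually (\<lambda>x. z \<le> \<phi> x) at_top"
    "\<And>\<kappa>. {s. 0 \<le> s \<and> G s = s} = {0, \<kappa>} \<Longrightarrow>
      (\<And>s. 0 < s \<Longrightarrow> s \<le> \<zeta>2 \<Longrightarrow> (\<lambda>n. (G ^^ n) s) \<longlonglongrightarrow> \<kappa>) \<Longrightarrow> (\<phi> \<longlongrightarrow> \<kappa>) at_top"
proof -
  obtain \<phi> x0 where \<phi>: "adm \<phi>" "A \<phi> = \<phi>" "0 < \<phi> x0" "continuous_on UNIV \<phi>" "(\<phi> \<longlongrightarrow> 0) at_bot"
    by (rule fixed_point_vanishing_at_bot)
  have pos: "0 < \<phi> x" for x by (rule fixed_point_pos[OF \<phi>(1,2,4,3)])
  obtain m where "0 < m" "eventually (\<lambda>x. m \<le> \<phi> x) at_top"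
    using fixed_point_persistence[OF \<phi>(1,2,4) pos] by metis
  then have above: "\<exists>z>\<zeta>1. eventually (\<lambda>x. z \<le> \<phi> x) at_top"
    using eventually_above_zeta1[OF \<phi>(1), of m] \<phi>(2) by simp
  show ?thesis
  proof (rule that[OF \<phi>(1,2) pos \<phi>(4,5) above])
    fix \<kappa> assume "{s. 0 \<le> s \<and> G s = s} = {0, \<kappa>}"
      "\<And>s. 0 < s \<Longrightarrow> s \<le> \<zeta>2 \<Longrightarrow> (\<lambda>n. (G ^^ n) s) \<longlonglongrightarrow> \<kappa>"
    then show "(\<phi> \<longlongrightarrow> \<kappa>) at_top"
      by (rule fixed_point_tendsto[OF \<phi>(1,2) \<open>0 < m\<close> \<open>eventually (\<lambda>x. m \<le> \<phi> x) at_top\<close>])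
  qed
qed

end

section \<open>The kernels of the lattice equation\<close>

definition exp_measure :: "real \<Rightarrow> real measure" where
  "exp_measure a = density lborel (\<lambda>t. ennreal (exponential_density a t))"

text \<open>The operator \<open>c \<phi>' + a \<phi> = a h\<close> is inverted by averaging
  \<open>h (x - c * t)\<close> over an exponential time \<open>t\<close> of rate \<open>a\<close>.
  Describing the kernel as a law in \<open>t\<close> treats both signs of \<open>c\<close> at
  once.\<close>

definition delay_kernel :: "real \<Rightarrow> real \<Rightarrow> (int \<Rightarrow> real) \<Rightarrow> real \<Rightarrow> real measure" where
  "delay_kernel a c \<beta> s = distr (exp_measure a \<Otimes>\<^sub>M measure_pmf (embed_pmf \<beta>)) borel
     (\<lambda>(t, k). c * t + real_of_int k + s)"

lemma pmf_embed_has_sum: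
  fixes \<beta> :: "int \<Rightarrow> real"
  assumes "\<And>k. 0 \<le> \<beta> k" "(\<beta> has_sum 1) UNIV"
  shows "pmf (embed_pmf \<beta>) k = \<beta> k"
proof (rule pmf_embed_pmf)
  have summ: "\<beta> summable_on UNIV" using assms(2) by (rule has_sum_imp_summable)
  then have "Infinite_Sum.abs_summable_on \<beta> UNIV" by (rule summable_on_iff_abs_summable_on_real[THEN iffD1])
  then have abs: "Infinite_Set_Sum.abs_summable_on \<beta> UNIV" by (rule abs_summable_equivalent[THEN iffD1])
  have "(\<integral>\<^sup>+x. ennreal (\<beta> x) \<partial>count_space UNIV) = ennreal (infsetsum \<beta> UNIV)"
    by (rule nn_integral_conv_infsetsum[OF abs]) (use assms in auto)
  also have "infsetsum \<beta> UNIV = infsum \<beta> UNIV" by (rule infsetsum_infsum[OF abs])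
  also have "\<dots> = 1" using assms(2) by (rule infsumI)
  finally show "(\<integral>\<^sup>+x. ennreal (\<beta> x) \<partial>count_space UNIV) = 1" by simp
qed (use assms in auto)

locale lattice_kernel =
  fixes a c s :: real and \<beta> :: "int \<Rightarrow> real"
  assumes a_pos: "0 < a" and beta_nonneg: "\<And>k. 0 \<le> \<beta> k" and beta_sum: "(\<beta> has_sum 1) UNIV"
begin

abbreviation "E \<equiv> exp_measure a"
abbreviation "P \<equiv> embed_pmf \<beta>"
abbreviation "Ker \<equiv> delay_kernel a c \<beta> s"

lemma pmf_P: "pmf P k = \<beta> k"
  using beta_nonneg beta_sum by (rule pmf_embed_has_sum)

lemma sets_E [simp, measurable_cong]: "sets E = sets borel" and space_E [simp]: "space E = UNIV"
  by (simp_all add: exp_measure_def)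

sublocale E: prob_space E
  unfolding exp_measure_def using a_pos by (rule prob_space_exponential_density)

sublocale EP: pair_prob_space E "measure_pmf P" ..

lemma shift_measurable [measurable]:
  "(\<lambda>(t, k). c * t + real_of_int k + s) \<in> borel_measurable (E \<Otimes>\<^sub>M measure_pmf P)"
  by measurable

sublocale real_distribution Ker
proof -
  interpret prob_space Ker
    unfolding delay_kernel_def by (rule EP.prob_space_distr) (rule shift_measurable)
  show "real_distribution Ker" by standard (simp add: delay_kernel_def)
qed

definition lattice_avg :: "(real \<Rightarrow> real) \<Rightarrow> real \<Rightarrow> real" where
  "lattice_avg f x = (\<integral>k. f (x - real_of_int k - s) \<partial>measure_pmf P)"

lemma lattice_avg_eq:
  assumes "\<And>x. \<bar>f x\<bar> \<le> B"
  shows "lattice_avg f x = (\<Sum>\<^sub>\<infinity>k. \<beta> k * f (x - real_of_int k - s))"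
proof -
  have "Infinite_Sum.abs_summable_on (\<lambda>k. \<beta> k * f (x - real_of_int k - s)) UNIV"
  proof (rule Infinite_Sum.abs_summable_on_comparison_test)
    show "Infinite_Sum.abs_summable_on (\<lambda>k. \<beta> k * B) UNIV"
      by (rule summable_on_iff_abs_summable_on_real[THEN iffD1, OF summable_on_cmult_left[OF has_sum_imp_summable[OF beta_sum]]])
    show "norm (\<beta> k * f (x - real_of_int k - s)) \<le> norm (\<beta> k * B)" for k
      using assms[of "x - real_of_int k - s"] beta_nonneg[of k] by (auto simp: abs_mult intro!: mult_left_mono)
  qed
  then have "Infinite_Set_Sum.abs_summable_on (\<lambda>k. \<beta> k * f (x - real_of_int k - s)) UNIV"
    by (rule abs_summable_equivalent[THEN iffD1])
  then show ?thesis
    unfolding lattice_avg_def pmf_expectation_eq_infsetsum pmf_P by (rule infsetsum_infsum)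
qed

lemma lattice_avg_measurable [measurable]:
  assumes [measurable]: "f \<in> borel_measurable borel"
  shows "lattice_avg f \<in> borel_measurable borel"
  unfolding lattice_avg_def[abs_def] by measurable

lemma lattice_avg_bounds:
  assumes "\<And>x. \<bar>f x\<bar> \<le> B"
  shows "\<bar>lattice_avg f x\<bar> \<le> B"
proof -
  have "\<bar>lattice_avg f x\<bar> \<le> (\<integral>k. \<bar>f (x - real_of_int k - s)\<bar> \<partial>measure_pmf P)"
    unfolding lattice_avg_def by (rule integral_abs_bound)
  also have "\<dots> \<le> (\<integral>k. B \<partial>measure_pmf P)"
    by (intro integral_mono measure_pmf.integrable_const_bound[of _ B])
       (use assms order_trans[OF abs_ge_zero assms[of 0]] in auto)
  also have "\<dots> = B" by simp
  finally show ?thesis .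
qed

lemma lattice_avg_nonneg: "(\<And>x. 0 \<le> f x) \<Longrightarrow> 0 \<le> lattice_avg f x"
  unfolding lattice_avg_def by (intro integral_nonneg_AE) simp

lemma lattice_avg_continuous:
  assumes f: "continuous_on UNIV f" and B: "\<And>x. \<bar>f x\<bar> \<le> B"
  shows "continuous_on UNIV (lattice_avg f)"
  unfolding continuous_on_sequentially comp_def lattice_avg_def
proof (intro allI ballI impI, elim conjE)
  fix x l assume "x \<longlonglongrightarrow> (l :: real)"
  then show "(\<lambda>n. \<integral>k. f (x n - real_of_int k - s) \<partial>measure_pmf P) \<longlonglongrightarrow> (\<integral>k. f (l - real_of_int k - s) \<partial>measure_pmf P)"
    using B by (intro integral_dominated_convergence[where w = "\<lambda>_. B"] AE_I2
        continuous_on_tendsto_compose[OF f] tendsto_intros) auto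
qed

lemma conv_Ker:
  assumes f[measurable]: "f \<in> borel_measurable borel" and B: "\<And>x. \<bar>f x\<bar> \<le> B"
  shows "conv Ker f x = (\<integral>t. lattice_avg f (x - c * t) \<partial>E)"
proof -
  have "conv Ker f x = (\<integral>z. f (x - (case z of (t, k) \<Rightarrow> c * t + real_of_int k + s)) \<partial>(E \<Otimes>\<^sub>M measure_pmf P))"
    unfolding conv_def delay_kernel_def by (subst integral_distr) auto
  also have "\<dots> = (\<integral>t. (\<integral>k. f (x - (c * t + real_of_int k + s)) \<partial>measure_pmf P) \<partial>E)"
    by (subst EP.integral_fst'[symmetric])
       (use B in \<open>auto intro!: EP.integrable_const_bound[of _ B]\<close>)
  also have "\<dots> = (\<integral>t. lattice_avg f (x - c * t) \<partial>E)"
    by (simp add: lattice_avg_def diff_diff_add add.assoc)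
  finally show ?thesis .
qed

lemma integral_E:
  assumes [measurable]: "g \<in> borel_measurable borel"
  shows "(\<integral>t. g t \<partial>E) = (\<integral>t. exponential_density a t * g t \<partial>lborel)"
  unfolding exp_measure_def using a_pos
  by (subst integral_density) (auto simp: exponential_density_nonneg)

lemma exp_density_integrable:
  assumes [measurable]: "g \<in> borel_measurable borel" and B: "\<And>t. \<bar>g t\<bar> \<le> B"
  shows "integrable lborel (\<lambda>t. exponential_density a t * g t)"
proof -
  have "integrable E g" by (rule E.integrable_const_bound[of _ B]) (use B in auto)
  then show ?thesis unfolding exp_measure_def using a_pos
    by (subst (asm) integrable_density) (auto simp: exponential_density_nonneg)
qed

text \<open>Memorylessness of the exponential law, in a form that covers both signs of \<open>c\<close>.\<close>

lemma conv_Ker_shift: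
  assumes f[measurable]: "f \<in> borel_measurable borel" and B: "\<And>x. \<bar>f x\<bar> \<le> B" and \<tau>: "0 \<le> \<tau>"
  shows "conv Ker f (x + c * \<tau>) = exp (- a * \<tau>) * conv Ker f x
     + (\<integral>r. indicator {0<..\<tau>} r * (a * exp (- a * (\<tau> - r)) * lattice_avg f (x + c * r)) \<partial>lborel)"
    and "integrable lborel (\<lambda>r. indicator {0<..\<tau>} r * (a * exp (- a * (\<tau> - r)) * lattice_avg f (x + c * r)))"
proof -
  let ?h = "\<lambda>r. lattice_avg f (x + c * r)"
  \<comment> \<open>In the variable \<open>r = \<tau> - t\<close>, the part \<open>r \<le> 0\<close>
    is a rescaled copy of the unshifted kernel. The interval is open at 0 because the endpoint
    already belongs to that copy.\<close>
  have split: "exponential_density a (\<tau> - r) * ?h r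
     = exp (- a * \<tau>) * (exponential_density a (- r) * ?h r)
       + indicator {0<..\<tau>} r * (a * exp (- a * (\<tau> - r)) * ?h r)" for r
    using \<tau> by (auto simp: exponential_density_def indicator_def algebra_simps simp flip: exp_add)
  have i1: "integrable lborel (\<lambda>r. exponential_density a (\<tau> - r) * ?h r)"
  proof -
    have "integrable lborel (\<lambda>t. exponential_density a t * ?h (\<tau> - t))"
      by (rule exp_density_integrable[of _ B]) (use B lattice_avg_bounds in auto)
    from lborel_integrable_real_affine[OF this, of "-1" \<tau>] show ?thesis by simp
  qed
  have i2: "integrable lborel (\<lambda>r. exponential_density a (- r) * ?h r)"
  proof -
    have "integrable lborel (\<lambda>t. exponential_density a t * ?h (- t))"
      by (rule exp_density_integrable[of _ B]) (use B lattice_avg_bounds in auto)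
    from lborel_integrable_real_affine[OF this, of "-1" 0] show ?thesis by simp
  qed
  have i3: "(\<lambda>r. indicator {0<..\<tau>} r * (a * exp (- a * (\<tau> - r)) * ?h r))
      = (\<lambda>r. exponential_density a (\<tau> - r) * ?h r - exp (- a * \<tau>) * (exponential_density a (- r) * ?h r))"
    unfolding split by simp
  show int: "integrable lborel (\<lambda>r. indicator {0<..\<tau>} r * (a * exp (- a * (\<tau> - r)) * ?h r))"
    unfolding i3 by (intro Bochner_Integration.integrable_diff integrable_mult_right i1 i2)
  have "conv Ker f (x + c * \<tau>) = (\<integral>t. exponential_density a t * ?h (\<tau> - t) \<partial>lborel)"
    unfolding conv_Ker[OF f B] by (subst integral_E) (auto simp: algebra_simps)
  also have "\<dots> = (\<integral>r. exponential_density a (\<tau> - r) * ?h r \<partial>lborel)"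
    by (subst lborel_integral_real_affine[where c = "-1" and t = \<tau>]) auto
  also have "\<dots> = exp (- a * \<tau>) * (\<integral>r. exponential_density a (- r) * ?h r \<partial>lborel)
       + (\<integral>r. indicator {0<..\<tau>} r * (a * exp (- a * (\<tau> - r)) * ?h r) \<partial>lborel)"
    unfolding split by (subst Bochner_Integration.integral_add) (use i2 int in auto)
  also have "(\<integral>r. exponential_density a (- r) * ?h r \<partial>lborel) = (\<integral>t. exponential_density a t * ?h (- t) \<partial>lborel)"
    by (subst lborel_integral_real_affine[where c = "-1" and t = 0]) auto
  also have "\<dots> = conv Ker f x"
    unfolding conv_Ker[OF f B] by (subst integral_E) auto
  finally show "conv Ker f (x + c * \<tau>) = exp (- a * \<tau>) * conv Ker f x
     + (\<integral>r. indicator {0<..\<tau>} r * (a * exp (- a * (\<tau> - r)) * ?h r) \<partial>lborel)" .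
qed

text \<open>By \<open>conv_Ker_shift\<close> the increment over \<open>\<tau>\<close> is a
  difference of two terms in \<open>[0, B * (1 - exp (- a * \<tau>))]\<close>, hence at most
  \<open>a * B * \<tau>\<close>. A displacement in space corresponds to \<open>c * \<tau>\<close>,
  whence the factor \<open>1 / \<bar>c\<bar>\<close>.\<close>

lemma conv_Ker_lipschitz:
  assumes c: "c \<noteq> 0" and f: "f \<in> borel_measurable borel" and f0: "\<And>x. 0 \<le> f x" and fB: "\<And>x. f x \<le> B"
  shows "\<bar>conv Ker f x - conv Ker f x'\<bar> \<le> a / \<bar>c\<bar> * B * \<bar>x - x'\<bar>"
proof -
  have B: "\<bar>f x\<bar> \<le> B" for x using f0 fB by (simp add: abs_of_nonneg)
  have B0: "0 \<le> B" using f0 fB order_trans by blast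
  have main: "\<bar>conv Ker f (x + c * \<tau>) - conv Ker f x\<bar> \<le> a * B * \<tau>" if \<tau>: "0 \<le> \<tau>" for x \<tau>
  proof -
    define I where "I = (\<integral>r. indicator {0<..\<tau>} r * (a * exp (- a * (\<tau> - r)) * lattice_avg f (x + c * r)) \<partial>lborel)"
    have eq: "conv Ker f (x + c * \<tau>) = exp (- a * \<tau>) * conv Ker f x + I"
      unfolding I_def by (rule conv_Ker_shift(1)[OF f B \<tau>])
    have one: "lattice_avg (\<lambda>_. 1) y = 1" for y by (simp add: lattice_avg_def)
    \<comment> \<open>The shift formula for the constant 1 evaluates the mass of the integral term
      without computing an integral.\<close>
    have sh: "1 = exp (- a * \<tau>) + (\<integral>r. indicator {0<..\<tau>} r * (a * exp (- a * (\<tau> - r))) \<partial>lborel)"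
      "integrable lborel (\<lambda>r. indicator {0<..\<tau>} r * (a * exp (- a * (\<tau> - r))))"
      using conv_Ker_shift[of "\<lambda>_. 1" 1 \<tau> 0] \<tau> by (simp_all add: one)
    have "0 \<le> I" unfolding I_def using a_pos lattice_avg_nonneg[OF f0] by (intro integral_nonneg_AE) auto
    have "I \<le> (\<integral>r. B * (indicator {0<..\<tau>} r * (a * exp (- a * (\<tau> - r)))) \<partial>lborel)"
      unfolding I_def
    proof (rule integral_mono[OF conv_Ker_shift(2)[OF f B \<tau>]])
      show "integrable lborel (\<lambda>r. B * (indicator {0<..\<tau>} r * (a * exp (- a * (\<tau> - r)))))"
        by (intro integrable_mult_right sh)
      show "indicator {0<..\<tau>} r * (a * exp (- a * (\<tau> - r)) * lattice_avg f (x + c * r))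
          \<le> B * (indicator {0<..\<tau>} r * (a * exp (- a * (\<tau> - r))))" for r
        using lattice_avg_bounds[of f B "x + c * r", OF B] a_pos
        by (auto simp: indicator_def mult.commute[of B] intro!: mult_left_mono)
    qed
    also have "\<dots> = B * (1 - exp (- a * \<tau>))" using sh(1) by simp
    finally have "I \<le> B * (1 - exp (- a * \<tau>))" .
    moreover have e: "1 - exp (- a * \<tau>) \<le> a * \<tau>" "0 \<le> 1 - exp (- a * \<tau>)"
      using exp_ge_add_one_self[of "- a * \<tau>"] a_pos \<tau> by auto
    then have "B * (1 - exp (- a * \<tau>)) \<le> B * (a * \<tau>)" using B0 by (intro mult_left_mono)
    moreover have F: "0 \<le> conv Ker f x" "conv Ker f x \<le> B"
      using conv_nonneg[of f x, OF f0] conv_le_const[of f B x, OF f f0 fB] by auto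
    have "(1 - exp (- a * \<tau>)) * conv Ker f x \<le> (1 - exp (- a * \<tau>)) * B" "0 \<le> (1 - exp (- a * \<tau>)) * conv Ker f x"
      using F e by (auto intro: mult_left_mono)
    moreover have "conv Ker f (x + c * \<tau>) - conv Ker f x = I - (1 - exp (- a * \<tau>)) * conv Ker f x"
      using eq by (simp add: algebra_simps)
    ultimately show ?thesis using \<open>0 \<le> I\<close> by (simp add: mult_ac abs_le_iff)
  qed
  define \<tau> where "\<tau> = (x' - x) / c"
  have \<tau>: "x' = x + c * \<tau>" "x = x' + c * (- \<tau>)" "\<bar>\<tau>\<bar> = \<bar>x - x'\<bar> / \<bar>c\<bar>"
    using c by (auto simp: \<tau>_def abs_divide abs_minus_commute)
  have "\<bar>conv Ker f x - conv Ker f x'\<bar> \<le> a * B * \<bar>\<tau>\<bar>"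
  proof (cases "0 \<le> \<tau>")
    case True
    then show ?thesis using main[of \<tau> x] \<tau>(1) by (simp add: abs_minus_commute)
  next
    case False
    then show ?thesis using main[of "- \<tau>" x'] \<tau>(2) by simp
  qed
  then show ?thesis unfolding \<tau>(3) by (simp add: mult_ac)
qed

text \<open>In the variable \<open>\<tau>\<close> the shift formula is variation of constants, and
  the fundamental theorem of calculus differentiates it, since \<open>lattice_avg f\<close> is
  continuous.\<close>

lemma conv_Ker_derivative:
  assumes c: "c \<noteq> 0" and f: "continuous_on UNIV f" and B: "\<And>x. \<bar>f x\<bar> \<le> B"
  shows "(conv Ker f has_real_derivative (a / c * (lattice_avg f x - conv Ker f x))) (at x)"
proof -
  have fm: "f \<in> borel_measurable borel" using f by (rule borel_measurable_continuous_onI)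
  \<comment> \<open>The formula holds for \<open>0 \<le> \<tau>\<close> only. Starting one time unit
    earlier puts \<open>x\<close> at the interior value \<open>\<tau> = 1\<close>, so the derivative
    is two-sided.\<close>
  define x0 where "x0 = x - c"
  define k where "k r = a * exp (a * r) * lattice_avg f (x0 + c * r)" for r
  have k_cont: "continuous_on S k" for S
    unfolding k_def
    by (intro continuous_intros continuous_on_compose2[OF lattice_avg_continuous[OF f B]]) auto
  have [measurable]: "k \<in> borel_measurable borel"
    using k_cont by (rule borel_measurable_continuous_onI)
  define \<Psi> where "\<Psi> \<tau> = exp (- a * \<tau>) * (conv Ker f x0 + integral {0..\<tau>} k)" for \<tau>
  have \<Psi>: "conv Ker f (x0 + c * \<tau>) = \<Psi> \<tau>" if \<tau>: "0 \<le> \<tau>" for \<tau>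
  proof -
    have "(\<integral>r. indicator {0<..\<tau>} r * (a * exp (- a * (\<tau> - r)) * lattice_avg f (x0 + c * r)) \<partial>lborel)
        = (\<integral>r. exp (- a * \<tau>) * (indicator {0<..\<tau>} r * k r) \<partial>lborel)"
      by (intro Bochner_Integration.integral_cong) (auto simp: k_def indicator_def algebra_simps simp flip: exp_add)
    also have "\<dots> = exp (- a * \<tau>) * (LINT r:{0<..\<tau>}|lborel. k r)"
      by (simp add: set_lebesgue_integral_def)
    also have "(LINT r:{0<..\<tau>}|lborel. k r) = (LINT r:{0..\<tau>}|lborel. k r)"
      unfolding set_lebesgue_integral_def
      by (intro integral_cong_AE) (use AE_lborel_singleton[of 0] in
          \<open>auto elim!: eventually_mono simp: indicator_def\<close>)
    also have "\<dots> = integral {0..\<tau>} k"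
      by (intro set_borel_integral_eq_integral(2) borel_integrable_atLeastAtMost') (rule k_cont)
    finally show ?thesis
      unfolding conv_Ker_shift(1)[OF fm B \<tau>] \<Psi>_def by (simp add: algebra_simps)
  qed
  have "((\<lambda>\<tau>. integral {0..\<tau>} k) has_vector_derivative k 1) (at 1 within {0..2})"
    by (rule integral_has_vector_derivative) (use k_cont in auto)
  then have "((\<lambda>\<tau>. integral {0..\<tau>} k) has_real_derivative k 1) (at 1)"
    by (simp add: has_real_derivative_iff_has_vector_derivative at_within_interior[of 1 "{0..2}"])
  then have "(\<Psi> has_real_derivative (- a * exp (- a * 1) * (conv Ker f x0 + integral {0..1} k) + exp (- a * 1) * k 1)) (at 1)"
    unfolding \<Psi>_def by (auto intro!: derivative_eq_intros)
  moreover have "- a * exp (- a * 1) * (conv Ker f x0 + integral {0..1} k) + exp (- a * 1) * k 1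
      = a * (lattice_avg f x - conv Ker f x)"
    using \<Psi>[of 1] by (simp add: \<Psi>_def k_def x0_def algebra_simps flip: exp_add)
  ultimately have d: "(\<Psi> has_real_derivative a * (lattice_avg f x - conv Ker f x)) (at 1)" by simp
  have "((\<lambda>y. \<Psi> ((y - x0) / c)) has_real_derivative a * (lattice_avg f x - conv Ker f x) * (1 / c)) (at x)"
  proof (rule DERIV_chain2[where g = "\<lambda>y. (y - x0) / c" and f = \<Psi>])
    show "(\<Psi> has_real_derivative a * (lattice_avg f x - conv Ker f x)) (at ((x - x0) / c))"
      using d c by (simp add: x0_def)
    show "((\<lambda>y. (y - x0) / c) has_real_derivative 1 / c) (at x)"
      using c by (auto intro!: derivative_eq_intros)
  qed
  then have "(conv Ker f has_real_derivative a * (lattice_avg f x - conv Ker f x) * (1 / c)) (at x)"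
  proof (rule has_field_derivative_transform_within)
    show "0 < \<bar>c\<bar>" using c by simp
    fix y assume "dist y x < \<bar>c\<bar>"
    then have "\<bar>(y - x) / c\<bar> < 1" using c by (simp add: dist_real_def abs_divide)
    moreover have "(y - x0) / c = 1 + (y - x) / c" using c by (simp add: x0_def field_simps)
    ultimately have "0 \<le> (y - x0) / c" by linarith
    from \<Psi>[OF this] show "\<Psi> ((y - x0) / c) = conv Ker f y" using c by simp
  qed auto
  then show ?thesis by simp
qed

lemma laplace_Ker:
  assumes z: "0 < a + c * z" and summ: "(\<lambda>k. \<beta> k * exp (- z * real_of_int k)) summable_on UNIV"
  shows "(\<integral>\<^sup>+y. ennreal (exp (- z * y)) \<partial>Ker)
    = ennreal (a / (a + c * z) * exp (- z * s) * (\<Sum>\<^sub>\<infinity>k. \<beta> k * exp (- z * real_of_int k)))"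
proof -
  have E: "(\<integral>\<^sup>+t. ennreal (exp (- z * (c * t))) \<partial>E) = ennreal (a / (a + c * z))"
  proof -
    have "(\<integral>\<^sup>+t. ennreal (exp (- z * (c * t))) \<partial>E)
        = (\<integral>\<^sup>+t. ennreal a * (ennreal (exp (- (a + c * z) * t)) * indicator {0..} t) \<partial>lborel)"
      unfolding exp_measure_def using a_pos
      by (subst nn_integral_density)
         (auto intro!: nn_integral_cong simp: exponential_density_def indicator_def algebra_simps
           simp flip: ennreal_mult exp_add)
    also have "\<dots> = ennreal a * ennreal (1 / (a + c * z))"
      by (subst nn_integral_cmult) (simp_all only: nn_integral_exp_neg_halfline[OF z], simp)
    also have "\<dots> = ennreal (a / (a + c * z))" using a_pos z by (simp flip: ennreal_mult)
    finally show ?thesis .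
  qed
  have K: "(\<integral>\<^sup>+k. ennreal (exp (- z * real_of_int k)) \<partial>measure_pmf P) = ennreal (\<Sum>\<^sub>\<infinity>k. \<beta> k * exp (- z * real_of_int k))"
  proof -
    have nn: "0 \<le> \<beta> k * exp (- z * real_of_int k)" for k using beta_nonneg by simp
    have "Infinite_Sum.abs_summable_on (\<lambda>k. \<beta> k * exp (- z * real_of_int k)) UNIV"
      using summ by (rule summable_on_iff_abs_summable_on_real[THEN iffD1])
    then have abs: "Infinite_Set_Sum.abs_summable_on (\<lambda>k. \<beta> k * exp (- z * real_of_int k)) UNIV"
      by (rule abs_summable_equivalent[THEN iffD1])
    have "(\<integral>\<^sup>+k. ennreal (exp (- z * real_of_int k)) \<partial>measure_pmf P)
        = (\<integral>\<^sup>+k. ennreal (\<beta> k * exp (- z * real_of_int k)) \<partial>count_space UNIV)"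
      by (subst nn_integral_measure_pmf) (simp add: pmf_P ennreal_mult' beta_nonneg)
    also have "\<dots> = ennreal (infsetsum (\<lambda>k. \<beta> k * exp (- z * real_of_int k)) UNIV)"
      by (rule nn_integral_conv_infsetsum[OF abs nn])
    finally show ?thesis unfolding infsetsum_infsum[OF abs] .
  qed
  have S0: "0 \<le> (\<Sum>\<^sub>\<infinity>k. \<beta> k * exp (- z * real_of_int k))" by (intro infsum_nonneg) (simp add: beta_nonneg)
  have "(\<integral>\<^sup>+y. ennreal (exp (- z * y)) \<partial>Ker)
      = (\<integral>\<^sup>+x. ennreal (exp (- z * (case x of (t, k) \<Rightarrow> c * t + real_of_int k + s))) \<partial>(E \<Otimes>\<^sub>M measure_pmf P))"
    unfolding delay_kernel_def by (subst nn_integral_distr) auto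
  also have "\<dots> = (\<integral>\<^sup>+t. (\<integral>\<^sup>+k. ennreal (exp (- z * (c * t + real_of_int k + s))) \<partial>measure_pmf P) \<partial>E)"
    by (subst measure_pmf.nn_integral_fst[symmetric]) auto
  also have "\<dots> = (\<integral>\<^sup>+t. ennreal (exp (- z * (c * t))) * (ennreal (exp (- z * s)) * (\<integral>\<^sup>+k. ennreal (exp (- z * real_of_int k)) \<partial>measure_pmf P)) \<partial>E)"
  proof (intro nn_integral_cong)
    fix t
    have "ennreal (exp (- z * (c * t + real_of_int k + s)))
        = ennreal (exp (- z * (c * t))) * (ennreal (exp (- z * s)) * ennreal (exp (- z * real_of_int k)))" for k
      by (simp add: algebra_simps flip: ennreal_mult exp_add)
    then show "(\<integral>\<^sup>+k. ennreal (exp (- z * (c * t + real_of_int k + s))) \<partial>measure_pmf P)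
       = ennreal (exp (- z * (c * t))) * (ennreal (exp (- z * s)) * (\<integral>\<^sup>+k. ennreal (exp (- z * real_of_int k)) \<partial>measure_pmf P))"
      by (simp add: nn_integral_cmult)
  qed
  also have "\<dots> = (\<integral>\<^sup>+t. ennreal (exp (- z * (c * t))) \<partial>E) * (ennreal (exp (- z * s)) * (\<integral>\<^sup>+k. ennreal (exp (- z * real_of_int k)) \<partial>measure_pmf P))"
    by (rule nn_integral_multc) measurable
  also have "\<dots> = ennreal (a / (a + c * z) * exp (- z * s) * (\<Sum>\<^sub>\<infinity>k. \<beta> k * exp (- z * real_of_int k)))"
    unfolding E K using a_pos z S0 by (simp add: mult.assoc flip: ennreal_mult)
  finally show ?thesis .
qed

text \<open>\<open>w * \<bar>y\<bar> \<le> exp (w * \<bar>y\<bar>)\<close>, and this is at most the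
  sum of the two exponentials whose transforms are finite by \<open>laplace_Ker\<close>.\<close>

lemma first_moment_Ker:
  assumes w: "0 < w" "0 < a + c * w" "0 < a - c * w"
    and summ: "(\<lambda>k. \<beta> k * exp (- w * real_of_int k)) summable_on UNIV"
      "(\<lambda>k. \<beta> k * exp (w * real_of_int k)) summable_on UNIV"
  shows "(\<integral>\<^sup>+y. ennreal \<bar>y\<bar> \<partial>Ker) < \<infinity>"
proof -
  have "\<bar>y\<bar> \<le> 1 / w * (exp (- w * y) + exp (- (- w) * y))" for y
  proof -
    have "w * \<bar>y\<bar> \<le> exp (w * \<bar>y\<bar>)" using exp_ge_add_one_self[of "w * \<bar>y\<bar>"] by linarith
    also have "\<dots> \<le> exp (- w * y) + exp (- (- w) * y)" by (cases "0 \<le> y") auto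
    finally show ?thesis using w by (simp add: field_simps)
  qed
  then have "(\<integral>\<^sup>+y. ennreal \<bar>y\<bar> \<partial>Ker) \<le> (\<integral>\<^sup>+y. ennreal (1 / w) * (ennreal (exp (- w * y)) + ennreal (exp (- (- w) * y))) \<partial>Ker)"
    using w by (intro nn_integral_mono) (simp del: ennreal_plus flip: ennreal_mult ennreal_plus add: ennreal_leI)
  also have "\<dots> = ennreal (1 / w) * ((\<integral>\<^sup>+y. ennreal (exp (- w * y)) \<partial>Ker) + (\<integral>\<^sup>+y. ennreal (exp (- (- w) * y)) \<partial>Ker))"
    by (subst nn_integral_cmult, simp, subst nn_integral_add) auto
  also have "\<dots> < \<infinity>"
    using laplace_Ker[of w] laplace_Ker[of "- w"] w summ by (simp add: ennreal_mult_less_top)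
  finally show ?thesis .
qed

text \<open>The rectangle \<open>{t1<..<t2} \<times> {k0}\<close> maps into the interval and has
  positive product measure, as the exponential density is at least \<open>a * exp (- a * t2)\<close>
  on it.\<close>

lemma Ker_charges:
  assumes k0: "0 < \<beta> k0" and I: "0 \<le> t1" "t1 < t2" and sub: "\<And>t. t1 < t \<Longrightarrow> t < t2 \<Longrightarrow> c * t + real_of_int k0 + s \<in> {u<..<v}"
  shows "0 < measure Ker {u<..<v}"
proof -
  have "0 < ennreal (a * exp (- a * t2) * (t2 - t1)) * ennreal (\<beta> k0)"
    using a_pos I k0 by (simp add: ennreal_zero_less_mult_iff)
  also have "\<dots> \<le> emeasure E {t1<..<t2} * emeasure (measure_pmf P) {k0}"
  proof (intro mult_mono)
    have "ennreal (a * exp (- a * t2) * (t2 - t1)) = (\<integral>\<^sup>+t. ennreal (a * exp (- a * t2)) * indicator {t1<..<t2} t \<partial>lborel)"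
      using a_pos I by (simp add: nn_integral_cmult ennreal_mult)
    also have "\<dots> \<le> (\<integral>\<^sup>+t. ennreal (exponential_density a t) * indicator {t1<..<t2} t \<partial>lborel)"
      using a_pos I by (intro nn_integral_mono)
        (auto simp: indicator_def exponential_density_def intro!: ennreal_leI mult_left_mono)
    also have "\<dots> = emeasure E {t1<..<t2}"
      unfolding exp_measure_def by (subst emeasure_density) auto
    finally show "ennreal (a * exp (- a * t2) * (t2 - t1)) \<le> emeasure E {t1<..<t2}" .
    show "ennreal (\<beta> k0) \<le> emeasure (measure_pmf P) {k0}" by (simp add: emeasure_pmf_single pmf_P)
  qed auto
  also have "\<dots> = emeasure (E \<Otimes>\<^sub>M measure_pmf P) ({t1<..<t2} \<times> {k0})"
    by (rule measure_pmf.emeasure_pair_measure_Times[symmetric]) auto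
  also have "\<dots> \<le> emeasure (E \<Otimes>\<^sub>M measure_pmf P) ((\<lambda>(t, k). c * t + real_of_int k + s) -` {u<..<v} \<inter> space (E \<Otimes>\<^sub>M measure_pmf P))"
    by (intro emeasure_mono measurable_sets[OF shift_measurable]) (use sub in \<open>auto simp: space_pair_measure\<close>)
  also have "\<dots> = emeasure Ker {u<..<v}"
    unfolding delay_kernel_def by (subst emeasure_distr) auto
  finally show ?thesis by (simp add: emeasure_eq_measure)
qed

end

section \<open>The characteristic function and the critical speeds\<close>

definition laplace_sum :: "(int \<Rightarrow> real) \<Rightarrow> real \<Rightarrow> real" where
  "laplace_sum \<beta> z = (\<Sum>\<^sub>\<infinity>k. \<beta> k * exp (- z * real_of_int k))"

abbreviation laplace_summable :: "(int \<Rightarrow> real) \<Rightarrow> real \<Rightarrow> bool" where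
  "laplace_summable \<beta> z \<equiv> (\<lambda>k. \<beta> k * exp (- z * real_of_int k)) summable_on UNIV"

lemma chi_laplace_sum:
  "chi D d r \<beta> gp z c = d + 2 * D + c * z - D * (exp z + exp (- z)) - gp * exp (- c * r * z) * laplace_sum \<beta> z"
  by (simp add: chi_def laplace_sum_def mult.commute)

lemma laplace_sum_nonneg: "(\<And>k. 0 \<le> \<beta> k) \<Longrightarrow> 0 \<le> laplace_sum \<beta> z"
  unfolding laplace_sum_def by (intro infsum_nonneg) simp

text \<open>Each term is monotone in \<open>z\<close>, in a direction set by the sign of
  \<open>k\<close>, so one of the two endpoints dominates it.\<close>

lemma laplace_summable_between:
  assumes nn: "\<And>k. 0 \<le> \<beta> k" and summ: "laplace_summable \<beta> z1" "laplace_summable \<beta> z2" and z: "z1 \<le> z" "z \<le> z2"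
  shows "laplace_summable \<beta> z"
proof (rule summable_on_comparison_test)
  show "(\<lambda>k. \<beta> k * exp (- z1 * real_of_int k) + \<beta> k * exp (- z2 * real_of_int k)) summable_on UNIV"
    using summ by (rule summable_on_add)
  show "\<beta> k * exp (- z * real_of_int k) \<le> \<beta> k * exp (- z1 * real_of_int k) + \<beta> k * exp (- z2 * real_of_int k)" for k
  proof -
    have "exp (- z * real_of_int k) \<le> exp (- z1 * real_of_int k) + exp (- z2 * real_of_int k)"
    proof (cases "0 \<le> k")
      case True
      then have "exp (- z * real_of_int k) \<le> exp (- z1 * real_of_int k)" using z by (simp add: mult_right_mono)
      then show ?thesis by (simp add: add_increasing2)
    next
      case False
      then have "exp (- z * real_of_int k) \<le> exp (- z2 * real_of_int k)" using z by (simp add: mult_right_mono_neg)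
      then show ?thesis by (simp add: add_increasing)
    qed
    then show ?thesis using nn[of k] by (metis distrib_left mult_left_mono)
  qed
qed (use nn in auto)

lemma laplace_summable_between_gammas:
  assumes nn: "\<And>k. 0 \<le> \<beta> k" and z: "gamma_minus \<beta> < ereal z" "ereal z < gamma_plus \<beta>"
  shows "laplace_summable \<beta> z"
proof -
  obtain z2 where z2: "laplace_summable \<beta> z2" "z < z2"
    using z(2) unfolding gamma_plus_def less_Sup_iff by auto
  obtain z1 where z1: "laplace_summable \<beta> z1" "z1 < z"
    using z(1) unfolding gamma_minus_def Inf_less_iff by auto
  show ?thesis by (rule laplace_summable_between[OF nn z1(1) z2(1)]) (use z1 z2 in auto)
qed

section \<open>Reflection of the lattice\<close>

lemma laplace_summable_reflect: "laplace_summable (\<lambda>k. \<beta> (- k)) z \<longleftrightarrow> laplace_summable \<beta> (- z)"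
proof -
  have bij: "bij_betw uminus (UNIV :: int set) UNIV" by (rule bij_uminus)
  show ?thesis
    using summable_on_reindex_bij_betw[OF bij, of "\<lambda>k. \<beta> k * exp (- (- z) * real_of_int k)"] by simp
qed

lemma laplace_sum_reflect: "laplace_sum (\<lambda>k. \<beta> (- k)) z = laplace_sum \<beta> (- z)"
proof -
  have bij: "bij_betw uminus (UNIV :: int set) UNIV" by (rule bij_uminus)
  show ?thesis
    using infsum_reindex_bij_betw[OF bij, of "\<lambda>k. \<beta> k * exp (- (- z) * real_of_int k)"] by (simp add: laplace_sum_def)
qed

lemma chi_reflect: "chi D d r (\<lambda>k. \<beta> (- k)) gp z c = chi D d r \<beta> gp (- z) (- c)"
  by (simp add: chi_laplace_sum laplace_sum_reflect)

lemma gamma_plus_reflect: "gamma_plus (\<lambda>k. \<beta> (- k)) = - gamma_minus \<beta>"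
proof -
  have "{ereal z | z. laplace_summable (\<lambda>k. \<beta> (- k)) z} = uminus ` {ereal z | z. laplace_summable \<beta> z}"
  proof (intro equalityI subsetI)
    fix x assume "x \<in> {ereal z | z. laplace_summable (\<lambda>k. \<beta> (- k)) z}"
    then obtain z where z: "x = ereal z" "laplace_summable (\<lambda>k. \<beta> (- k)) z" by blast
    then have "x = - ereal (- z)" "laplace_summable \<beta> (- z)"
      unfolding laplace_summable_reflect by simp_all
    then show "x \<in> uminus ` {ereal z | z. laplace_summable \<beta> z}" by blast
  next
    fix x assume "x \<in> uminus ` {ereal z | z. laplace_summable \<beta> z}"
    then obtain z where z: "x = ereal (- z)" "laplace_summable \<beta> z" by auto
    then have "laplace_summable (\<lambda>k. \<beta> (- k)) (- z)"
      unfolding laplace_summable_reflect by simp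
    then show "x \<in> {ereal z | z. laplace_summable (\<lambda>k. \<beta> (- k)) z}" using z(1) by blast
  qed
  then show ?thesis unfolding gamma_plus_def gamma_minus_def by (simp only: ereal_Sup_uminus_image_eq)
qed

lemma gamma_minus_reflect: "gamma_minus (\<lambda>k. \<beta> (- k)) = - gamma_plus \<beta>"
  using gamma_plus_reflect[of "\<lambda>k. \<beta> (- k)"] by (simp add: ereal_uminus_eq_reorder)

lemma admissible_z_reflect: "admissible_z D d (\<lambda>k. \<beta> (- k)) z c \<longleftrightarrow> admissible_z D d \<beta> (- z) (- c)"
proof -
  have "- gamma_plus \<beta> < ereal z \<longleftrightarrow> ereal (- z) < gamma_plus \<beta>"
    using ereal_uminus_less_reorder[of "gamma_plus \<beta>" "ereal z"] by simp
  moreover have "ereal z < - gamma_minus \<beta> \<longleftrightarrow> gamma_minus \<beta> < ereal (- z)"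
    using ereal_less_uminus_reorder[of "ereal z" "gamma_minus \<beta>"] by simp
  ultimately show ?thesis
    unfolding admissible_z_def gamma_plus_reflect gamma_minus_reflect by auto
qed

lemma cstar_plus_reflect: "cstar_plus D d r (\<lambda>k. \<beta> (- k)) gp = - cstar_minus D d r \<beta> gp"
proof -
  have "uminus ` {c. \<exists>z>0. admissible_z D d (\<lambda>k. \<beta> (- k)) z c \<and> chi D d r (\<lambda>k. \<beta> (- k)) gp z c = 0}
      = {c. \<exists>z<0. admissible_z D d \<beta> z c \<and> chi D d r \<beta> gp z c = 0}" (is "uminus ` ?S = ?S'")
  proof (intro equalityI subsetI)
    fix c assume "c \<in> uminus ` ?S"
    then obtain z where "0 < z" "admissible_z D d \<beta> (- z) c \<and> chi D d r \<beta> gp (- z) c = 0"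
      by (auto simp: admissible_z_reflect[of D d \<beta>] chi_reflect[of D d r \<beta>])
    then show "c \<in> ?S'" by (auto intro!: exI[of _ "- z"])
  next
    fix c assume "c \<in> ?S'"
    then obtain z where z: "z < 0" "admissible_z D d \<beta> z c" "chi D d r \<beta> gp z c = 0" by blast
    then have "0 < - z \<and> admissible_z D d (\<lambda>k. \<beta> (- k)) (- z) (- c) \<and> chi D d r (\<lambda>k. \<beta> (- k)) gp (- z) (- c) = 0"
      unfolding admissible_z_reflect chi_reflect by simp
    then have "- c \<in> ?S" by blast
    then show "c \<in> uminus ` ?S" by force
  qed
  then show ?thesis unfolding cstar_plus_def cstar_minus_def Inf_real_def by simp
qed

section \<open>Roots and sign of the characteristic function\<close>

lemma chi_mono:
  assumes "\<And>k. 0 \<le> \<beta> k" "0 \<le> r" "0 \<le> gp" "0 < z" "c \<le> c'"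
  shows "chi D d r \<beta> gp z c \<le> chi D d r \<beta> gp z c'"
proof -
  have "c * (r * z) \<le> c' * (r * z)" using assms by (intro mult_right_mono) auto
  then have "exp (- c' * r * z) \<le> exp (- c * r * z)" by (simp add: mult.assoc)
  then have "gp * exp (- c' * r * z) * laplace_sum \<beta> z \<le> gp * exp (- c * r * z) * laplace_sum \<beta> z"
    using assms laplace_sum_nonneg[OF assms(1)] by (intro mult_right_mono mult_left_mono) auto
  moreover have "c * z \<le> c' * z" using assms by (intro mult_right_mono) auto
  ultimately show ?thesis unfolding chi_laplace_sum by linarith
qed

text \<open>Makes the infimum in \<open>cstar_plus\<close> range over a nonempty set. With
  \<open>z\<close> fixed, \<open>chi\<close> changes sign as the speed varies; at a root
  \<open>d + 2 * D + c * z\<close> equals a positive quantity, so the positivity in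
  \<open>admissible_z\<close> is automatic.\<close>

lemma ex_chi_root:
  assumes nn: "\<And>k. 0 \<le> \<beta> k" and pos: "0 < D" "0 < d" "0 \<le> r" "0 \<le> gp"
    and gamma: "0 < gamma_plus \<beta>" "gamma_minus \<beta> < 0"
  obtains c z where "0 < z" "admissible_z D d \<beta> z c" "chi D d r \<beta> gp z c = 0"
proof -
  obtain z where z: "0 < z" "ereal z < gamma_plus \<beta>" using ereal_dense2[OF gamma(1)] by auto
  define M where "M = D * (exp z + exp (- z)) + gp * laplace_sum \<beta> z"
  have Dpos: "0 < D * (exp z + exp (- z))" using pos by (simp add: add_pos_pos)
  have L: "0 \<le> gp * laplace_sum \<beta> z" using pos laplace_sum_nonneg[OF nn] by simp
  have M: "0 < M" using Dpos L by (simp add: M_def)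
  \<comment> \<open>At \<open>c0\<close> the affine part of \<open>chi\<close> vanishes, leaving
    only negative terms; at \<open>c1\<close> the product \<open>c1 * z\<close> outweighs them,
    because the delay factor is at most 1.\<close>
  define c0 where "c0 = - (d + 2 * D) / z"
  define c1 where "c1 = M / z"
  have "\<exists>c\<ge>c0. c \<le> c1 \<and> chi D d r \<beta> gp z c = 0"
  proof (rule IVT')
    have "0 \<le> gp * exp (- c0 * r * z) * laplace_sum \<beta> z" using pos laplace_sum_nonneg[OF nn] by simp
    then show "chi D d r \<beta> gp z c0 \<le> 0"
      using Dpos z unfolding chi_laplace_sum by (simp add: c0_def)
    have "0 \<le> c1 * r * z" using M z pos by (simp add: c1_def)
    then have "exp (- c1 * r * z) * (gp * laplace_sum \<beta> z) \<le> 1 * (gp * laplace_sum \<beta> z)"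
      using L by (intro mult_right_mono) auto
    then show "0 \<le> chi D d r \<beta> gp z c1"
      using z pos unfolding chi_laplace_sum by (simp add: c1_def M_def mult_ac)
    have "c0 \<le> 0" unfolding c0_def using pos z by (intro divide_nonpos_pos) auto
    moreover have "0 \<le> c1" using z M by (simp add: c1_def)
    ultimately show "c0 \<le> c1" by linarith
    show "continuous_on {c0..c1} (chi D d r \<beta> gp z)"
      unfolding chi_laplace_sum[abs_def] by (intro continuous_intros)
  qed
  then obtain c where c: "chi D d r \<beta> gp z c = 0" by blast
  have "0 \<le> gp * exp (- c * r * z) * laplace_sum \<beta> z" using pos laplace_sum_nonneg[OF nn] by simp
  then have "0 < d + 2 * D + c * z" using c Dpos unfolding chi_laplace_sum by linarith
  moreover have "gamma_minus \<beta> < ereal z" using gamma(2) z by (metis ereal_less(2) less_trans zero_ereal_def)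
  ultimately have "admissible_z D d \<beta> z c" using z by (simp add: admissible_z_def)
  then show ?thesis using that z c by blast
qed

text \<open>
  The exponent \<open>z\<close> need not be admissible at the critical speed: it may equal \<open>gamma_plus \<beta>\<close>, which is why
  only \<open>chi \<ge> 0\<close> is claimed.
\<close>

lemma chi_nonneg_at_critical_speed:
  assumes nn: "\<And>k. 0 \<le> \<beta> k" and sum: "(\<beta> has_sum 1) UNIV" and pos: "0 < D" "0 < d" "0 \<le> r" and gp: "d < gp"
    and gamma: "0 < gamma_plus \<beta>" "gamma_minus \<beta> < 0" and c: "cstar_plus D d r \<beta> gp \<le> c"
  obtains z where "0 < z" "laplace_summable \<beta> z" "0 \<le> chi D d r \<beta> gp z c"
proof -
  define S where "S = {c. \<exists>z>0. admissible_z D d \<beta> z c \<and> chi D d r \<beta> gp z c = 0}"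
  define e where "e n = 1 / real (Suc n)" for n
  have e: "0 < e n" "e n \<le> 1" for n by (auto simp: e_def)
  have e_lim: "e \<longlonglongrightarrow> 0"
    unfolding e_def[abs_def] using LIMSEQ_inverse_real_of_nat by (simp add: inverse_eq_divide)
  have "S \<noteq> {}" using ex_chi_root[OF nn pos _ gamma, of gp] gp pos unfolding S_def by force
  have "\<exists>z>0. laplace_summable \<beta> z \<and> 0 \<le> chi D d r \<beta> gp z (c + e n)" for n
  proof -
    have "\<exists>c'\<in>S. c' < c + e n"
      by (rule cInf_lessD) (use \<open>S \<noteq> {}\<close> c e[of n] in \<open>auto simp: S_def cstar_plus_def\<close>)
    then obtain c' z where *: "c' < c + e n" "0 < z" "admissible_z D d \<beta> z c'" "chi D d r \<beta> gp z c' = 0"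
      unfolding S_def by blast
    then have "laplace_summable \<beta> z"
      using laplace_summable_between_gammas[OF nn] by (simp add: admissible_z_def)
    moreover have "chi D d r \<beta> gp z c' \<le> chi D d r \<beta> gp z (c + e n)"
      by (rule chi_mono[OF nn]) (use * pos gp in auto)
    ultimately show ?thesis using * by auto
  qed
  then obtain z where z: "\<And>n. 0 < z n" "\<And>n. laplace_summable \<beta> (z n)" "\<And>n. 0 \<le> chi D d r \<beta> gp (z n) (c + e n)"
    by metis
  \<comment> \<open>The quadratic lower bound for \<open>exp\<close> beats the affine part of
    \<open>chi\<close>, so exponents at which \<open>chi\<close> is nonnegative stay bounded and a
    subsequence converges.\<close>
  define Z where "Z = max 1 (2 * (d + 2 * D + \<bar>c\<bar> + 1) / D)"
  have z_le: "z n \<le> Z" for n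
  proof (cases "z n \<le> 1")
    case False
    have "0 \<le> gp * exp (- (c + e n) * r * z n) * laplace_sum \<beta> (z n)"
      using gp pos laplace_sum_nonneg[OF nn] by simp
    then have "D * (exp (z n) + exp (- z n)) \<le> d + 2 * D + (c + e n) * z n"
      using z(3)[of n] unfolding chi_laplace_sum by linarith
    moreover have "D * ((z n)\<^sup>2 / 2) \<le> D * (exp (z n) + exp (- z n))"
      using exp_lower_Taylor_quadratic[of "z n"] z(1)[of n] pos
      by (intro mult_left_mono) (auto intro: add_increasing2)
    moreover have "(c + e n) * z n \<le> (\<bar>c\<bar> + 1) * z n"
      using e[of n] z(1)[of n] by (intro mult_right_mono) auto
    moreover have "(d + 2 * D) * 1 \<le> (d + 2 * D) * z n" using pos False by (intro mult_left_mono) auto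
    ultimately have "D * ((z n)\<^sup>2 / 2) \<le> (d + 2 * D + \<bar>c\<bar> + 1) * z n" by (simp add: algebra_simps)
    then have "(D * z n / 2) * z n \<le> (d + 2 * D + \<bar>c\<bar> + 1) * z n" by (simp add: power2_eq_square)
    then have "D * z n / 2 \<le> d + 2 * D + \<bar>c\<bar> + 1" using z(1)[of n] by (simp only: mult_le_cancel_right_pos)
    then have "z n \<le> 2 * (d + 2 * D + \<bar>c\<bar> + 1) / D" using pos by (simp add: field_simps)
    then show ?thesis by (simp add: Z_def)
  qed (simp add: Z_def)
  obtain l \<sigma> where \<sigma>: "strict_mono (\<sigma> :: nat \<Rightarrow> nat)" and lim: "(\<lambda>n. z (\<sigma> n)) \<longlonglongrightarrow> l" and l0: "0 \<le> l"
  proof -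
    have "\<forall>n. z n \<in> {0..Z}" using z(1) z_le by (simp add: less_imp_le)
    then obtain l \<sigma> where "l \<in> {0..Z}" "strict_mono (\<sigma> :: nat \<Rightarrow> nat)" "(z \<circ> \<sigma>) \<longlonglongrightarrow> l"
      using compact_imp_seq_compact[OF compact_Icc[of 0 Z]] unfolding seq_compact_def by metis
    then show ?thesis using that by (auto simp: o_def)
  qed
  have e_lim': "(\<lambda>n. e (\<sigma> n)) \<longlonglongrightarrow> 0" using LIMSEQ_subseq_LIMSEQ[OF e_lim \<sigma>] by (simp add: o_def)
  \<comment> \<open>The limit is taken with finite partial sums: the Laplace sum need not be
    continuous, or known to converge, at the edge of its strip, whereas bounds for all finite
    \<open>F\<close> pass to the limit and then give both summability and
    \<open>0 \<le> chi\<close>.\<close>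
  have fin: "D * (exp l + exp (- l)) + gp * exp (- c * r * l) * (\<Sum>k\<in>F. \<beta> k * exp (- l * real_of_int k)) \<le> d + 2 * D + c * l"
    if F: "finite F" for F
  proof (rule LIMSEQ_le)
    have "(\<lambda>n. D * (exp (z (\<sigma> n)) + exp (- z (\<sigma> n))) + gp * exp (- (c + e (\<sigma> n)) * r * z (\<sigma> n))
        * (\<Sum>k\<in>F. \<beta> k * exp (- z (\<sigma> n) * real_of_int k)))
      \<longlonglongrightarrow> D * (exp l + exp (- l)) + gp * exp (- (c + 0) * r * l) * (\<Sum>k\<in>F. \<beta> k * exp (- l * real_of_int k))"
      by (intro tendsto_intros lim e_lim')
    then show "(\<lambda>n. D * (exp (z (\<sigma> n)) + exp (- z (\<sigma> n))) + gp * exp (- (c + e (\<sigma> n)) * r * z (\<sigma> n))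
        * (\<Sum>k\<in>F. \<beta> k * exp (- z (\<sigma> n) * real_of_int k)))
      \<longlonglongrightarrow> D * (exp l + exp (- l)) + gp * exp (- c * r * l) * (\<Sum>k\<in>F. \<beta> k * exp (- l * real_of_int k))"
      by simp
    show "(\<lambda>n. d + 2 * D + (c + e (\<sigma> n)) * z (\<sigma> n)) \<longlonglongrightarrow> d + 2 * D + c * l"
      using e_lim' lim by (auto intro!: tendsto_eq_intros)
    have "D * (exp (z n) + exp (- z n)) + gp * exp (- (c + e n) * r * z n) * (\<Sum>k\<in>F. \<beta> k * exp (- z n * real_of_int k))
        \<le> d + 2 * D + (c + e n) * z n" for n
    proof -
      have "(\<Sum>k\<in>F. \<beta> k * exp (- z n * real_of_int k)) \<le> laplace_sum \<beta> (z n)"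
        unfolding laplace_sum_def by (rule finite_sum_le_infsum[OF z(2) F]) (use nn in auto)
      then have "gp * exp (- (c + e n) * r * z n) * (\<Sum>k\<in>F. \<beta> k * exp (- z n * real_of_int k))
          \<le> gp * exp (- (c + e n) * r * z n) * laplace_sum \<beta> (z n)"
        using gp pos by (intro mult_left_mono) auto
      then show ?thesis using z(3)[of n] unfolding chi_laplace_sum by linarith
    qed
    then show "\<exists>N. \<forall>n\<ge>N. D * (exp (z (\<sigma> n)) + exp (- z (\<sigma> n))) + gp * exp (- (c + e (\<sigma> n)) * r * z (\<sigma> n))
        * (\<Sum>k\<in>F. \<beta> k * exp (- z (\<sigma> n) * real_of_int k)) \<le> d + 2 * D + (c + e (\<sigma> n)) * z (\<sigma> n)"
      by blast
  qed
  \<comment> \<open>At \<open>l = 0\<close> the limiting inequality would bound every finite partial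
    sum of \<open>\<beta>\<close> by \<open>d / gp < 1\<close>, against total mass 1.\<close>
  have "l \<noteq> 0"
  proof
    assume "l = 0"
    have "1 \<le> d / gp"
    proof (rule has_sum_le_finite_sums[OF sum])
      fix F :: "int set" assume "finite F"
      from fin[OF this] show "sum \<beta> F \<le> d / gp" using \<open>l = 0\<close> gp pos by (simp add: field_simps)
    qed
    then show False using gp pos by (simp add: field_simps)
  qed
  then have l: "0 < l" using l0 by simp
  define R where "R = (d + 2 * D + c * l - D * (exp l + exp (- l))) / (gp * exp (- c * r * l))"
  have cf: "0 < gp * exp (- c * r * l)" using gp pos by simp
  have F_le: "(\<Sum>k\<in>F. \<beta> k * exp (- l * real_of_int k)) \<le> R" if "finite F" for F
  proof -
    have "(\<Sum>k\<in>F. \<beta> k * exp (- l * real_of_int k)) * (gp * exp (- c * r * l)) \<le> d + 2 * D + c * l - D * (exp l + exp (- l))"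
      using fin[OF that] by (simp add: mult.commute)
    then show ?thesis unfolding R_def by (simp only: pos_le_divide_eq[OF cf])
  qed
  have summ: "laplace_summable \<beta> l"
    by (rule nonneg_bdd_above_summable_on) (use nn F_le in \<open>auto intro!: bdd_aboveI[of _ R]\<close>)
  have "laplace_sum \<beta> l \<le> R"
    unfolding laplace_sum_def by (rule infsum_le_finite_sums[OF summ]) (use F_le in auto)
  then have "laplace_sum \<beta> l * (gp * exp (- c * r * l)) \<le> d + 2 * D + c * l - D * (exp l + exp (- l))"
    unfolding R_def by (simp only: pos_le_divide_eq[OF cf])
  then have "0 \<le> chi D d r \<beta> gp l c" unfolding chi_laplace_sum by (simp add: mult_ac)
  then show ?thesis using that l summ by blast
qed

text \<open>\<open>chi\<close> is concave in \<open>z\<close> and equals \<open>d - gp < 0\<close>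
  at 0, so it cannot be nonnegative on both sides of 0. This shows that the two speed ranges are
  disjoint.\<close>

lemma chi_not_nonneg_both_sides:
  assumes nn: "\<And>k. 0 \<le> \<beta> k" and sum: "(\<beta> has_sum 1) UNIV" and pos: "0 < D" "d < gp" "0 < gp"
    and z: "z1 < 0" "0 < z2" and summ: "laplace_summable \<beta> z1" "laplace_summable \<beta> z2"
    and chi: "0 \<le> chi D d r \<beta> gp z1 c" "0 \<le> chi D d r \<beta> gp z2 c"
  shows False
proof -
  define t where "t = - z1 / (z2 - z1)"
  have t: "0 \<le> t" "t \<le> 1" "t * z2 + (1 - t) * z1 = 0" using z by (auto simp: t_def field_simps)
  have pt: "1 \<le> t * exp (y * z2) + (1 - t) * exp (y * z1)" for y
  proof -
    have "t * (1 + y * z2) + (1 - t) * (1 + y * z1) \<le> t * exp (y * z2) + (1 - t) * exp (y * z1)"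
      using t by (intro add_mono mult_left_mono exp_ge_add_one_self) auto
    moreover have "t * (1 + y * z2) + (1 - t) * (1 + y * z1) = 1 + (t * z2 + (1 - t) * z1) * y" by algebra
    ultimately show ?thesis using t by simp
  qed
  have termwise: "\<beta> k \<le> t * (exp (- c * r * z2) * (\<beta> k * exp (- z2 * real_of_int k)))
      + (1 - t) * (exp (- c * r * z1) * (\<beta> k * exp (- z1 * real_of_int k)))" for k
  proof -
    have "\<beta> k * 1 \<le> \<beta> k * (t * exp ((- c * r - real_of_int k) * z2) + (1 - t) * exp ((- c * r - real_of_int k) * z1))"
      by (rule mult_left_mono[OF pt nn])
    also have "\<dots> = t * (exp (- c * r * z2) * (\<beta> k * exp (- z2 * real_of_int k)))
      + (1 - t) * (exp (- c * r * z1) * (\<beta> k * exp (- z1 * real_of_int k)))"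
      by (simp add: left_diff_distrib exp_diff exp_minus field_simps)
    finally show ?thesis by simp
  qed
  have s2: "((\<lambda>k. exp (- c * r * z2) * (\<beta> k * exp (- z2 * real_of_int k))) has_sum (exp (- c * r * z2) * laplace_sum \<beta> z2)) UNIV"
    unfolding laplace_sum_def by (intro has_sum_cmult_right has_sum_infsum summ)
  have s1: "((\<lambda>k. exp (- c * r * z1) * (\<beta> k * exp (- z1 * real_of_int k))) has_sum (exp (- c * r * z1) * laplace_sum \<beta> z1)) UNIV"
    unfolding laplace_sum_def by (intro has_sum_cmult_right has_sum_infsum summ)
  define Q1 where "Q1 = exp (- c * r * z1) * laplace_sum \<beta> z1"
  define Q2 where "Q2 = exp (- c * r * z2) * laplace_sum \<beta> z2"
  have "1 \<le> t * Q2 + (1 - t) * Q1"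
    unfolding Q1_def Q2_def
    by (rule has_sum_mono[OF sum has_sum_add[OF has_sum_cmult_right[OF s2] has_sum_cmult_right[OF s1]]])
       (rule termwise)
  then have Q: "gp * 1 \<le> gp * (t * Q2 + (1 - t) * Q1)" using pos by (intro mult_left_mono) auto
  have "2 \<le> t * (exp z2 + exp (- z2)) + (1 - t) * (exp z1 + exp (- z1))"
    using pt[of 1] pt[of "-1"] by (simp add: algebra_simps)
  then have C: "D * 2 \<le> D * (t * (exp z2 + exp (- z2)) + (1 - t) * (exp z1 + exp (- z1)))"
    using pos by (intro mult_left_mono) auto
  have "0 \<le> t * chi D d r \<beta> gp z2 c + (1 - t) * chi D d r \<beta> gp z1 c"
    using t chi by (intro add_nonneg_nonneg mult_nonneg_nonneg) auto
  also have "\<dots> = d + 2 * D + c * (t * z2 + (1 - t) * z1)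
      - D * (t * (exp z2 + exp (- z2)) + (1 - t) * (exp z1 + exp (- z1))) - gp * (t * Q2 + (1 - t) * Q1)"
    unfolding chi_laplace_sum Q1_def Q2_def by (simp add: algebra_simps)
  finally show False using C Q t(3) pos by simp
qed

section \<open>Semi-wavefronts\<close>

text \<open>The condition on the speed is replaced by a suitable exponent \<open>\<rho>\<close>, in
  which form the lemma also serves the reflected problem.\<close>

lemma semi_wavefront_vanishing_at_bot:
  fixes D d r gp \<zeta>1 \<zeta>2 c \<rho> :: real and \<beta> :: "int \<Rightarrow> real" and g :: "real \<Rightarrow> real"
  assumes pos: "0 < D" "0 < d" and beta_nonneg: "\<And>k. 0 \<le> \<beta> k" and beta_sum: "(\<beta> has_sum 1) UNIV"
    and g_cont: "continuous_on {0..} g" and g0: "g 0 = 0"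
    and g_deriv: "(g has_real_derivative gp) (at 0 within {0..})"
    and gamma: "0 < gamma_plus \<beta>" "gamma_minus \<beta> < 0"
    and zeta: "0 < \<zeta>1" "\<zeta>1 < \<zeta>2"
    and G_pos: "\<And>s. s > 0 \<Longrightarrow> g s / d > 0" and gp: "gp / d > 1"
    and G_bound: "\<And>s. s \<ge> 0 \<Longrightarrow> g s / d \<in> {0..\<zeta>2}"
    and G_min: "\<And>s. s \<in> {\<zeta>1..\<zeta>2} \<Longrightarrow> g \<zeta>1 / d \<le> g s / d"
    and G_above: "\<And>s. s \<in> {0<..\<zeta>1} \<Longrightarrow> g s / d > s"
    and g_sublin: "\<And>s. s \<ge> 0 \<Longrightarrow> g s \<le> gp * s"
    and c: "c \<noteq> 0" and \<rho>: "0 < \<rho>" "laplace_summable \<beta> \<rho>" "0 \<le> chi D d r \<beta> gp \<rho> c"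
  obtains \<phi> where "profile_eq D d r \<beta> g c \<phi>" "\<And>x. 0 < \<phi> x" "\<And>x. \<phi> x \<le> \<zeta>2" "(\<phi> \<longlongrightarrow> 0) at_bot"
    "Liminf at_top (\<lambda>s. ereal (\<phi> s)) > ereal \<zeta>1"
    "\<And>\<kappa>. {s. s \<ge> 0 \<and> g s / d = s} = {0, \<kappa>} \<Longrightarrow>
      (\<forall>s\<in>{0<..\<zeta>2}. (\<lambda>n. ((\<lambda>u. g u / d) ^^ n) s) \<longlonglongrightarrow> \<kappa>) \<Longrightarrow> (\<phi> \<longlongrightarrow> \<kappa>) at_top"
proof -
  define a where "a = 2 * D + d"
  define p where "p = 2 * D / a"
  define q where "q = d / a"
  \<comment> \<open>After division by \<open>a\<close> the lattice diffusion and the reaction term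
    have weights \<open>p\<close> and \<open>q\<close> with sum 1; the slope at 0 of the normalised
    reaction \<open>g s / d\<close> is then \<open>gp / d\<close>.\<close>
  define \<gamma> where "\<gamma> = gp / d"
  define G where "G s = g (max 0 s) / d" for s
  \<comment> \<open>The law of a symmetric nearest-neighbour step:
    \<open>D * (\<phi> (x + 1) + \<phi> (x - 1))\<close> is \<open>2 * D\<close> times the mean of
    the two neighbours.\<close>
  define \<beta>1 where "\<beta>1 k = (if k = 1 \<or> k = -1 then 1 / 2 else 0 :: real)" for k :: int
  have a: "0 < a" using pos by (simp add: a_def)
  have pq: "0 < p" "0 < q" "p + q = 1" "p * a = 2 * D" "q * a = d"
  proof -
    show "0 < p" "0 < q" "p * a = 2 * D" "q * a = d" using pos a by (simp_all add: p_def q_def)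
    have "p + q = (2 * D + d) / a" by (simp only: p_def q_def add_divide_distrib)
    then show "p + q = 1" using a by (simp add: a_def)
  qed
  have beta1_sum: "(\<beta>1 has_sum 1) UNIV"
    by (rule has_sum_finite_neutralI[of "{1, -1}"]) (auto simp: \<beta>1_def)
  interpret K1: lattice_kernel a c 0 \<beta>1
    by standard (use a beta1_sum in \<open>auto simp: \<beta>1_def\<close>)
  interpret K2: lattice_kernel a c "c * r" \<beta>
    by standard (use a beta_nonneg beta_sum in auto)
  have g_pos: "0 < gp" using gp pos by (simp add: field_simps)
  have L_nonneg: "0 \<le> gp * exp (- c * r * \<rho>) * laplace_sum \<beta> \<rho>"
    using g_pos laplace_sum_nonneg[OF beta_nonneg] by simp
  have chi': "D * (exp \<rho> + exp (- \<rho>)) + gp * exp (- c * r * \<rho>) * laplace_sum \<beta> \<rho> \<le> a + c * \<rho>"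
    using \<rho>(3) unfolding chi_laplace_sum a_def by linarith
  have "0 < D * (exp \<rho> + exp (- \<rho>))" using pos by (simp add: add_pos_pos)
  then have a\<rho>: "0 < a + c * \<rho>" using chi' L_nonneg by linarith
  have summ1: "laplace_summable \<beta>1 z" for z
    by (rule finite_nonzero_values_imp_summable_on)
       (rule finite_subset[of _ "{1, -1}"], auto simp: \<beta>1_def)
  have sum1: "(\<Sum>\<^sub>\<infinity>k. \<beta>1 k * f k) = (f 1 + f (-1)) / 2" for f
  proof -
    have "((\<lambda>k. \<beta>1 k * f k) has_sum (f 1 + f (-1)) / 2) UNIV"
      by (rule has_sum_finite_neutralI[of "{1, -1}"]) (auto simp: \<beta>1_def add_divide_distrib)
    then show ?thesis by (rule infsumI)
  qed
  obtain w where w: "0 < w" "0 < a + c * w" "0 < a - c * w" "laplace_summable \<beta> w" "laplace_summable \<beta> (- w)"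
  proof -
    obtain w1 where w1: "0 < w1" "ereal w1 < gamma_plus \<beta>" using ereal_dense2[OF gamma(1)] by auto
    obtain w2 where w2: "w2 < 0" "gamma_minus \<beta> < ereal w2" using ereal_dense2[OF gamma(2)] by auto
    \<comment> \<open>The first two bounds secure exponential moments of \<open>\<beta>\<close> on
      both sides; the third keeps \<open>\<bar>c * w\<bar> < a\<close>, so the exponential time has
      them too.\<close>
    define w where "w = min (min w1 (- w2)) (a / (2 * \<bar>c\<bar>))"
    have w: "0 < w" "w \<le> w1" "w \<le> - w2" "w \<le> a / (2 * \<bar>c\<bar>)" using w1 w2 a c by (auto simp: w_def)
    have "\<bar>c\<bar> * w \<le> \<bar>c\<bar> * (a / (2 * \<bar>c\<bar>))" using w by (intro mult_left_mono) auto
    then have cw: "\<bar>c * w\<bar> < a" using c a w by (simp add: abs_mult)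
    have s1: "laplace_summable \<beta> w1"
      by (rule laplace_summable_between_gammas[OF beta_nonneg])
         (use w1 gamma in \<open>auto intro: less_trans[of _ 0]\<close>)
    have s2: "laplace_summable \<beta> w2"
      by (rule laplace_summable_between_gammas[OF beta_nonneg])
         (use w2 gamma in \<open>auto intro: less_trans[of _ 0]\<close>)
    have between: "laplace_summable \<beta> y" if "w2 \<le> y" "y \<le> w1" for y
      by (rule laplace_summable_between[OF beta_nonneg s2 s1 that])
    show ?thesis
    proof (rule that[of w])
      show "laplace_summable \<beta> w" "laplace_summable \<beta> (- w)"
        by (rule between; use w w1 w2 in linarith)+
    qed (use w cw in auto)
  qed
  have G_eq: "G s = g s / d" if "0 \<le> s" for s using that by (simp add: G_def)
  interpret W: convolution_equation K1.Ker K2.Ker p q \<gamma> "a / \<bar>c\<bar>" \<zeta>1 \<zeta>2 \<rho> G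
  proof
    show "0 < p" "0 < q" "p + q = 1" "0 < \<zeta>1" "\<zeta>1 < \<zeta>2" "0 < \<rho>" using pq zeta \<rho> by auto
    show "(\<integral>\<^sup>+y. ennreal \<bar>y\<bar> \<partial>K1.Ker) < \<infinity>"
      by (rule K1.first_moment_Ker[of w]) (use w summ1[of w] summ1[of "- w"] in simp_all)
    show "(\<integral>\<^sup>+y. ennreal \<bar>y\<bar> \<partial>K2.Ker) < \<infinity>"
      by (rule K2.first_moment_Ker[of w]) (use w in simp_all)
    show "\<bar>conv K1.Ker f x - conv K1.Ker f x'\<bar> \<le> a / \<bar>c\<bar> * B * \<bar>x - x'\<bar>"
      if "f \<in> borel_measurable borel" "\<And>x. 0 \<le> f x" "\<And>x. f x \<le> B" for f B x x'
      by (rule K1.conv_Ker_lipschitz[OF c that])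
    show "\<bar>conv K2.Ker f x - conv K2.Ker f x'\<bar> \<le> a / \<bar>c\<bar> * B * \<bar>x - x'\<bar>"
      if "f \<in> borel_measurable borel" "\<And>x. 0 \<le> f x" "\<And>x. f x \<le> B" for f B x x'
      by (rule K2.conv_Ker_lipschitz[OF c that])
    \<comment> \<open>The drift \<open>c * t\<close> has the sign of \<open>c\<close>, so the
      interval is approached from the opposite neighbour: from \<open>-1\<close> when
      \<open>c > 0\<close>, from \<open>1\<close> when \<open>c < 0\<close>.\<close>
    show "0 < measure K1.Ker {u<..<v}" if uv: "-1 < u" "u < v" "v < 1" for u v
    proof (cases "0 < c")
      case True
      show ?thesis
        by (rule K1.Ker_charges[of "-1" "(u + 1) / c" "(v + 1) / c"])
           (use True uv in \<open>auto simp: \<beta>1_def field_simps\<close>)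
    next
      case False
      then have "c < 0" using c by simp
      then show ?thesis
        by (intro K1.Ker_charges[of 1 "(v - 1) / c" "(u - 1) / c"])
           (use uv in \<open>auto simp: \<beta>1_def field_simps\<close>)
    qed
    show "continuous_on UNIV G"
      unfolding G_def by (intro continuous_intros continuous_on_compose2[OF g_cont]) (use pos in auto)
    show "0 \<le> G s" "G s \<le> \<zeta>2" for s using G_bound[of "max 0 s"] by (auto simp: G_def)
    show "G s \<le> \<gamma> * s" if "0 \<le> s" for s
      using g_sublin[OF that] that pos by (simp add: G_def \<gamma>_def field_simps)
    show "1 < \<gamma>" using gp by (simp add: \<gamma>_def)
    show "\<exists>\<delta>>0. \<forall>s\<in>{0..\<delta>}. \<gamma>' * s \<le> G s" if "\<gamma>' < \<gamma>" for \<gamma>'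
    proof -
      have "((\<lambda>y. (g y - g 0) / (y - 0)) \<longlongrightarrow> gp) (at 0 within {0..})"
        using g_deriv by (simp add: has_field_derivative_iff)
      moreover have "\<gamma>' * d < gp" using that pos by (simp add: \<gamma>_def field_simps)
      ultimately have "eventually (\<lambda>y. \<gamma>' * d < (g y - g 0) / (y - 0)) (at 0 within {0..})"
        by (rule order_tendstoD)
      then obtain e where e: "0 < e" "\<And>y. 0 \<le> y \<Longrightarrow> y \<noteq> 0 \<Longrightarrow> \<bar>y\<bar> < e \<Longrightarrow> \<gamma>' * d < g y / y"
        unfolding eventually_at dist_real_def using g0 by auto
      have "\<gamma>' * s \<le> G s" if "s \<in> {0..e / 2}" for s
      proof (cases "s = 0")
        case False
        then have "\<gamma>' * d < g s / s" using e that by (intro e(2)) auto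
        then show ?thesis using that False pos by (auto simp: G_def field_simps)
      qed (simp add: G_def g0)
      then show ?thesis using e(1) by (intro exI[of _ "e / 2"]) auto
    qed
    show "0 < G s" if "0 < s" for s using G_pos[OF that] that by (simp add: G_def)
    show "s < G s" if "0 < s" "s \<le> \<zeta>1" for s using G_above[of s] that by (simp add: G_def)
    show "G \<zeta>1 \<le> G s" if "\<zeta>1 \<le> s" "s \<le> \<zeta>2" for s using G_min[of s] that zeta by (simp add: G_def)
    show "ennreal p * (\<integral>\<^sup>+y. ennreal (exp (- \<rho> * y)) \<partial>K1.Ker)
      + ennreal (q * \<gamma>) * (\<integral>\<^sup>+y. ennreal (exp (- \<rho> * y)) \<partial>K2.Ker) \<le> 1"
    proof -
      define L1 where "L1 = a / (a + c * \<rho>) * exp (- \<rho> * 0) * ((exp (- \<rho>) + exp \<rho>) / 2)"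
      define L2 where "L2 = a / (a + c * \<rho>) * exp (- \<rho> * (c * r)) * laplace_sum \<beta> \<rho>"
      have "(\<integral>\<^sup>+y. ennreal (exp (- \<rho> * y)) \<partial>K1.Ker) = ennreal L1"
        unfolding K1.laplace_Ker[OF a\<rho> summ1] L1_def sum1 by simp
      moreover have "(\<integral>\<^sup>+y. ennreal (exp (- \<rho> * y)) \<partial>K2.Ker) = ennreal L2"
        unfolding K2.laplace_Ker[OF a\<rho> \<rho>(2)] L2_def laplace_sum_def ..
      moreover have "0 \<le> L1" "0 \<le> L2"
        using a a\<rho> laplace_sum_nonneg[OF beta_nonneg] by (auto simp: L1_def L2_def)
      moreover have "0 < \<gamma>" using gp by (simp add: \<gamma>_def)
      then have "0 \<le> q * \<gamma>" using pq(2) by simp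
      \<comment> \<open>Multiplied by \<open>a + c * \<rho>\<close>, this is exactly
        \<open>0 \<le> chi D d r \<beta> gp \<rho> c\<close>.\<close>
      moreover have "p * L1 + (q * \<gamma>) * L2 \<le> 1"
      proof -
        have "p * L1 + (q * \<gamma>) * L2
          = ((p * a) * ((exp (- \<rho>) + exp \<rho>) / 2) + (q * a) * \<gamma> * (exp (- \<rho> * (c * r)) * laplace_sum \<beta> \<rho>)) / (a + c * \<rho>)"
          unfolding L1_def L2_def by (simp add: add_divide_distrib mult_ac)
        also have "\<dots> = (D * (exp \<rho> + exp (- \<rho>)) + gp * exp (- c * r * \<rho>) * laplace_sum \<beta> \<rho>) / (a + c * \<rho>)"
          unfolding pq using pos by (simp add: \<gamma>_def mult_ac add.commute)
        also have "\<dots> \<le> 1" using chi' a\<rho> by simp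
        finally show ?thesis .
      qed
      ultimately show ?thesis
        using pq by (simp add: ennreal_le_1 flip: ennreal_mult ennreal_plus)
    qed
  qed
  obtain \<phi> where \<phi>: "W.adm \<phi>" "W.A \<phi> = \<phi>" "\<And>x. 0 < \<phi> x" "continuous_on UNIV \<phi>" "(\<phi> \<longlongrightarrow> 0) at_bot"
    and above: "\<exists>z>\<zeta>1. eventually (\<lambda>x. z \<le> \<phi> x) at_top"
    and conv: "\<And>\<kappa>. {s. 0 \<le> s \<and> G s = s} = {0, \<kappa>} \<Longrightarrow>
      (\<And>s. 0 < s \<Longrightarrow> s \<le> \<zeta>2 \<Longrightarrow> (\<lambda>n. (G ^^ n) s) \<longlonglongrightarrow> \<kappa>) \<Longrightarrow> (\<phi> \<longlongrightarrow> \<kappa>) at_top"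
    using W.wave_exists by blast
  show ?thesis
  proof (rule that[of \<phi>])
    show "0 < \<phi> x" "\<phi> x \<le> \<zeta>2" for x using \<phi> W.admD by auto
    show "(\<phi> \<longlongrightarrow> 0) at_bot" by fact
    show "Liminf at_top (\<lambda>s. ereal (\<phi> s)) > ereal \<zeta>1"
    proof -
      obtain z where z: "\<zeta>1 < z" "eventually (\<lambda>x. z \<le> \<phi> x) at_top" using above by blast
      then have "ereal z \<le> Liminf at_top (\<lambda>s. ereal (\<phi> s))" by (intro Liminf_bounded) simp
      then show ?thesis using z(1) by (metis ereal_less_eq(3) less_le_trans less_ereal.simps(1))
    qed
    show "(\<phi> \<longlongrightarrow> \<kappa>) at_top"
      if fix_only: "{s. s \<ge> 0 \<and> g s / d = s} = {0, \<kappa>}"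
        and attract: "\<forall>s\<in>{0<..\<zeta>2}. (\<lambda>n. ((\<lambda>u. g u / d) ^^ n) s) \<longlonglongrightarrow> \<kappa>" for \<kappa>
    proof (rule conv)
      show "{s. 0 \<le> s \<and> G s = s} = {0, \<kappa>}"
        unfolding fix_only[symmetric] by (auto simp: G_eq)
      \<comment> \<open>Iterates remain nonnegative, where the extended \<open>G\<close> agrees with
        \<open>g s / d\<close>.\<close>
      have "(G ^^ n) s = ((\<lambda>u. g u / d) ^^ n) s \<and> 0 \<le> (G ^^ n) s" if "0 \<le> s" for n s
      proof (induction n)
        case (Suc n)
        then show ?case using G_eq[of "(G ^^ n) s"] G_bound[of "(G ^^ n) s"] by auto
      qed (use that in simp)
      then show "(\<lambda>n. (G ^^ n) s) \<longlonglongrightarrow> \<kappa>" if "0 < s" "s \<le> \<zeta>2" for s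
        using attract that by auto
    qed
    show "profile_eq D d r \<beta> g c \<phi>"
      unfolding profile_eq_def
    proof (intro allI conjI)
      fix x
      define h1 where "h1 = K1.lattice_avg \<phi> x"
      define h2 where "h2 = K2.lattice_avg (\<lambda>s. G (\<phi> s)) x"
      have G\<phi>_cont: "continuous_on UNIV (\<lambda>s. G (\<phi> s))"
        using continuous_on_compose2[OF W.G_cont \<phi>(4)] by auto
      have "(W.A \<phi> has_real_derivative
          p * (a / c * (h1 - conv K1.Ker \<phi> x)) + q * (a / c * (h2 - conv K2.Ker (\<lambda>s. G (\<phi> s)) x))) (at x)"
        unfolding W.A_def[abs_def] h1_def h2_def
        by (intro DERIV_add DERIV_cmult K1.conv_Ker_derivative[OF c \<phi>(4), of \<zeta>2]
            K2.conv_Ker_derivative[OF c G\<phi>_cont, of \<zeta>2]) (use W.admD[OF \<phi>(1)] in auto)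
      then have der: "(\<phi> has_real_derivative
          p * (a / c * (h1 - conv K1.Ker \<phi> x)) + q * (a / c * (h2 - conv K2.Ker (\<lambda>s. G (\<phi> s)) x))) (at x)"
        unfolding \<phi>(2) .
      then show "\<phi> differentiable at x" using real_differentiable_def by blast
      have "c * deriv \<phi> x = p * a * h1 + q * a * h2 - a * (p * conv K1.Ker \<phi> x + q * conv K2.Ker (\<lambda>s. G (\<phi> s)) x)"
        unfolding DERIV_imp_deriv[OF der] using c by (simp add: algebra_simps)
      also have "p * conv K1.Ker \<phi> x + q * conv K2.Ker (\<lambda>s. G (\<phi> s)) x = \<phi> x"
        using fun_cong[OF \<phi>(2), of x] unfolding W.A_def .
      finally have eq: "c * deriv \<phi> x = 2 * D * h1 + d * h2 - a * \<phi> x" unfolding pq .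
      have "h1 = (\<phi> (x - 1) + \<phi> (x + 1)) / 2"
        unfolding h1_def K1.lattice_avg_eq[of \<phi> \<zeta>2, OF W.admD(4)[OF \<phi>(1)]] sum1 by simp
      moreover have "d * h2 = (\<Sum>\<^sub>\<infinity>k. \<beta> k * g (\<phi> (x - real_of_int k - c * r)))"
      proof -
        have "h2 = (\<Sum>\<^sub>\<infinity>k. \<beta> k * G (\<phi> (x - real_of_int k - c * r)))"
          unfolding h2_def by (rule K2.lattice_avg_eq[of _ \<zeta>2]) (use W.admD[OF \<phi>(1)] in auto)
        also have "d * \<dots> = (\<Sum>\<^sub>\<infinity>k. d * (\<beta> k * G (\<phi> (x - real_of_int k - c * r))))"
          by (rule infsum_cmult_right'[symmetric])
        also have "\<dots> = (\<Sum>\<^sub>\<infinity>k. \<beta> k * g (\<phi> (x - real_of_int k - c * r)))"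
          using pos W.admD(2)[OF \<phi>(1)] by (intro infsum_cong) (simp add: G_eq)
        finally show ?thesis .
      qed
      ultimately show "c * deriv \<phi> x = D * (\<phi> (x + 1) + \<phi> (x - 1) - 2 * \<phi> x) - d * \<phi> x
          + (\<Sum>\<^sub>\<infinity>k. \<beta> k * g (\<phi> (x - real_of_int k - c * r)))"
        using eq by (simp add: a_def algebra_simps)
    qed
  qed
qed

lemma profile_eq_reflect:
  assumes "profile_eq D d r (\<lambda>k. \<beta> (- k)) g (- c) \<phi>"
  shows "profile_eq D d r \<beta> g c (\<lambda>x. \<phi> (- x))"
  unfolding profile_eq_def
proof (intro allI conjI)
  fix x
  have \<phi>: "\<phi> differentiable at (- x)"
    "- c * deriv \<phi> (- x) = D * (\<phi> (- x + 1) + \<phi> (- x - 1) - 2 * \<phi> (- x)) - d * \<phi> (- x)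
       + (\<Sum>\<^sub>\<infinity>k. \<beta> (- k) * g (\<phi> (- x - real_of_int k - (- c) * r)))"
    using assms unfolding profile_eq_def by blast+
  have "(\<phi> has_real_derivative deriv \<phi> (- x)) (at (- x))"
    using \<phi>(1) DERIV_deriv_iff_real_differentiable by blast
  then have der: "((\<lambda>x. \<phi> (- x)) has_real_derivative - deriv \<phi> (- x)) (at x)"
    using DERIV_mirror[of \<phi> "deriv \<phi> (- x)" x] by simp
  then show "(\<lambda>x. \<phi> (- x)) differentiable at x" using real_differentiable_def by blast
  have bij: "bij_betw uminus (UNIV :: int set) UNIV" by (rule bij_uminus)
  have "(\<Sum>\<^sub>\<infinity>k. \<beta> (- k) * g (\<phi> (- x - real_of_int k - (- c) * r)))
      = (\<Sum>\<^sub>\<infinity>k. \<beta> k * g (\<phi> (- (x - real_of_int k - c * r))))"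
    using infsum_reindex_bij_betw[OF bij, of "\<lambda>k. \<beta> k * g (\<phi> (- (x - real_of_int k - c * r)))"]
    by (simp add: algebra_simps)
  moreover have "\<phi> (- x - 1) = \<phi> (- 1 - x)" by (rule arg_cong[of _ _ \<phi>]) simp
  ultimately show "c * deriv (\<lambda>x. \<phi> (- x)) x = D * (\<phi> (- (x + 1)) + \<phi> (- (x - 1)) - 2 * \<phi> (- x)) - d * \<phi> (- x)
      + (\<Sum>\<^sub>\<infinity>k. \<beta> k * g (\<phi> (- (x - real_of_int k - c * r))))"
    using \<phi>(2) unfolding DERIV_imp_deriv[OF der] by (simp add: algebra_simps)
qed

theorem theorem5p5:
  fixes D d r gp \<zeta>1 \<zeta>2 :: real and \<beta> :: "int \<Rightarrow> real" and g :: "real \<Rightarrow> real"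
  assumes D_pos: "D > 0" and d_pos: "d > 0" and r_nonneg: "r \<ge> 0"
    and beta_nonneg: "\<And>k. \<beta> k \<ge> 0" and beta_sum: "(\<beta> has_sum 1) UNIV"
    and g_cont: "continuous_on {0..} g" and g_nonneg: "\<And>s. s \<ge> 0 \<Longrightarrow> g s \<ge> 0"
    and g0: "g 0 = 0"
    and g_deriv: "(g has_real_derivative gp) (at 0 within {0..})"
    and gamma: "gamma_plus \<beta> > 0" "gamma_minus \<beta> < 0"
    and zeta: "0 < \<zeta>1" "\<zeta>1 < \<zeta>2"
    and G_cont: "continuous_on {0..} (\<lambda>s. g s / d)"
    and G_pos: "\<And>s. s > 0 \<Longrightarrow> g s / d > 0"
    and G_deriv: "gp / d > 1"
    and G_inv: "\<And>s. s \<in> {\<zeta>1..\<zeta>2} \<Longrightarrow> g s / d \<in> {\<zeta>1..\<zeta>2}"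
    and G_bound: "\<And>s. s \<ge> 0 \<Longrightarrow> g s / d \<in> {0..\<zeta>2}"
    and G_min: "\<And>s. s \<in> {\<zeta>1..\<zeta>2} \<Longrightarrow> g \<zeta>1 / d \<le> g s / d"
    and G_above: "\<And>s. s \<in> {0<..\<zeta>1} \<Longrightarrow> g s / d > s"
    and g_sublin: "\<And>s. s \<ge> 0 \<Longrightarrow> g s \<le> gp * s"
    and c_range: "c \<le> cstar_minus D d r \<beta> gp \<or> c \<ge> cstar_plus D d r \<beta> gp" and c_ne: "c \<noteq> 0"
  shows "\<exists>\<phi>. semi_wavefront D d r \<beta> g c \<phi> \<and> (\<forall>x. \<phi> x \<le> \<zeta>2) \<and>
     (c \<le> cstar_minus D d r \<beta> gp \<longrightarrow>
        (\<phi> \<longlongrightarrow> 0) at_top \<and> Liminf at_bot (\<lambda>s. ereal (\<phi> s)) > ereal \<zeta>1) \<and>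
     (c \<ge> cstar_plus D d r \<beta> gp \<longrightarrow>
        (\<phi> \<longlongrightarrow> 0) at_bot \<and> Liminf at_top (\<lambda>s. ereal (\<phi> s)) > ereal \<zeta>1) \<and>
     (\<forall>\<kappa>. ({s. s \<ge> 0 \<and> g s / d = s} = {0, \<kappa>} \<and>
           (\<forall>s\<in>{0<..\<zeta>2}. (\<lambda>n. ((\<lambda>u. g u / d) ^^ n) s) \<longlonglongrightarrow> \<kappa>)) \<longrightarrow>
        (c \<le> cstar_minus D d r \<beta> gp \<longrightarrow> (\<phi> \<longlongrightarrow> \<kappa>) at_bot) \<and>
        (c \<ge> cstar_plus D d r \<beta> gp \<longrightarrow> (\<phi> \<longlongrightarrow> \<kappa>) at_top))"
proof -
  have gp: "d < gp" "0 < gp" using G_deriv d_pos by (auto simp: field_simps)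
  let ?\<beta>' = "\<lambda>k. \<beta> (- k)"
  have sum': "(?\<beta>' has_sum 1) UNIV"
    using has_sum_reindex_bij_betw[OF bij_uminus, of \<beta> 1] beta_sum by simp
  have gamma': "0 < gamma_plus ?\<beta>'" "gamma_minus ?\<beta>' < 0"
    using gamma ereal_uminus_less_reorder[of "gamma_plus \<beta>" 0]
    by (simp_all add: gamma_plus_reflect[of \<beta>] gamma_minus_reflect[of \<beta>])
  have plus: "\<exists>z>0. laplace_summable \<beta> z \<and> 0 \<le> chi D d r \<beta> gp z c" if "cstar_plus D d r \<beta> gp \<le> c"
    using chi_nonneg_at_critical_speed[OF beta_nonneg beta_sum D_pos d_pos r_nonneg gp(1) gamma that] by blast
  have minus: "\<exists>z>0. laplace_summable ?\<beta>' z \<and> 0 \<le> chi D d r ?\<beta>' gp z (- c)" if "c \<le> cstar_minus D d r \<beta> gp"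
  proof -
    have "cstar_plus D d r ?\<beta>' gp \<le> - c" using that by (simp add: cstar_plus_reflect[of D d r \<beta>])
    from chi_nonneg_at_critical_speed[OF beta_nonneg sum' D_pos d_pos r_nonneg gp(1) gamma' this]
    show ?thesis by blast
  qed
  \<comment> \<open>A single profile has to satisfy the implications for both speed ranges;
    disjointness of the ranges makes one of them vacuous.\<close>
  have excl: "\<not> (cstar_plus D d r \<beta> gp \<le> c \<and> c \<le> cstar_minus D d r \<beta> gp)"
  proof
    assume both: "cstar_plus D d r \<beta> gp \<le> c \<and> c \<le> cstar_minus D d r \<beta> gp"
    obtain z where z: "0 < z" "laplace_summable \<beta> z" "0 \<le> chi D d r \<beta> gp z c"
      using plus both by blast
    obtain z' where z': "0 < z'" "laplace_summable \<beta> (- z')" "0 \<le> chi D d r \<beta> gp (- z') c"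
      using minus both unfolding laplace_summable_reflect[of \<beta>] chi_reflect[of D d r \<beta>] minus_minus by blast
    show False
      by (rule chi_not_nonneg_both_sides[OF beta_nonneg beta_sum D_pos gp _ z(1) z'(2) z(2) z'(3) z(3)])
         (use z'(1) in simp)
  qed
  show ?thesis
  proof (cases "cstar_plus D d r \<beta> gp \<le> c")
    case True
    obtain z where z: "0 < z" "laplace_summable \<beta> z" "0 \<le> chi D d r \<beta> gp z c" using plus[OF True] by blast
    obtain \<phi> where \<phi>: "profile_eq D d r \<beta> g c \<phi>" "\<And>x. 0 < \<phi> x" "\<And>x. \<phi> x \<le> \<zeta>2" "(\<phi> \<longlongrightarrow> 0) at_bot"
      "Liminf at_top (\<lambda>s. ereal (\<phi> s)) > ereal \<zeta>1"
      "\<And>\<kappa>. {s. s \<ge> 0 \<and> g s / d = s} = {0, \<kappa>} \<Longrightarrow>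
        (\<forall>s\<in>{0<..\<zeta>2}. (\<lambda>n. ((\<lambda>u. g u / d) ^^ n) s) \<longlonglongrightarrow> \<kappa>) \<Longrightarrow> (\<phi> \<longlongrightarrow> \<kappa>) at_top"
      using semi_wavefront_vanishing_at_bot[OF D_pos d_pos beta_nonneg beta_sum g_cont g0 g_deriv gamma zeta
          G_pos G_deriv G_bound G_min G_above g_sublin c_ne z] by blast
    have "bounded (range \<phi>)"
      by (rule boundedI[of _ \<zeta>2]) (use \<phi>(2,3) in \<open>auto simp: abs_of_pos\<close>)
    then show ?thesis
      using \<phi> True excl by (intro exI[of _ \<phi>]) (auto simp: semi_wavefront_def)
  next
    case False
    then have le: "c \<le> cstar_minus D d r \<beta> gp" using c_range by auto
    obtain z where z: "0 < z" "laplace_summable ?\<beta>' z" "0 \<le> chi D d r ?\<beta>' gp z (- c)" using minus[OF le] by blast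
    have c_ne': "- c \<noteq> 0" using c_ne by simp
    obtain \<phi> where \<phi>: "profile_eq D d r ?\<beta>' g (- c) \<phi>" "\<And>x. 0 < \<phi> x" "\<And>x. \<phi> x \<le> \<zeta>2" "(\<phi> \<longlongrightarrow> 0) at_bot"
      "Liminf at_top (\<lambda>s. ereal (\<phi> s)) > ereal \<zeta>1"
      "\<And>\<kappa>. {s. s \<ge> 0 \<and> g s / d = s} = {0, \<kappa>} \<Longrightarrow>
        (\<forall>s\<in>{0<..\<zeta>2}. (\<lambda>n. ((\<lambda>u. g u / d) ^^ n) s) \<longlonglongrightarrow> \<kappa>) \<Longrightarrow> (\<phi> \<longlongrightarrow> \<kappa>) at_top"
      using semi_wavefront_vanishing_at_bot[OF D_pos d_pos beta_nonneg sum' g_cont g0 g_deriv gamma' zeta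
          G_pos G_deriv G_bound G_min G_above g_sublin c_ne' z] by blast
    have "bounded (range (\<lambda>x. \<phi> (- x)))"
      by (rule boundedI[of _ \<zeta>2]) (use \<phi>(2,3) in \<open>auto simp: abs_of_pos\<close>)
    moreover have "((\<lambda>x. \<phi> (- x)) \<longlongrightarrow> 0) at_top"
      using \<phi>(4) by (simp add: filterlim_at_bot_mirror)
    moreover have "Liminf at_bot (\<lambda>s. ereal (\<phi> (- s))) > ereal \<zeta>1"
      using \<phi>(5) by (simp add: at_bot_mirror Liminf_filtermap_eq)
    moreover have "((\<lambda>x. \<phi> (- x)) \<longlongrightarrow> \<kappa>) at_bot" if "(\<phi> \<longlongrightarrow> \<kappa>) at_top" for \<kappa>
      using that by (simp add: filterlim_at_top_mirror)
    ultimately show ?thesis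
      using \<phi> profile_eq_reflect[OF \<phi>(1)] False le
      by (intro exI[of _ "\<lambda>x. \<phi> (- x)"]) (auto simp: semi_wavefront_def)
  qed
qed

end
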